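(* The Hawaiian earring group $\mathrm{HEG}$ is acylindrically hyperbolic, its elliptic radical $\mathrm{Rad}_{\mathrm{Ell}}(\mathrm{HEG})$ is trivial, and $\mathrm{HEG}$ does not admit any universal acylindrical action (on any hyperbolic space).
   Context: The Hawaiian earring group $\mathrm{HEG}$ is the fundamental group, at the basepoint $(0,0)$, of $\bigcup_{n\geqslant 1}C_n\subset\mathbb{R}^2$ (with the subspace topology), where $C_n$ is the circle with center $(-\frac1n,0)$ and radius $\frac1n$. Combinatorially: let $A=\{a_n^{\pm1}\}_{n\in\mathbb{N}}$ be letters with formal inverses. A word is a map $w:X\to A$ with $X$ totally ordered such that $\{i\in X\mid w(i)=a\}$ is finite for each $a\in A$; words are identified if they differ by an order isomorphism of domains. For $n\geqslant 0$ let $p_n(w)$ be the restriction of $w$ to $\{i\mid w(i)\in\{a_1^{\pm1},\dots,a_n^{\pm1}\}\}$, a finite word, regarded as an element of the free group $F_n$ on $a_1,\dots,a_n$. Put $w\sim u$ if $p_n(w)=p_n(u)$ in $F_n$ for all $n$. Then $\mathrm{HEG}$ is the set of $\sim$-classes with multiplication induced by concatenation. All group actions on metric spaces are by isometries. A hyperbolic space is a geodesic metric space which is Gromov hyperbolic. An action of $G$ on a metric space $(S,d)$ is acylindrical if for each $\epsilon>0$ there exist $R,N>0$ such that for all $p,q\in S$ with $d(p,q)\geqslant R$ the set $\{g\in G\mid d(p,gp)\leqslant\epsilon \text{ and } d(q,gq)\leqslant\epsilon\}$ has at most $N$ elements. An action on a hyperbolic space is elementary if the limit set of $G$ on the Gromov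 boundary contains at most 2 points. A group is acylindrically hyperbolic if it admits a non-elementary acylindrical action on a hyperbolic space. An element $g$ is elliptic for an action if some (equivalently, every) orbit of $\langle g\rangle$ is bounded. The elliptic radical $\mathrm{Rad}_{\mathrm{Ell}}(G)$ is the set of all $g\in G$ which are elliptic for every acylindrical action of $G$ on every hyperbolic space. An action of $G$ on a hyperbolic space is universal acylindrical if it is acylindrical and the set of elliptic elements of this action coincides with $\mathrm{Rad}_{\mathrm{Ell}}(G)$. *)

theory Defs
  imports "HOL-Analysis.Analysis" "HOL-Algebra.Group_Action"
begin

section \<open>The Hawaiian earring group\<close>

text \<open>The letter \<open>(k, True)\<close> is \<open>a\<^bsub>k+1\<^esub>\<close>, and \<open>(k, False)\<close> is its formal inverse.  So the letters
  \<open>a\<^sub>1\<^sup>\<plusminus>, \<dots>, a\<^sub>n\<^sup>\<plusminus>\<close> are those with first component below \<open>n\<close>.\<close>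

type_synonym letter = "nat \<times> bool"

definition inv_letter :: "letter \<Rightarrow> letter" where
  "inv_letter a = (fst a, \<not> snd a)"

definition letters_upto :: "nat \<Rightarrow> letter set" where
  "letters_upto n = {a. fst a < n}"

text \<open>\<open>free_eq n\<close> is equality in the free group \<open>F\<^sub>n\<close>, whose elements are represented by finite
  words in the letters \<open>a\<^sub>1\<^sup>\<plusminus>, \<dots>, a\<^sub>n\<^sup>\<plusminus>\<close>.\<close>

definition cancel_step :: "nat \<Rightarrow> letter list rel" where
  "cancel_step n = {(xs @ [a, inv_letter a] @ ys, xs @ ys) | xs a ys.
     xs \<in> lists (letters_upto n) \<and> a \<in> letters_upto n \<and> ys \<in> lists (letters_upto n)}"

definition free_eq :: "nat \<Rightarrow> letter list rel" where
  "free_eq n = (cancel_step n \<union> (cancel_step n)\<inverse>)\<^sup>*"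

text \<open>A word consists of a set of positions, a total order on it and a labelling by letters.  Each
  letter occurs finitely often and there are countably many letters, so the set of positions is
  countable; hence every word is order isomorphic to one whose positions are natural numbers (with
  an arbitrary total order, unrelated to the usual one).  Values of the labelling outside the set
  of positions are irrelevant.  Order isomorphic words have the same projections, so they are
  identified in the quotient below.\<close>

datatype word = Word (positions: "nat set") (ord: "nat rel") (label: "nat \<Rightarrow> letter")

definition is_word :: "word \<Rightarrow> bool" where
  "is_word w \<longleftrightarrow> linear_order_on (positions w) (ord w) \<and>
     (\<forall>a. finite {i \<in> positions w. label w i = a})"

definition word_proj :: "nat \<Rightarrow> word \<Rightarrow> letter list" where
  "word_proj n w = map (label w)
     (THE is. distinct is \<and> set is = {i \<in> positions w. label w i \<in> letters_upto n} \<and>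
       sorted_wrt (\<lambda>i j. (i, j) \<in> ord w) is)"

definition word_rel :: "word rel" where
  "word_rel = {(u, v). is_word u \<and> is_word v \<and>
     (\<forall>n. (word_proj n u, word_proj n v) \<in> free_eq n)}"

definition empty_word :: word where
  "empty_word = Word {} {} (\<lambda>_. (0, True))"

text \<open>The positions of the concatenation are the disjoint sum, re-encoded in the natural numbers.\<close>

definition word_append :: "word \<Rightarrow> word \<Rightarrow> word" where
  "word_append u v = Word
     (sum_encode ` (positions u <+> positions v))
     ({(sum_encode (Inl i), sum_encode (Inl j)) | i j. (i, j) \<in> ord u} \<union>
      {(sum_encode (Inr i), sum_encode (Inr j)) | i j. (i, j) \<in> ord v} \<union>
      {(sum_encode (Inl i), sum_encode (Inr j)) | i j. i \<in> positions u \<and> j \<in> positions v})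
     (\<lambda>k. case sum_decode k of Inl i \<Rightarrow> label u i | Inr j \<Rightarrow> label v j)"

definition HEG :: "word set monoid" where
  "HEG = \<lparr>carrier = {w. is_word w} // word_rel,
     mult = (\<lambda>x y. \<Union>u\<in>x. \<Union>v\<in>y. word_rel `` {word_append u v}),
     one = word_rel `` {empty_word}\<rparr>"


section \<open>Hyperbolic spaces and their boundary\<close>

definition geodesic_space :: "'s set \<Rightarrow> ('s \<Rightarrow> 's \<Rightarrow> real) \<Rightarrow> bool" where
  "geodesic_space S d \<longleftrightarrow> Metric_space S d \<and>
     (\<forall>x\<in>S. \<forall>y\<in>S. \<exists>\<gamma>. \<gamma> 0 = x \<and> \<gamma> (d x y) = y \<and> \<gamma> \<in> {0..d x y} \<rightarrow> S \<and>
        (\<forall>s\<in>{0..d x y}. \<forall>t\<in>{0..d x y}. d (\<gamma> s) (\<gamma> t) = \<bar>s - t\<bar>))"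

definition gromov_product :: "('s \<Rightarrow> 's \<Rightarrow> real) \<Rightarrow> 's \<Rightarrow> 's \<Rightarrow> 's \<Rightarrow> real" where
  "gromov_product d p x y = (d p x + d p y - d x y) / 2"

definition gromov_hyperbolic :: "'s set \<Rightarrow> ('s \<Rightarrow> 's \<Rightarrow> real) \<Rightarrow> bool" where
  "gromov_hyperbolic S d \<longleftrightarrow> (\<exists>\<delta>\<ge>0. \<forall>p\<in>S. \<forall>x\<in>S. \<forall>y\<in>S. \<forall>z\<in>S.
     gromov_product d p x z \<ge> min (gromov_product d p x y) (gromov_product d p y z) - \<delta>)"

text \<open>Spaces are non-empty, so that boundedness of some orbit and of every orbit agree.\<close>

definition hyperbolic_space :: "'s set \<Rightarrow> ('s \<Rightarrow> 's \<Rightarrow> real) \<Rightarrow> bool" where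
  "hyperbolic_space S d \<longleftrightarrow> S \<noteq> {} \<and> geodesic_space S d \<and> gromov_hyperbolic S d"

definition converges_to_infinity :: "'s set \<Rightarrow> ('s \<Rightarrow> 's \<Rightarrow> real) \<Rightarrow> (nat \<Rightarrow> 's) \<Rightarrow> bool" where
  "converges_to_infinity S d s \<longleftrightarrow> range s \<subseteq> S \<and>
     (\<forall>p\<in>S. filterlim (\<lambda>(i, j). gromov_product d p (s i) (s j)) at_top
        (sequentially \<times>\<^sub>F sequentially))"

definition boundary_rel :: "'s set \<Rightarrow> ('s \<Rightarrow> 's \<Rightarrow> real) \<Rightarrow> (nat \<Rightarrow> 's) rel" where
  "boundary_rel S d = {(s, t). converges_to_infinity S d s \<and> converges_to_infinity S d t \<and>
     (\<forall>p\<in>S. filterlim (\<lambda>n. gromov_product d p (s n) (t n)) at_top sequentially)}"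

definition gromov_boundary :: "'s set \<Rightarrow> ('s \<Rightarrow> 's \<Rightarrow> real) \<Rightarrow> (nat \<Rightarrow> 's) set set" where
  "gromov_boundary S d = {s. converges_to_infinity S d s} // boundary_rel S d"


section \<open>Acylindrical actions\<close>

definition isometric_action ::
    "('g, 'm) monoid_scheme \<Rightarrow> 's set \<Rightarrow> ('s \<Rightarrow> 's \<Rightarrow> real) \<Rightarrow> ('g \<Rightarrow> 's \<Rightarrow> 's) \<Rightarrow> bool" where
  "isometric_action G S d \<phi> \<longleftrightarrow> Metric_space S d \<and> group_action G S \<phi> \<and>
     (\<forall>g\<in>carrier G. \<forall>x\<in>S. \<forall>y\<in>S. d (\<phi> g x) (\<phi> g y) = d x y)"

definition acylindrical_action ::
    "('g, 'm) monoid_scheme \<Rightarrow> 's set \<Rightarrow> ('s \<Rightarrow> 's \<Rightarrow> real) \<Rightarrow> ('g \<Rightarrow> 's \<Rightarrow> 's) \<Rightarrow> bool" where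
  "acylindrical_action G S d \<phi> \<longleftrightarrow> isometric_action G S d \<phi> \<and>
     (\<forall>\<epsilon>>0. \<exists>R>0. \<exists>N::nat. N > 0 \<and> (\<forall>p\<in>S. \<forall>q\<in>S. d p q \<ge> R \<longrightarrow>
        finite {g \<in> carrier G. d p (\<phi> g p) \<le> \<epsilon> \<and> d q (\<phi> g q) \<le> \<epsilon>} \<and>
        card {g \<in> carrier G. d p (\<phi> g p) \<le> \<epsilon> \<and> d q (\<phi> g q) \<le> \<epsilon>} \<le> N))"

text \<open>The limit set consists of the boundary points that are limits of sequences in an orbit; all
  orbits have the same limits.\<close>

definition limit_set ::
    "('g, 'm) monoid_scheme \<Rightarrow> 's set \<Rightarrow> ('s \<Rightarrow> 's \<Rightarrow> real) \<Rightarrow> ('g \<Rightarrow> 's \<Rightarrow> 's) \<Rightarrow> (nat \<Rightarrow> 's) set set"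
  where "limit_set G S d \<phi> =
     {\<xi> \<in> gromov_boundary S d. \<exists>x\<in>S. \<exists>s\<in>\<xi>. range s \<subseteq> Group_Action.orbit G \<phi> x}"

definition elementary_action ::
    "('g, 'm) monoid_scheme \<Rightarrow> 's set \<Rightarrow> ('s \<Rightarrow> 's \<Rightarrow> real) \<Rightarrow> ('g \<Rightarrow> 's \<Rightarrow> 's) \<Rightarrow> bool" where
  "elementary_action G S d \<phi> \<longleftrightarrow> finite (limit_set G S d \<phi>) \<and> card (limit_set G S d \<phi>) \<le> 2"

definition elliptic ::
    "('g, 'm) monoid_scheme \<Rightarrow> 's set \<Rightarrow> ('s \<Rightarrow> 's \<Rightarrow> real) \<Rightarrow> ('g \<Rightarrow> 's \<Rightarrow> 's) \<Rightarrow> 'g \<Rightarrow> bool" where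
  "elliptic G S d \<phi> g \<longleftrightarrow>
     (\<exists>x\<in>S. Metric_space.mbounded S d {\<phi> (g [^]\<^bsub>G\<^esub> n) x | n :: int. True})"

text \<open>Quantification over all hyperbolic spaces is not possible inside a HOL formula.  For a group
  over the type \<open>'g\<close> the next two definitions let the spaces range over all subsets of the type
  \<open>'g \<times> real\<close>.  This is no restriction: by \<open>hyperbolic_action_reduction\<close> below, every
  acylindrical action on a hyperbolic space of any type restricts to an invariant hyperbolic
  subspace of cardinality at most that of \<open>'g \<times> real\<close>.  The theorems
  \<open>acylindrically_hyperbolicI\<close> and \<open>elliptic_radicalD\<close> state the resulting independence of
  the type.\<close>

definition acylindrically_hyperbolic :: "('g, 'm) monoid_scheme \<Rightarrow> bool" where
  "acylindrically_hyperbolic G \<longleftrightarrow>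
     (\<exists>(S :: ('g \<times> real) set) d \<phi>. hyperbolic_space S d \<and> acylindrical_action G S d \<phi> \<and>
        \<not> elementary_action G S d \<phi>)"

definition elliptic_radical :: "('g, 'm) monoid_scheme \<Rightarrow> 'g set" where
  "elliptic_radical G = {g \<in> carrier G. \<forall>(S :: ('g \<times> real) set) d \<phi>.
     hyperbolic_space S d \<and> acylindrical_action G S d \<phi> \<longrightarrow> elliptic G S d \<phi> g}"

definition universal_acylindrical_action ::
    "('g, 'm) monoid_scheme \<Rightarrow> 's set \<Rightarrow> ('s \<Rightarrow> 's \<Rightarrow> real) \<Rightarrow> ('g \<Rightarrow> 's \<Rightarrow> 's) \<Rightarrow> bool" where
  "universal_acylindrical_action G S d \<phi> \<longleftrightarrow> acylindrical_action G S d \<phi> \<and>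
     {g \<in> carrier G. elliptic G S d \<phi> g} = elliptic_radical G"


section \<open>Independence of the type of the space\<close>

lemma invariant_geodesic_subspace:
  includes cardinal_syntax
  fixes G :: "('g, 'm) monoid_scheme" and S :: "'s set"
  assumes act: "isometric_action G S d \<phi>" and geo: "geodesic_space S d"
    and F: "finite F" "F \<subseteq> S"
  obtains S' and f :: "'s \<Rightarrow> 'g \<times> real" where "F \<subseteq> S'" "S' \<subseteq> S" "geodesic_space S' d"
    "\<And>g x. g \<in> carrier G \<Longrightarrow> x \<in> S' \<Longrightarrow> \<phi> g x \<in> S'" "inj_on f S'"
proof -
  let ?U = "UNIV :: ('g \<times> real) set"
  interpret Metric_space S d using act by (simp add: isometric_action_def)
  interpret group_action G S \<phi> using act by (simp add: isometric_action_def)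
  interpret group G by (rule group_hom.axioms(1)[OF group_hom])
  have "\<forall>x\<in>S. \<forall>y\<in>S. \<exists>\<gamma>. \<gamma> 0 = x \<and> \<gamma> (d x y) = y \<and> \<gamma> \<in> {0..d x y} \<rightarrow> S \<and>
        (\<forall>s\<in>{0..d x y}. \<forall>t\<in>{0..d x y}. d (\<gamma> s) (\<gamma> t) = \<bar>s - t\<bar>)"
    using geo by (simp add: geodesic_space_def)
  then obtain \<gamma> where \<gamma>: "\<And>x y. x \<in> S \<Longrightarrow> y \<in> S \<Longrightarrow> \<gamma> x y 0 = x \<and> \<gamma> x y (d x y) = y \<and>
        \<gamma> x y \<in> {0..d x y} \<rightarrow> S \<and>
        (\<forall>s\<in>{0..d x y}. \<forall>t\<in>{0..d x y}. d (\<gamma> x y s) (\<gamma> x y t) = \<bar>s - t\<bar>)"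
    by metis
  define I where "I A = A \<union> (\<Union>x\<in>A. \<Union>y\<in>A. \<Union>g\<in>carrier G. (\<lambda>t. \<phi> g (\<gamma> x y t)) ` {0..d x y})" for A
  define H where "H n = (I ^^ n) (\<Union>g\<in>carrier G. \<phi> g ` F)" for n
  have H0: "H 0 = (\<Union>g\<in>carrier G. \<phi> g ` F)" and HS: "H (Suc n) = I (H n)" for n
    by (simp_all add: H_def)
  have inf: "infinite ?U" by (simp add: finite_prod infinite_UNIV_char_0)
  have cG: "|carrier G| \<le>o |?U|"
  proof -
    have "inj_on (\<lambda>g. (g, 0 :: real)) (carrier G)" by (simp add: inj_on_def)
    then show ?thesis by (meson card_of_ordLeqI UNIV_I)
  qed
  have cR: "|h ` T| \<le>o |?U|" for h :: "real \<Rightarrow> 's" and T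
  proof -
    have "|h ` T| \<le>o |T|" by (rule card_of_image)
    moreover have "inj_on (\<lambda>t. (undefined :: 'g, t)) T" by (simp add: inj_on_def)
    then have "|T| \<le>o |?U|" by (meson card_of_ordLeqI UNIV_I)
    ultimately show ?thesis by (rule ordLeq_transitive)
  qed
  have cH: "|H n| \<le>o |?U|" for n
  proof (induction n)
    case 0
    have "|\<phi> g ` F| \<le>o |?U|" for g
      using F inf by (meson card_of_ordLeq_infinite finite_imageI card_of_Well_order
          ordLeq_total)
    then show ?case unfolding H0 by (intro card_of_UNION_ordLeq_infinite[OF inf cG]) simp
  next
    case (Suc n)
    have "|\<Union>x\<in>H n. \<Union>y\<in>H n. \<Union>g\<in>carrier G. (\<lambda>t. \<phi> g (\<gamma> x y t)) ` {0..d x y}| \<le>o |?U|"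
      by (intro card_of_UNION_ordLeq_infinite[OF inf Suc] ballI
          card_of_UNION_ordLeq_infinite[OF inf cG] cR)
    then show ?case unfolding HS I_def using Suc inf
      by (intro card_of_Un_ordLeq_infinite_Field card_of_Card_order) (simp_all add: Field_card_of)
  qed
  define S' where "S' = (\<Union>n. H n)"
  have "|UNIV :: nat set| \<le>o |?U|"
    using inf by (simp add: infinite_iff_card_of_nat)
  then have "|S'| \<le>o |?U|"
    unfolding S'_def by (intro card_of_UNION_ordLeq_infinite[OF inf]) (use cH in auto)
  then obtain f :: "'s \<Rightarrow> 'g \<times> real" where f: "inj_on f S'"
    by (metis card_of_ordLeq)
  have HsubS: "H n \<subseteq> S" for n
  proof (induction n)
    case 0
    show ?case unfolding H0 using F element_image by blast
  next
    case (Suc n)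
    have "\<phi> g (\<gamma> x y t) \<in> S" if "x \<in> H n" "y \<in> H n" "g \<in> carrier G" "t \<in> {0..d x y}" for x y g t
    proof -
      have "\<gamma> x y \<in> {0..d x y} \<rightarrow> S" using \<gamma> Suc that by blast
      then show ?thesis using that element_image by blast
    qed
    then show ?case unfolding HS I_def using Suc by auto
  qed
  then have S'S: "S' \<subseteq> S" by (auto simp: S'_def)
  have one: "\<phi> \<one>\<^bsub>G\<^esub> x = x" if "x \<in> S" for x
    using that id_eq_one by (metis restrict_apply')
  have FS: "F \<subseteq> S'"
  proof
    fix x assume "x \<in> F"
    then have "x \<in> H 0" unfolding H0 using one F by force
    then show "x \<in> S'" by (auto simp: S'_def)
  qed
  have HSuc: "H n \<subseteq> H (Suc n)" for n by (auto simp: HS I_def)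
  then have mono: "H m \<subseteq> H n" if "m \<le> n" for m n
    using that by (rule lift_Suc_mono_le)
  have Hinv: "\<phi> h z \<in> H n" if h: "h \<in> carrier G" and "z \<in> H n" for h z n
    using that(2)
  proof (induction n arbitrary: z)
    case 0
    then obtain g x where gx: "g \<in> carrier G" "x \<in> F" "z = \<phi> g x" by (auto simp: H0)
    then have "\<phi> h z = \<phi> (h \<otimes>\<^bsub>G\<^esub> g) x" using h F by (auto simp: composition_rule)
    then show ?case unfolding H0 using gx h by auto
  next
    case (Suc n)
    show ?case
    proof (cases "z \<in> H n")
      case True
      then show ?thesis using Suc.IH HSuc by blast
    next
      case False
      then obtain x y g t where z: "x \<in> H n" "y \<in> H n" "g \<in> carrier G" "t \<in> {0..d x y}"
        "z = \<phi> g (\<gamma> x y t)"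
        using Suc.prems by (auto simp: HS I_def)
      have "\<gamma> x y t \<in> S" using \<gamma>[of x y] z HsubS by blast
      then have "\<phi> h z = \<phi> (h \<otimes>\<^bsub>G\<^esub> g) (\<gamma> x y t)" using h z by (auto simp: composition_rule)
      moreover have "h \<otimes>\<^bsub>G\<^esub> g \<in> carrier G" using h z by simp
      ultimately show ?thesis unfolding HS I_def using z by blast
    qed
  qed
  have geo': "geodesic_space S' d"
    unfolding geodesic_space_def
  proof (intro conjI ballI)
    show "Metric_space S' d" using S'S by (rule subspace)
    fix x y assume xy: "x \<in> S'" "y \<in> S'"
    then obtain m n where "x \<in> H m" "y \<in> H n" by (auto simp: S'_def)
    then have H: "x \<in> H (max m n)" "y \<in> H (max m n)"
      using mono by (meson max.cobounded1 max.cobounded2 subsetD)+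
    have "\<gamma> x y t \<in> S'" if t: "t \<in> {0..d x y}" for t
    proof -
      have "\<gamma> x y t \<in> S" using \<gamma>[of x y] H HsubS t by blast
      then have "\<gamma> x y t = \<phi> \<one>\<^bsub>G\<^esub> (\<gamma> x y t)" by (simp add: one)
      then have "\<gamma> x y t \<in> H (Suc (max m n))"
        unfolding HS I_def using H t one_closed by blast
      then show ?thesis by (auto simp: S'_def)
    qed
    then show "\<exists>\<gamma>. \<gamma> 0 = x \<and> \<gamma> (d x y) = y \<and> \<gamma> \<in> {0..d x y} \<rightarrow> S' \<and>
        (\<forall>s\<in>{0..d x y}. \<forall>t\<in>{0..d x y}. d (\<gamma> s) (\<gamma> t) = \<bar>s - t\<bar>)"
      using \<gamma>[of x y] xy S'S by (intro exI[of _ "\<gamma> x y"]) auto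
  qed
  show thesis
    by (rule that[OF FS S'S geo' _ f]) (use Hinv in \<open>auto simp: S'_def\<close>)
qed

theorem hyperbolic_action_reduction:
  fixes G :: "('g, 'm) monoid_scheme" and S :: "'s set"
  assumes hyp: "hyperbolic_space S d" and acyl: "acylindrical_action G S d \<phi>"
    and F: "finite F" "F \<subseteq> S"
  obtains T :: "('g \<times> real) set" and d' \<phi>' k where
    "hyperbolic_space T d'" "acylindrical_action G T d' \<phi>'"
    "inj_on k T" "F \<subseteq> k ` T" "k ` T \<subseteq> S"
    "\<And>x y. x \<in> T \<Longrightarrow> y \<in> T \<Longrightarrow> d (k x) (k y) = d' x y"
    "\<And>g x. g \<in> carrier G \<Longrightarrow> x \<in> T \<Longrightarrow> k (\<phi>' g x) = \<phi> g (k x)"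
proof -
  have act: "isometric_action G S d \<phi>" using acyl by (simp add: acylindrical_action_def)
  interpret Metric_space S d using act by (simp add: isometric_action_def)
  interpret group_action G S \<phi> using act by (simp add: isometric_action_def)
  interpret group G by (rule group_hom.axioms(1)[OF group_hom])
  obtain a where a: "a \<in> S" using hyp by (auto simp: hyperbolic_space_def)
  have geo: "geodesic_space S d" using hyp by (simp add: hyperbolic_space_def)
  obtain S' and f :: "'s \<Rightarrow> 'g \<times> real" where S': "insert a F \<subseteq> S'" "S' \<subseteq> S" "geodesic_space S' d"
    and inv: "\<And>g x. g \<in> carrier G \<Longrightarrow> x \<in> S' \<Longrightarrow> \<phi> g x \<in> S'" and f: "inj_on f S'"
    by (rule invariant_geodesic_subspace[OF act geo, of "insert a F"]) (use F a in auto)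
  define T where "T = f ` S'"
  define k where "k = inv_into S' f"
  define d' where "d' x y = d (k x) (k y)" for x y
  define \<phi>' where "\<phi>' g = (\<lambda>x\<in>T. f (\<phi> g (k x)))" for g
  have kf: "k (f x) = x" if "x \<in> S'" for x using that f by (simp add: k_def)
  have kT: "k x \<in> S'" and fk: "f (k x) = x" if "x \<in> T" for x
    using that by (auto simp: T_def k_def f inv_into_into f_inv_into_f)
  have kTS: "k x \<in> S" if "x \<in> T" for x using kT[OF that] S' by auto
  have fT: "f x \<in> T" if "x \<in> S'" for x using that by (simp add: T_def)
  have k_im: "k ` T = S'" by (force simp: T_def kf)
  have k_inj: "inj_on k T" by (metis fk inj_onI)
  have k\<phi>: "k (\<phi>' g x) = \<phi> g (k x)" and \<phi>T: "\<phi>' g x \<in> T" if "g \<in> carrier G" "x \<in> T" for g x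
    using that by (simp_all add: \<phi>'_def kf inv kT fT)
  have comp: "\<phi>' (g \<otimes>\<^bsub>G\<^esub> h) x = \<phi>' g (\<phi>' h x)"
    if "g \<in> carrier G" "h \<in> carrier G" "x \<in> T" for g h x
    using that \<phi>T[of h x] by (simp add: \<phi>'_def kf inv kT composition_rule kTS)
  have one: "\<phi>' \<one>\<^bsub>G\<^esub> x = x" if "x \<in> T" for x
  proof -
    have "\<phi> \<one>\<^bsub>G\<^esub> (k x) = k x" using kTS[OF that] id_eq_one by (metis restrict_apply')
    then show ?thesis using that by (simp add: \<phi>'_def fk)
  qed
  have Bij: "\<phi>' g \<in> Bij T" if g: "g \<in> carrier G" for g
  proof -
    have "bij_betw (\<phi>' g) T T"
    proof (rule bij_betwI[of _ _ _ "\<phi>' (inv\<^bsub>G\<^esub> g)"])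
      show "\<phi>' g \<in> T \<rightarrow> T" "\<phi>' (inv\<^bsub>G\<^esub> g) \<in> T \<rightarrow> T" using g \<phi>T by auto
      show "\<phi>' (inv\<^bsub>G\<^esub> g) (\<phi>' g x) = x" "\<phi>' g (\<phi>' (inv\<^bsub>G\<^esub> g) x) = x" if "x \<in> T" for x
        using g that comp[of "inv\<^bsub>G\<^esub> g" g x] comp[of g "inv\<^bsub>G\<^esub> g" x] one by simp_all
    qed
    then show ?thesis by (simp add: Bij_def \<phi>'_def)
  qed
  have ga: "group_action G T \<phi>'"
  proof (intro group_action.intro group_hom.intro group_hom_axioms.intro homI)
    show "group G" by (rule is_group)
    show "group (BijGroup T)" by (rule group_BijGroup)
    show "\<phi>' g \<in> carrier (BijGroup T)" if "g \<in> carrier G" for g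
      using Bij that by (simp add: BijGroup_def)
    show "\<phi>' (g \<otimes>\<^bsub>G\<^esub> h) = \<phi>' g \<otimes>\<^bsub>BijGroup T\<^esub> \<phi>' h"
      if gh: "g \<in> carrier G" "h \<in> carrier G" for g h
    proof
      fix x show "\<phi>' (g \<otimes>\<^bsub>G\<^esub> h) x = (\<phi>' g \<otimes>\<^bsub>BijGroup T\<^esub> \<phi>' h) x"
        using gh comp[OF gh, of x] Bij
        by (cases "x \<in> T") (simp_all add: BijGroup_def compose_def, simp add: \<phi>'_def)
    qed
  qed
  have MT: "Metric_space T d'"
  proof
    show "0 \<le> d' x y" "d' x y = d' y x" for x y by (simp_all add: d'_def commute)
    show "(d' x y = 0) = (x = y)" if "x \<in> T" "y \<in> T" for x y
      using that kTS k_inj by (simp add: d'_def inj_on_eq_iff)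
    show "d' x z \<le> d' x y + d' y z" if "x \<in> T" "y \<in> T" "z \<in> T" for x y z
      using that kTS by (simp add: d'_def triangle)
  qed
  have iso: "isometric_action G T d' \<phi>'"
    using act MT ga kTS by (simp add: isometric_action_def d'_def k\<phi>)
  have "acylindrical_action G T d' \<phi>'"
    unfolding acylindrical_action_def
  proof (intro conjI iso allI impI)
    fix \<epsilon> :: real assume "\<epsilon> > 0"
    define A where "A p q = {g \<in> carrier G. d p (\<phi> g p) \<le> \<epsilon> \<and> d q (\<phi> g q) \<le> \<epsilon>}" for p q
    have "\<exists>R>0. \<exists>N::nat. N > 0 \<and> (\<forall>p\<in>S. \<forall>q\<in>S. d p q \<ge> R \<longrightarrow> finite (A p q) \<and> card (A p q) \<le> N)"
      using acyl \<open>\<epsilon> > 0\<close> by (simp add: acylindrical_action_def A_def)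
    then obtain R N where RN: "R > 0" "N > (0::nat)"
      "\<forall>p\<in>S. \<forall>q\<in>S. d p q \<ge> R \<longrightarrow> finite (A p q) \<and> card (A p q) \<le> N"
      by blast
    have A: "{g \<in> carrier G. d' p (\<phi>' g p) \<le> \<epsilon> \<and> d' q (\<phi>' g q) \<le> \<epsilon>} = A (k p) (k q)"
      if "p \<in> T" "q \<in> T" for p q
      unfolding A_def d'_def using that k\<phi> by (intro Collect_cong conj_cong refl) simp_all
    show "\<exists>R>0. \<exists>N::nat. N > 0 \<and> (\<forall>p\<in>T. \<forall>q\<in>T. d' p q \<ge> R \<longrightarrow>
        finite {g \<in> carrier G. d' p (\<phi>' g p) \<le> \<epsilon> \<and> d' q (\<phi>' g q) \<le> \<epsilon>} \<and>
        card {g \<in> carrier G. d' p (\<phi>' g p) \<le> \<epsilon> \<and> d' q (\<phi>' g q) \<le> \<epsilon>} \<le> N)"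
    proof (intro exI[of _ R] conjI exI[of _ N] RN(1,2) ballI impI)
      fix p q assume pq: "p \<in> T" "q \<in> T" "R \<le> d' p q"
      then have "finite (A (k p) (k q)) \<and> card (A (k p) (k q)) \<le> N"
        using RN(3) kTS by (simp add: d'_def)
      then show "finite {g \<in> carrier G. d' p (\<phi>' g p) \<le> \<epsilon> \<and> d' q (\<phi>' g q) \<le> \<epsilon>}"
        "card {g \<in> carrier G. d' p (\<phi>' g p) \<le> \<epsilon> \<and> d' q (\<phi>' g q) \<le> \<epsilon>} \<le> N"
        by (simp_all add: A[OF pq(1,2)])
    qed
  qed
  moreover have "hyperbolic_space T d'"
    unfolding hyperbolic_space_def
  proof (intro conjI)
    show "T \<noteq> {}" using S' by (auto simp: T_def)
    obtain \<delta> where "\<delta> \<ge> 0" "\<And>p x y z. p \<in> S \<Longrightarrow> x \<in> S \<Longrightarrow> y \<in> S \<Longrightarrow> z \<in> S \<Longrightarrow>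
        gromov_product d p x z \<ge> min (gromov_product d p x y) (gromov_product d p y z) - \<delta>"
      using hyp unfolding hyperbolic_space_def gromov_hyperbolic_def by metis
    then show "gromov_hyperbolic T d'"
      unfolding gromov_hyperbolic_def using kTS
      by (intro exI[of _ \<delta>] conjI ballI) (auto simp: gromov_product_def d'_def)
    show "geodesic_space T d'"
      unfolding geodesic_space_def
    proof (intro conjI MT ballI)
      fix x y assume xy: "x \<in> T" "y \<in> T"
      then obtain \<gamma> where \<gamma>: "\<gamma> 0 = k x" "\<gamma> (d (k x) (k y)) = k y" "\<gamma> \<in> {0..d (k x) (k y)} \<rightarrow> S'"
        "\<forall>s\<in>{0..d (k x) (k y)}. \<forall>t\<in>{0..d (k x) (k y)}. d (\<gamma> s) (\<gamma> t) = \<bar>s - t\<bar>"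
        using S'(3) kT unfolding geodesic_space_def by metis
      have kfg: "k (f (\<gamma> t)) = \<gamma> t" "f (\<gamma> t) \<in> T" if "0 \<le> t" "t \<le> d (k x) (k y)" for t
      proof -
        have "\<gamma> t \<in> S'" using \<gamma>(3) that by auto
        then show "k (f (\<gamma> t)) = \<gamma> t" "f (\<gamma> t) \<in> T" by (simp_all add: kf fT)
      qed
      show "\<exists>\<gamma>. \<gamma> 0 = x \<and> \<gamma> (d' x y) = y \<and> \<gamma> \<in> {0..d' x y} \<rightarrow> T \<and>
        (\<forall>s\<in>{0..d' x y}. \<forall>t\<in>{0..d' x y}. d' (\<gamma> s) (\<gamma> t) = \<bar>s - t\<bar>)"
        using \<gamma> xy by (intro exI[of _ "\<lambda>t. f (\<gamma> t)"]) (auto simp: d'_def kfg fk)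
    qed
  qed
  ultimately show thesis
    using k_im k_inj S' k\<phi> by (intro that[of T d' \<phi>' k]) (auto simp: d'_def)
qed

theorem elliptic_radicalD:
  fixes G :: "('g, 'm) monoid_scheme" and S :: "'s set"
  assumes g: "g \<in> elliptic_radical G"
    and hyp: "hyperbolic_space S d" and acyl: "acylindrical_action G S d \<phi>"
  shows "elliptic G S d \<phi> g"
proof -
  have gG: "g \<in> carrier G" using g by (simp add: elliptic_radical_def)
  obtain T :: "('g \<times> real) set" and d' \<phi>' k where T: "hyperbolic_space T d'" "acylindrical_action G T d' \<phi>'"
    and k: "inj_on k T" "k ` T \<subseteq> S"
    and d: "\<And>x y. x \<in> T \<Longrightarrow> y \<in> T \<Longrightarrow> d (k x) (k y) = d' x y"
    and \<phi>: "\<And>g x. g \<in> carrier G \<Longrightarrow> x \<in> T \<Longrightarrow> k (\<phi>' g x) = \<phi> g (k x)"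
    by (rule hyperbolic_action_reduction[OF hyp acyl, of "{}"]) blast+
  have "elliptic G T d' \<phi>' g" using g T by (simp add: elliptic_radical_def)
  then obtain x where x: "x \<in> T"
    and b: "Metric_space.mbounded T d' {\<phi>' (g [^]\<^bsub>G\<^esub> n) x | n :: int. True}"
    by (auto simp: elliptic_def)
  interpret S: Metric_space S d using acyl by (simp add: acylindrical_action_def isometric_action_def)
  interpret T: Metric_space T d' using T by (simp add: acylindrical_action_def isometric_action_def)
  interpret group_action G S \<phi> using acyl by (simp add: acylindrical_action_def isometric_action_def)
  interpret group G by (rule group_hom.axioms(1)[OF group_hom])
  define P where "P n = \<phi>' (g [^]\<^bsub>G\<^esub> n) x" for n :: int
  have "{\<phi>' (g [^]\<^bsub>G\<^esub> n) x | n :: int. True} = range P" by (auto simp: P_def)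
  then have "T.mbounded (range P)" using b by simp
  then have P: "range P \<subseteq> T \<and> (\<exists>B. \<forall>y\<in>range P. \<forall>z\<in>range P. d' y z \<le> B)"
    by (simp only: T.mbounded_alt)
  then obtain B where B: "\<forall>y\<in>range P. \<forall>z\<in>range P. d' y z \<le> B" by blast
  have inT: "P n \<in> T" for n using P by blast
  have kx: "k (P n) = \<phi> (g [^]\<^bsub>G\<^esub> n) (k x)" for n :: int
    using \<phi> gG x by (simp add: P_def)
  have "d (\<phi> (g [^]\<^bsub>G\<^esub> m) (k x)) (\<phi> (g [^]\<^bsub>G\<^esub> n) (k x)) \<le> B" for m n :: int
    using B inT d[of "P m" "P n"] by (simp flip: kx)
  moreover have "\<phi> (g [^]\<^bsub>G\<^esub> n) (k x) \<in> S" for n :: int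
    using inT[of n] k by (auto simp flip: kx)
  ultimately have "S.mbounded {\<phi> (g [^]\<^bsub>G\<^esub> n) (k x) | n :: int. True}"
    unfolding S.mbounded_alt full_SetCompr_eq by (auto simp: image_subset_iff)
  moreover have "k x \<in> S" using x k by blast
  ultimately show ?thesis unfolding elliptic_def by (intro bexI[of _ "k x"])
qed

lemma gromov_product_basepoint:
  assumes "Metric_space S d" "p \<in> S" "q \<in> S" "x \<in> S" "y \<in> S"
  shows "gromov_product d p x y \<ge> gromov_product d q x y - d p q"
proof -
  interpret Metric_space S d by fact
  show ?thesis
    using triangle[of q p x] triangle[of q p y] assms commute[of p q]
    by (simp add: gromov_product_def field_simps)
qed

lemma filterlim_gromov_product_basepoint:
  assumes "Metric_space S d" "p \<in> S" "q \<in> S" "\<And>a. u a \<in> S" "\<And>a. v a \<in> S"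
    and "filterlim (\<lambda>a. gromov_product d q (u a) (v a)) at_top F"
  shows "filterlim (\<lambda>a. gromov_product d p (u a) (v a)) at_top F"
proof (rule filterlim_at_top_mono)
  show "filterlim (\<lambda>a. - d p q + gromov_product d q (u a) (v a)) at_top F"
    using assms(6) by (rule filterlim_tendsto_add_at_top[OF tendsto_const])
  show "\<forall>\<^sub>F a in F. - d p q + gromov_product d q (u a) (v a) \<le> gromov_product d p (u a) (v a)"
    using gromov_product_basepoint[OF assms(1-3)] assms(4,5) by (simp add: algebra_simps)
qed

lemma equiv_boundary_rel:
  assumes "hyperbolic_space S d"
  shows "equiv {s. converges_to_infinity S d s} (boundary_rel S d)"
proof (rule equivI)
  interpret Metric_space S d
    using assms by (simp add: hyperbolic_space_def geodesic_space_def)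
  show "boundary_rel S d \<subseteq> {s. converges_to_infinity S d s} \<times> {s. converges_to_infinity S d s}"
    by (auto simp: boundary_rel_def)
  have "filterlim (\<lambda>n. (n, n)) (sequentially \<times>\<^sub>F sequentially) sequentially"
    by (intro filterlim_Pair filterlim_ident)
  then have "filterlim (\<lambda>n. gromov_product d p (s n) (s n)) at_top sequentially"
    if "converges_to_infinity S d s" "p \<in> S" for s p
    using that filterlim_compose[of "\<lambda>(i, j). gromov_product d p (s i) (s j)"]
    by (fastforce simp: converges_to_infinity_def)
  then show "refl_on {s. converges_to_infinity S d s} (boundary_rel S d)"
    by (auto simp: boundary_rel_def refl_on_def)
  show "sym (boundary_rel S d)"
    by (auto simp: boundary_rel_def sym_def gromov_product_def commute add.commute)
  show "trans (boundary_rel S d)"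
  proof (rule transI)
    fix s t u assume st: "(s, t) \<in> boundary_rel S d" and tu: "(t, u) \<in> boundary_rel S d"
    obtain \<delta> where \<delta>: "\<And>p x y z. p \<in> S \<Longrightarrow> x \<in> S \<Longrightarrow> y \<in> S \<Longrightarrow> z \<in> S \<Longrightarrow>
        gromov_product d p x z \<ge> min (gromov_product d p x y) (gromov_product d p y z) - \<delta>"
      using assms unfolding hyperbolic_space_def gromov_hyperbolic_def by metis
    have inS: "s n \<in> S" "t n \<in> S" "u n \<in> S" for n
      using st tu by (auto simp: boundary_rel_def converges_to_infinity_def)
    have "filterlim (\<lambda>n. gromov_product d p (s n) (u n)) at_top sequentially" if p: "p \<in> S" for p
      unfolding filterlim_at_top
    proof
      fix Z
      have "\<forall>\<^sub>F n in sequentially. Z + \<delta> \<le> gromov_product d p (s n) (t n)"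
        "\<forall>\<^sub>F n in sequentially. Z + \<delta> \<le> gromov_product d p (t n) (u n)"
        using st tu p by (auto simp: boundary_rel_def filterlim_at_top)
      then show "\<forall>\<^sub>F n in sequentially. Z \<le> gromov_product d p (s n) (u n)"
      proof eventually_elim
        case (elim n)
        then show ?case using \<delta>[OF p inS(1,2,3), of n n n] by linarith
      qed
    qed
    then show "(s, u) \<in> boundary_rel S d"
      using st tu by (simp add: boundary_rel_def)
  qed
qed

theorem acylindrically_hyperbolicI:
  fixes G :: "('g, 'm) monoid_scheme" and S :: "'s set"
  assumes hyp: "hyperbolic_space S d" and acyl: "acylindrical_action G S d \<phi>"
    and ne: "\<not> elementary_action G S d \<phi>"
  shows "acylindrically_hyperbolic G"
proof -
  have "\<exists>L \<subseteq> limit_set G S d \<phi>. finite L \<and> card L = 3"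
    using ne unfolding elementary_action_def
    by (cases "finite (limit_set G S d \<phi>)")
      (metis Suc_leI eval_nat_numeral(3) not_le obtain_subset_with_card_n,
        metis infinite_arbitrarily_large)
  then obtain L where L: "L \<subseteq> limit_set G S d \<phi>" "finite L" "card L = 3" by blast
  then have "\<forall>\<xi>\<in>L. \<exists>x s. x \<in> S \<and> s \<in> \<xi> \<and> range s \<subseteq> Group_Action.orbit G \<phi> x"
    unfolding limit_set_def by blast
  then obtain X s where X: "\<And>\<xi>. \<xi> \<in> L \<Longrightarrow> X \<xi> \<in> S"
    and s: "\<And>\<xi>. \<xi> \<in> L \<Longrightarrow> s \<xi> \<in> \<xi>" "\<And>\<xi>. \<xi> \<in> L \<Longrightarrow> range (s \<xi>) \<subseteq> Group_Action.orbit G \<phi> (X \<xi>)"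
    by metis
  have bd: "\<xi> \<in> gromov_boundary S d" if "\<xi> \<in> L" for \<xi> using that L by (auto simp: limit_set_def)
  note eqS = equiv_boundary_rel[OF hyp]
  have conv: "converges_to_infinity S d (s \<xi>)" if "\<xi> \<in> L" for \<xi>
    using bd[OF that] s(1)[OF that] unfolding gromov_boundary_def quotient_def boundary_rel_def
    by auto
  have distinct: "\<xi> = \<eta>" if "\<xi> \<in> L" "\<eta> \<in> L" "(s \<xi>, s \<eta>) \<in> boundary_rel S d" for \<xi> \<eta>
    using quotient_eqI[OF eqS] bd s(1) that unfolding gromov_boundary_def by blast
  obtain T :: "('g \<times> real) set" and d' \<phi>' k where T: "hyperbolic_space T d'" "acylindrical_action G T d' \<phi>'"
    and k: "inj_on k T" "X ` L \<subseteq> k ` T" "k ` T \<subseteq> S"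
    and d: "\<And>x y. x \<in> T \<Longrightarrow> y \<in> T \<Longrightarrow> d (k x) (k y) = d' x y"
    and \<phi>: "\<And>g x. g \<in> carrier G \<Longrightarrow> x \<in> T \<Longrightarrow> k (\<phi>' g x) = \<phi> g (k x)"
    by (rule hyperbolic_action_reduction[OF hyp acyl, of "X ` L"])
      (use X L in blast)+
  interpret MS: Metric_space S d using hyp by (simp add: hyperbolic_space_def geodesic_space_def)
  interpret T: group_action G T \<phi>' using T by (simp add: acylindrical_action_def isometric_action_def)
  have gp: "gromov_product d' p x y = gromov_product d (k p) (k x) (k y)"
    if "p \<in> T" "x \<in> T" "y \<in> T" for p x y
    using that by (simp add: gromov_product_def d)
  have "\<exists>r x. x \<in> T \<and> range r \<subseteq> Group_Action.orbit G \<phi>' x \<and> (\<forall>n. r n \<in> T \<and> k (r n) = s \<xi> n)"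
    if \<xi>: "\<xi> \<in> L" for \<xi>
  proof -
    obtain x where x: "x \<in> T" "X \<xi> = k x" using k \<xi> by blast
    have "\<forall>n. \<exists>g. g \<in> carrier G \<and> s \<xi> n = \<phi> g (X \<xi>)"
      using s(2)[OF \<xi>] unfolding Group_Action.orbit_def by blast
    then obtain g where g: "\<And>n. g n \<in> carrier G" "\<And>n. s \<xi> n = \<phi> (g n) (X \<xi>)" by metis
    have "\<phi>' (g n) x \<in> T" for n using T.element_image[OF g(1) x(1)] by blast
    moreover have "k (\<phi>' (g n) x) = s \<xi> n" for n using \<phi>[OF g(1) x(1)] g(2) x(2) by simp
    ultimately show ?thesis
      using x(1) g(1)
      by (intro exI[of _ "\<lambda>n. \<phi>' (g n) x"] exI[of _ x] conjI allI)
        (auto simp only: Group_Action.orbit_def)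
  qed
  then obtain r x where x: "\<And>\<xi>. \<xi> \<in> L \<Longrightarrow> x \<xi> \<in> T"
    and r_orb: "\<And>\<xi>. \<xi> \<in> L \<Longrightarrow> range (r \<xi>) \<subseteq> Group_Action.orbit G \<phi>' (x \<xi>)"
    and rT: "\<And>\<xi> n. \<xi> \<in> L \<Longrightarrow> r \<xi> n \<in> T" and kr: "\<And>\<xi> n. \<xi> \<in> L \<Longrightarrow> k (r \<xi> n) = s \<xi> n"
    by metis
  have kS: "k p \<in> S" if "p \<in> T" for p using k that by blast
  have rconv: "converges_to_infinity T d' (r \<xi>)" if \<xi>: "\<xi> \<in> L" for \<xi>
    using conv[OF \<xi>] rT[OF \<xi>] kS by (auto simp: converges_to_infinity_def gp kr[OF \<xi>])
  note eqT = equiv_boundary_rel[OF T(1)]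
  define c where "c \<xi> = boundary_rel T d' `` {r \<xi>}" for \<xi>
  have "inj_on c L"
  proof (rule inj_onI)
    fix \<xi> \<eta> assume \<xi>: "\<xi> \<in> L" and \<eta>: "\<eta> \<in> L" and "c \<xi> = c \<eta>"
    then have "(r \<xi>, r \<eta>) \<in> boundary_rel T d'"
      using eq_equiv_class[OF _ eqT] rconv by (simp add: c_def)
    then have *: "filterlim (\<lambda>n. gromov_product d (k p) (s \<xi> n) (s \<eta> n)) at_top sequentially"
      if "p \<in> T" for p
      using that by (simp add: boundary_rel_def gp rT \<xi> \<eta> kr)
    obtain p where p: "p \<in> T" using T(1) by (auto simp: hyperbolic_space_def)
    have "filterlim (\<lambda>n. gromov_product d q (s \<xi> n) (s \<eta> n)) at_top sequentially"
      if "q \<in> S" for q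
      by (rule filterlim_gromov_product_basepoint[OF MS.Metric_space_axioms that kS[OF p] _ _ *[OF p]])
        (use conv \<xi> \<eta> in \<open>auto simp: converges_to_infinity_def\<close>)
    then have "(s \<xi>, s \<eta>) \<in> boundary_rel S d"
      using conv \<xi> \<eta> by (simp add: boundary_rel_def)
    then show "\<xi> = \<eta>" using distinct \<xi> \<eta> by blast
  qed
  then have "card (c ` L) = 3" using L by (simp add: card_image)
  moreover have "c ` L \<subseteq> limit_set G T d' \<phi>'"
  proof
    fix \<zeta> assume "\<zeta> \<in> c ` L"
    then obtain \<xi> where \<xi>: "\<xi> \<in> L" "\<zeta> = c \<xi>" by blast
    have "r \<xi> \<in> \<zeta>"
      unfolding \<xi> c_def using equiv_class_self[OF eqT] rconv[OF \<xi>(1)] by blast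
    moreover have "\<zeta> \<in> gromov_boundary T d'"
      unfolding \<xi> c_def gromov_boundary_def using rconv[OF \<xi>(1)] by (intro quotientI) simp
    ultimately show "\<zeta> \<in> limit_set G T d' \<phi>'"
      unfolding limit_set_def using x r_orb \<xi>(1) by blast
  qed
  ultimately have "\<not> elementary_action G T d' \<phi>'"
    unfolding elementary_action_def using card_mono[of "limit_set G T d' \<phi>'" "c ` L"] by linarith
  then show ?thesis unfolding acylindrically_hyperbolic_def using T by blast
qed

end

theory Submission
  imports Defs "HOL-Library.Sublist"
begin

text \<open>Killing all letters beyond the first \<open>n\<close> maps the group onto \<open>F\<^sub>n\<close>, and the group is the
  free product of \<open>F\<^sub>n\<close> and the subgroup \<open>H\<^sub>n\<close> of words in the remaining letters. It therefore
  acts on a tree with trivial edge stabilisers, in which \<open>F\<^sub>n\<close> acts freely and \<open>H\<^sub>n\<close> fixes a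
  vertex. Such an action is acylindrical, non-elementary for \<open>n = 2\<close>, and an element which is
  non-trivial in \<open>F\<^sub>n\<close> is not elliptic. The tree is realised as the tight span of the
  pseudometric on the group given by the number of the first \<open>n\<close> letters in reduced words, so
  that neither normal forms in free products nor Bass-Serre theory are needed.

  A universal acylindrical action would thus have no elliptic element besides \<open>1\<close>. By
  acylindricity and hyperbolicity, for every \<open>M\<close> there is an exponent \<open>k\<close> such that \<open>d x (g\<^sup>k x)
  \<ge> d x (g x) + M\<close> for all points \<open>x\<close> and all non-elliptic \<open>g\<close>. The group contains infinite
  words with \<open>w\<^sub>i = a\<^sub>i (w\<^sub>i\<^sub>+\<^sub>1)\<^sup>k\<close> for prescribed exponents \<open>k\<close> depending on \<open>i\<close>. If these
  grow fast enough, then \<open>d x (w\<^sub>i x) \<ge> d x (w\<^sub>i\<^sub>+\<^sub>1 x) + 1\<close> for all \<open>i\<close>, which is absurd.\<close>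

section \<open>Powers of isometries of hyperbolic spaces\<close>

text \<open>The exponent at stage \<open>i\<close> must be fixed before
  \<open>w\<^sub>i\<^sub>+\<^sub>1\<close> is known, since that word contains all later exponents.
  So one \<open>k\<close> has to serve all non-elliptic \<open>g\<close> and all points
  \<open>x\<close>. Acylindricity supplies the uniformity in \<open>g\<close>: if
  \<open>N + 1\<close> distinct powers moved a point only a little, they would move a far point of
  its orbit equally little, so displacements grow with a slope of at least \<open>1 / N\<close>.
  Hyperbolicity supplies the uniformity in \<open>x\<close>: \<open>g\<close> and its power both
  carry \<open>x\<close> towards an axis and back, and this common part cancels in the comparison;
  the four-point inequality stands in for the axis. For the trees the obstacle is that elements are
  infinite words, of which no reduced form is at hand. Lengths are read off the reduced projections
  to \<open>F\<^sub>m\<close>: the number of letters below \<open>n\<close> increases with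
  \<open>m\<close>, is bounded by the finitely many such letters of a representative, and so
  stabilises. Every property of the length thus comes from finite reduced words. No single
  \<open>n\<close> detects all elements, so these actions determine the radical while none of them
  is universal.\<close>

locale iterated_isometry = Metric_space S d for S :: "'s set" and d +
  fixes T :: "int \<Rightarrow> 's \<Rightarrow> 's" and \<delta> :: real
  assumes T_closed: "x \<in> S \<Longrightarrow> T n x \<in> S"
    and T_zero: "x \<in> S \<Longrightarrow> T 0 x = x"
    and T_add: "x \<in> S \<Longrightarrow> T m (T n x) = T (m + n) x"
    and T_isometry: "\<lbrakk>x \<in> S; y \<in> S\<rbrakk> \<Longrightarrow> d (T n x) (T n y) = d x y"
    and \<delta>_nonneg: "0 \<le> \<delta>"
    and four_point: "\<lbrakk>p \<in> S; q \<in> S; x \<in> S; y \<in> S\<rbrakk> \<Longrightarrow>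
      d p q + d x y \<le> max (d p x + d q y) (d p y + d q x) + 2 * \<delta>"
begin

definition disp :: "int \<Rightarrow> 's \<Rightarrow> real" where
  "disp n x = d x (T n x)"

lemma disp_nonneg: "0 \<le> disp n x"
  by (simp add: disp_def)

lemma disp_zero [simp]: "x \<in> S \<Longrightarrow> disp 0 x = 0"
  by (simp add: disp_def T_zero)

lemma dist_iterates: "x \<in> S \<Longrightarrow> d (T m x) (T n x) = disp (n - m) x"
  using T_isometry[of x "T (n - m) x" m] by (simp add: disp_def T_add T_closed)

lemma disp_minus [simp]: "x \<in> S \<Longrightarrow> disp (- n) x = disp n x"
  using dist_iterates[of x 0 n] dist_iterates[of x n 0] commute[of "T 0 x" "T n x"] by simp

lemma disp_iterate [simp]: "x \<in> S \<Longrightarrow> disp n (T m x) = disp n x"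
  using dist_iterates[of x m "n + m"] by (simp add: disp_def T_add)

lemma four_point_orbit:
  assumes "x \<in> S"
  shows "disp (j - i) x + disp (l - k) x \<le>
    max (disp (k - i) x + disp (l - j) x) (disp (l - i) x + disp (k - j) x) + 2 * \<delta>"
  using four_point[of "T i x" "T j x" "T k x" "T l x"] assms
  by (simp add: dist_iterates T_closed)

text \<open>Each further multiple of \<open>i\<close> gains at least \<open>s\<close>: in the
  four-point inequality for the exponents 0, \<open>i\<close>, \<open>2 * i\<close> and
  \<open>(n + 2) * i\<close>, the first alternative of the maximum would contradict the gain already
  proved.\<close>

lemma disp_multiple_ge:
  assumes x: "x \<in> S" and s: "0 < s" and double: "disp (2 * i) x \<ge> disp i x + 2 * \<delta> + s"
  shows "disp (int n * i) x \<ge> real n * s"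
proof -
  have "disp (int (Suc n) * i) x \<ge> disp (int n * i) x + s" if "n > 0" for n
    using that
  proof (induction n rule: nat_induct_non_zero)
    case 1
    then show ?case using double \<delta>_nonneg by simp
  next
    case (Suc n)
    have "disp (2 * i) x + disp (int (Suc n) * i) x \<le>
      max (disp i x + disp (int n * i) x) (disp (int (Suc (Suc n)) * i) x + disp i x) + 2 * \<delta>"
      using four_point_orbit[OF x, of "2 * i" 0 "int (Suc (Suc n)) * i" i]
      by (simp add: algebra_simps x)
    then show ?case using Suc.IH s double by linarith
  qed
  moreover have "disp i x \<ge> s"
  proof -
    have "disp (2 * i) x \<le> disp i x + disp i x"
      using triangle[of x "T i x" "T (2 * i) x"] x dist_iterates[of x i "2 * i"]
      by (simp add: disp_def T_closed)
    then show ?thesis using double \<delta>_nonneg by linarith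
  qed
  ultimately show ?thesis
  proof (induction n)
    case (Suc n)
    then show ?case
    proof (cases "n = 0")
      case False
      then have "disp (int (Suc n) * i) x \<ge> disp (int n * i) x + s" using Suc.prems(1) by blast
      moreover have "real n * s \<le> disp (int n * i) x" using Suc by blast
      ultimately have "disp (int (Suc n) * i) x \<ge> real n * s + s" by linarith
      moreover have "real (Suc n) * s = real n * s + s" by (simp add: algebra_simps)
      ultimately show ?thesis by linarith
    qed simp
  qed (simp add: x)
qed

text \<open>If both alternatives failed, the four-point inequality would bound the displacement of
  the iterates \<open>T n\<close> by a linear function of slope less than \<open>\<rho>\<close>.\<close>

lemma growth_dichotomy:
  assumes x: "x \<in> S" and growth: "\<And>n :: nat. disp (int n) x \<ge> real n * \<rho> - C"
    and uv: "0 < u" "u < v"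
  shows "disp (int v) x \<ge> disp (int (v - u)) x + real u * \<rho> - 2 * \<delta> \<or>
    disp (int u) x \<ge> disp (int (v - u)) x + real v * \<rho> - 2 * \<delta>"
proof (rule ccontr)
  define \<alpha> where "\<alpha> = disp (int v) x - disp (int (v - u)) x + 2 * \<delta>"
  define \<beta> where "\<beta> = disp (int u) x - disp (int (v - u)) x + 2 * \<delta>"
  \<comment> \<open>The least slope with \<open>\<alpha> \<le> u * \<sigma>\<close> and
    \<open>\<beta> \<le> v * \<sigma>\<close>, so that a linear bound survives the recursion from
    \<open>n\<close> to \<open>n - u\<close> and \<open>n - v\<close>; \<open>K\<close> below
    absorbs the initial values.\<close>
  define \<sigma> where "\<sigma> = max (\<alpha> / real u) (\<beta> / real v)"
  assume "\<not> ?thesis"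
  then have "\<alpha> < real u * \<rho>" "\<beta> < real v * \<rho>" by (simp_all add: \<alpha>_def \<beta>_def)
  then have \<sigma>: "\<sigma> < \<rho>" and \<alpha>: "\<alpha> \<le> real u * \<sigma>" and \<beta>: "\<beta> \<le> real v * \<sigma>"
    using uv by (simp_all add: \<sigma>_def field_simps max_def)
  define K where "K = Max ((\<lambda>n. disp (int n) x - real n * \<sigma>) ` {..<v})"
  have upper: "disp (int n) x \<le> real n * \<sigma> + K" for n
  proof (induction n rule: less_induct)
    case (less n)
    show ?case
    proof (cases "n < v")
      case True
      then have "disp (int n) x - real n * \<sigma> \<le> K" unfolding K_def by (intro Max_ge) auto
      then show ?thesis by simp
    next
      case False
      have "disp (int n) x + disp (int v - int u) x \<le>
        max (disp (int v) x + disp (int n - int u) x) (disp (int u) x + disp (int n - int v) x)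
          + 2 * \<delta>"
        using four_point_orbit[OF x, of "int n" 0 "int v" "int u"]
          disp_minus[OF x, of "int n - int u"] disp_minus[OF x, of "int n - int v"]
        by (simp add: max.commute add.commute)
      then have "disp (int n) x \<le> max (\<alpha> + disp (int (n - u)) x) (\<beta> + disp (int (n - v)) x)"
        using False uv by (simp add: \<alpha>_def \<beta>_def of_nat_diff)
      moreover have "disp (int (n - u)) x \<le> real (n - u) * \<sigma> + K"
        "disp (int (n - v)) x \<le> real (n - v) * \<sigma> + K"
        using less[of "n - u"] less[of "n - v"] False uv by simp_all
      ultimately show ?thesis
        using \<alpha> \<beta> False uv by (simp add: of_nat_diff algebra_simps)
    qed
  qed
  obtain n :: nat where "real n > (C + K) / (\<rho> - \<sigma>)" using reals_Archimedean2 by blast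
  then have "C + K < real n * (\<rho> - \<sigma>)" using \<sigma> by (simp add: field_simps)
  then show False using growth[of n] upper[of n] by (simp add: algebra_simps)
qed

text \<open>The dichotomy is applied with \<open>u = 1\<close> and with \<open>u = k - 1\<close>,
  both times with \<open>v = k\<close>. If the second alternative held both times,
  \<open>disp 1 x\<close> and \<open>disp (k - 1) x\<close> would each exceed the other, because
  \<open>k * \<rho> > 2 * \<delta>\<close>. The conclusion is uniform in \<open>C\<close>, which may
  vary with the point and the isometry.\<close>

lemma disp_power_ge:
  assumes x: "x \<in> S" and growth: "\<And>n :: nat. disp (int n) x \<ge> real n * \<rho> - C"
    and k: "real k * \<rho> > 2 * \<delta>" "k > 1" and \<rho>: "\<rho> \<ge> 0"
  shows "disp (int k) x \<ge> disp 1 x + (real k - 1) * \<rho> - 4 * \<delta>"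
proof -
  have "disp (int k) x \<ge> disp (int (k - 1)) x + \<rho> - 2 * \<delta> \<or>
      disp 1 x \<ge> disp (int (k - 1)) x + real k * \<rho> - 2 * \<delta>"
    using growth_dichotomy[OF x growth, of 1 k] k by simp
  moreover have "disp (int k) x \<ge> disp 1 x + (real k * \<rho> - \<rho>) - 2 * \<delta> \<or>
      disp (int (k - 1)) x \<ge> disp 1 x + real k * \<rho> - 2 * \<delta>"
    using growth_dichotomy[OF x growth, of "k - 1" k] k by (simp add: of_nat_diff left_diff_distrib)
  moreover have "(real k - 1) * \<rho> = real k * \<rho> - \<rho>" by (simp add: left_diff_distrib)
  ultimately show ?thesis using k(1) \<rho> \<delta>_nonneg by linarith
qed

text \<open>Let \<open>y\<close> almost minimise \<open>E y\<close>, the largest displacement by \<open>T 1, \<dots>, T N\<close>, and let \<open>T i\<close>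
  attain it. If \<open>T (2 * i)\<close> did not displace \<open>y\<close> much further, then the geodesics from \<open>y\<close> to
  all \<open>T j y\<close> and \<open>T (- j) y\<close> would start in the same direction, and moving \<open>y\<close> a little that
  way would decrease \<open>E\<close>.\<close>

lemma exists_doubling:
  assumes geo: "geodesic_space S d" and S: "S \<noteq> {}"
    and moved: "\<And>y. y \<in> S \<Longrightarrow> \<exists>i\<in>{1..N}. disp i y > 16 * \<delta> + 4"
  obtains y i where "y \<in> S" "i \<in> {1..N}" "disp (2 * i) y \<ge> disp i y + 2 * \<delta> + 1"
proof (rule ccontr)
  note that' = that
  assume "\<not> thesis"
  then have no_doubling: "disp (2 * i) y < disp i y + 2 * \<delta> + 1" if "y \<in> S" "i \<in> {1..N}" for y i
    using that that' not_less by metis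
  \<comment> \<open>All exponents up to \<open>N\<close> enter because the estimates compare
    \<open>T i y\<close> with \<open>T j y\<close>, and \<open>i - j\<close> again has modulus at
    most \<open>N\<close>.\<close>
  define E where "E y = Max ((\<lambda>i. disp i y) ` {1..N})" for y
  have N: "{1..N} \<noteq> {}" using S moved by blast
  have E_ge: "disp i y \<le> E y" if "i \<in> {1..N}" for i y
    using that by (auto simp: E_def)
  have E_attained: "\<exists>i\<in>{1..N}. E y = disp i y" for y
  proof -
    have "E y \<in> (\<lambda>i. disp i y) ` {1..N}" unfolding E_def using N by (intro Max_in) simp_all
    then show ?thesis by blast
  qed
  have E_gt: "E y > 16 * \<delta> + 4" if "y \<in> S" for y
    using moved[OF that] E_ge by (meson less_le_trans)
  have bdd: "bdd_below (E ` S)"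
    by (rule bdd_belowI2[of _ "16 * \<delta> + 4"]) (rule less_imp_le[OF E_gt])
  obtain y where y: "y \<in> S" and y_min: "E y < Inf (E ` S) + 1"
    using cInf_lessD[of "E ` S" "Inf (E ` S) + 1"] S by auto
  have almost_min: "E y < E z + 1" if "z \<in> S" for z
    using y_min cInf_lower[OF imageI[OF that] bdd] by linarith
  obtain i where i: "i \<in> {1..N}" and Ei: "E y = disp i y" using E_attained by blast
  \<comment> \<open>The final estimate bounds \<open>disp j z\<close> by
    \<open>disp j y - 2 * t + 10 * \<delta>\<close> or by
    \<open>2 * t - disp j y + 6 * \<delta>\<close>. With \<open>2 * t = 10 * \<delta> + 2\<close>
    the former is a drop by 2, and the latter is at most \<open>16 * \<delta> + 2\<close>, which the
    threshold \<open>16 * \<delta> + 4\<close> exceeds by more than 1.\<close>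
  define t where "t = 5 * \<delta> + 1"
  then have t2: "2 * t = 10 * \<delta> + 2" by simp
  obtain \<gamma> where \<gamma>: "\<gamma> 0 = y" "\<gamma> (disp i y) = T i y" "\<gamma> \<in> {0..disp i y} \<rightarrow> S"
    "\<forall>s\<in>{0..disp i y}. \<forall>t\<in>{0..disp i y}. d (\<gamma> s) (\<gamma> t) = \<bar>s - t\<bar>"
    using bspec[OF bspec[OF conjunct2[OF geo[unfolded geodesic_space_def]] y] T_closed[OF y, of i]]
    unfolding disp_def by blast
  have t: "t \<in> {0..disp i y}" using E_gt[OF y] Ei \<delta>_nonneg by (auto simp: t_def)
  define z where "z = \<gamma> t"
  have z: "z \<in> S" using \<gamma>(3) t by (auto simp: z_def)
  have yz: "d y z = t" "d z (T i y) = E y - t"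
    using bspec[OF bspec[OF \<gamma>(4), of 0], of t] bspec[OF bspec[OF \<gamma>(4), of t], of "disp i y"]
      t \<gamma>(1,2) Ei
    by (auto simp: z_def disp_nonneg)
  have inS: "T n y \<in> S" "T n z \<in> S" for n using y z T_closed by auto
  have big: "E y > 16 * \<delta> + 4" using E_gt y .
  have disp_le: "disp m y \<le> E y" if "\<bar>m\<bar> \<le> N" for m
  proof -
    have "m = 0 \<or> m \<in> {1..N} \<or> - m \<in> {1..N}" using that unfolding atLeastAtMost_iff by linarith
    then consider "m = 0" | "m \<in> {1..N}" | "- m \<in> {1..N}" by blast
    then show ?thesis
    proof cases
      case 1 then show ?thesis using big \<delta>_nonneg y by simp
    next
      case 2 then show ?thesis by (rule E_ge)
    next
      case 3 then show ?thesis using E_ge[of "- m" y] y by simp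
    qed
  qed
  have zy: "d z y = t" using yz commute by metis
  have iterate0: "d y (T n y) = disp n y" "d (T n y) y = disp n y" for n
    using commute by (simp_all add: disp_def)
  \<comment> \<open>Without doubling, the way from \<open>T (- i) y\<close> to \<open>T i y\<close>
    via \<open>y\<close> backtracks, so moving from \<open>y\<close> towards \<open>T i y\<close>
    also approaches \<open>T (- i) y\<close>.\<close>
  have behind: "d z (T (- i) y) \<le> E y - t + 2 * \<delta>"
  proof -
    have "d z (T (- i) y) + E y \<le> max (t + disp (2 * i) y) (E y - t + E y) + 2 * \<delta>"
      using four_point[OF z inS(1)[of "- i"] y inS(1)[of i]]
      by (simp add: zy yz(2) iterate0 dist_iterates[OF y] Ei disp_minus[OF y])
    then show ?thesis
      using no_doubling[OF y i] big Ei \<delta>_nonneg unfolding t_def by linarith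
  qed
  have "disp j z < E y - 1" if j: "j \<in> {1..N}" for j
  proof -
    have ij: "\<bar>j - i\<bar> \<le> N" "\<bar>i - j\<bar> \<le> N" using i j by auto
    have "d z (T j y) + E y \<le> max (t + disp (i - j) y) (E y - t + disp j y) + 2 * \<delta>"
      using four_point[OF z inS(1)[of j] y inS(1)[of i]]
      by (simp add: zy yz(2) iterate0 dist_iterates[OF y] Ei)
    then have fwd: "d z (T j y) \<le> max t (disp j y - t) + 2 * \<delta>"
      using disp_le[OF ij(2)] by linarith
    have "d z (T (- j) y) + E y \<le> max (t + disp (j - i) y) (d z (T (- i) y) + disp j y) + 2 * \<delta>"
      using four_point[OF z inS(1)[of "- j"] y inS(1)[of "- i"]]
      by (simp add: zy iterate0 dist_iterates[OF y] disp_minus[OF y] Ei)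
    then have bwd: "d z (T (- j) y) \<le> max t (disp j y - t + 2 * \<delta>) + 2 * \<delta>"
      using disp_le[OF ij(1)] behind by linarith
    have "d (T j z) y = d z (T (- j) y)"
      using T_isometry[OF z inS(1)[of "- j"], of j] T_add[OF y, of j "- j"] T_zero[OF y] by simp
    moreover have "d (T j z) (T j y) = t"
      using T_isometry[OF z y, of j] yz commute[of y z] by simp
    ultimately have "disp j z + disp j y \<le> max (2 * t) (d z (T j y) + d z (T (- j) y)) + 2 * \<delta>"
      using four_point[OF z inS(2)[of j] y inS(1)[of j]] by (simp add: zy iterate0 flip: disp_def)
    then have "disp j z \<le> max (2 * t - disp j y + 6 * \<delta>) (disp j y - 2 * t + 10 * \<delta>)"
      using fwd bwd \<delta>_nonneg by linarith
    moreover have "disp j y \<le> E y" "disp j y \<ge> 0" using E_ge j disp_nonneg by auto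
    ultimately show ?thesis using big \<delta>_nonneg t2 by linarith
  qed
  then have "E z < E y - 1" using E_attained[of z] by auto
  then show False using almost_min[OF z] by linarith
qed

lemma disp_add_le: "x \<in> S \<Longrightarrow> disp (m + n) x \<le> disp m x + disp n x"
  using triangle[of x "T m x" "T (m + n) x"] dist_iterates[of x m "m + n"]
  by (simp add: disp_def T_closed)

lemma disp_basepoint: "\<lbrakk>x \<in> S; y \<in> S\<rbrakk> \<Longrightarrow> disp n x \<ge> disp n y - 2 * d x y"
  using triangle[of y x "T n y"] triangle[of x "T n x"
    "T n y"] T_isometry[of x y n] T_closed commute[of x y]
  by (simp add: disp_def)

text \<open>Serves to show that a non-elliptic element has infinite order, so that its powers count
  as different elements in the acylindricity bound.\<close>

lemma periodic_disp_bounded: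
  assumes x: "x \<in> S" and p: "p > 0" and per: "T p x = x"
  shows "\<exists>B. \<forall>n. disp n x \<le> B"
proof -
  have mult: "T (int q * p) x = x" for q
  proof (induction q)
    case (Suc q)
    have "T (int (Suc q) * p) x = T p (T (int q * p) x)"
      using T_add[OF x] by (simp add: algebra_simps)
    then show ?case using Suc per by simp
  qed (simp add: x T_zero)
  define B where "B = Max ((\<lambda>r. disp r x) ` {0..<p})"
  have nonneg: "disp n x \<le> B" if "n \<ge> 0" for n
  proof -
    define q where "q = nat (n div p)"
    have "int q = n div p" using that p by (simp add: q_def pos_imp_zdiv_nonneg_iff)
    then have "disp n x = disp (n mod p + int q * p) x" by simp
    also have "\<dots> = disp (n mod p) x"
      using T_add[OF x, of "n mod p" "int q * p"] mult[of q] by (simp add: disp_def)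
    also have "\<dots> \<le> B" unfolding B_def using p by (intro Max_ge) auto
    finally show ?thesis .
  qed
  have "disp n x \<le> B" for n
    using nonneg[of n] nonneg[of "- n"] x by (cases "n \<ge> 0") auto
  then show ?thesis by blast
qed

text \<open>Doubling at \<open>y\<close> yields a gain of 1 per \<open>i\<close> steps, and
  \<open>i \<le> N\<close>; hence the slope \<open>1 / N\<close> depends on neither the point nor
  the isometry. Rounding \<open>n\<close> down to a multiple of \<open>i\<close> and moving from
  \<open>y\<close> to \<open>x\<close> only change \<open>C\<close>.\<close>

lemma growth_of_doubling:
  assumes y: "y \<in> S" and i: "i \<in> {1..N}" and double: "disp (2 * i) y \<ge> disp i y + 2 * \<delta> + 1"
    and x: "x \<in> S"
  obtains C where "\<And>n :: nat. disp (int n) x \<ge> real n * (1 / of_int N) - C"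
proof
  define B where "B = Max ((\<lambda>r. disp r y) ` {0..<i})"
  fix n :: nat
  define q where "q = nat (int n div i)"
  define r where "r = int n mod i"
  have q: "int q = int n div i" using i by (simp add: q_def pos_imp_zdiv_nonneg_iff)
  have n: "int n = int q * i + r" unfolding q r_def by simp
  have r: "0 \<le> r" "r < i" using i by (auto simp: r_def)
  have "disp r y \<le> B" unfolding B_def using r by (intro Max_ge) auto
  moreover have "disp (int q * i) y \<ge> real q"
    using disp_multiple_ge[OF y _ double, of q] by simp
  moreover have "disp (int q * i) y \<le> disp (int n) y + disp r y"
    using disp_add_le[OF y, of "int n" "- r"] n y by simp
  moreover have "real n * (1 / of_int N) \<le> real q + 1"
  proof -
    have "int n \<le> (int q + 1) * i" using n r by (simp add: algebra_simps)
    also have "\<dots> \<le> (int q + 1) * N" using i by (intro mult_left_mono) auto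
    finally have "real_of_int (int n) \<le> real_of_int ((int q + 1) * N)" by (simp only: of_int_le_iff)
    then show ?thesis using i by (simp add: field_simps)
  qed
  ultimately show "disp (int n) x \<ge> real n * (1 / of_int N) - (1 + B + 2 * d x y)"
    using disp_basepoint[OF x y, of "int n"] by linarith
qed

end

text \<open>The order of the quantifiers is the point: \<open>k\<close> depends only on
  \<open>M\<close>, on \<open>\<delta>\<close> and on the bound \<open>N\<close> that acylindricity
  gives for one fixed \<open>\<epsilon>\<close>.\<close>

lemma acylindrical_powers_displace:
  fixes G :: "('g, 'm) monoid_scheme" and S :: "'s set"
  assumes hyp: "hyperbolic_space S d" and acyl: "acylindrical_action G S d \<phi>"
  shows "\<exists>k>0. \<forall>g\<in>carrier G. \<not> elliptic G S d \<phi> g \<longrightarrow>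
    (\<forall>x\<in>S. d x (\<phi> (g [^]\<^bsub>G\<^esub> (k :: nat)) x) \<ge> d x (\<phi> g x) + M)"
proof -
  interpret Metric_space S d using acyl by (simp add: acylindrical_action_def isometric_action_def)
  interpret group_action G S \<phi> using acyl
    by (simp add: acylindrical_action_def isometric_action_def)
  interpret group G by (rule group_hom.axioms(1)[OF group_hom])
  obtain \<delta> where \<delta>: "\<delta> \<ge> 0" "\<And>p x y z. p \<in> S \<Longrightarrow> x \<in> S \<Longrightarrow> y \<in> S \<Longrightarrow> z \<in> S \<Longrightarrow>
      gromov_product d p x z \<ge> min (gromov_product d p x y) (gromov_product d p y z) - \<delta>"
    using hyp unfolding hyperbolic_space_def gromov_hyperbolic_def by metis
  have flow: "iterated_isometry S d (\<lambda>n. \<phi> (g [^]\<^bsub>G\<^esub> n)) \<delta>" if g: "g \<in> carrier G" for g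
  proof unfold_locales
    show "\<phi> (g [^]\<^bsub>G\<^esub> n) x \<in> S" if "x \<in> S" for x and n :: int
      using that g by (intro element_image[OF _ _ refl]) auto
    show "\<phi> (g [^]\<^bsub>G\<^esub> (0 :: int)) x = x" if "x \<in> S" for x
      using that id_eq_one by (metis int_pow_0 restrict_apply')
    show "\<phi> (g [^]\<^bsub>G\<^esub> m) (\<phi> (g [^]\<^bsub>G\<^esub> n) x) = \<phi> (g [^]\<^bsub>G\<^esub> (m + n)) x" if "x \<in> S" for x
      and m n :: int
      using that g composition_rule[of x "g [^]\<^bsub>G\<^esub> m" "g [^]\<^bsub>G\<^esub> n"] by (simp add: int_pow_mult)
    show "d (\<phi> (g [^]\<^bsub>G\<^esub> n) x) (\<phi> (g [^]\<^bsub>G\<^esub> n) y) = d x y" if "x \<in> S" "y \<in> S" for x y and n :: int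
      using acyl that g by (simp add: acylindrical_action_def isometric_action_def)
    show "d p q + d x y \<le> max (d p x + d q y) (d p y + d q x) + 2 * \<delta>"
      if "p \<in> S" "q \<in> S" "x \<in> S" "y \<in> S" for p q x y
    proof -
      have "gromov_product d p x q \<le> gromov_product d p x y + \<delta> \<or>
          gromov_product d p q y \<le> gromov_product d p x y + \<delta>"
        using \<delta>(2)[OF that(1,3,2,4)] by linarith
      then show ?thesis unfolding gromov_product_def using commute[of q x]
        by (auto simp: field_simps)
    qed
  qed (use \<delta> in simp)
  \<comment> \<open>The threshold under which \<open>exists_doubling\<close> operates.\<close>
  define \<epsilon> where "\<epsilon> = 16 * \<delta> + 4"
  have "\<epsilon> > 0" using \<delta> by (simp add: \<epsilon>_def)
  then obtain R and N :: nat where N: "N > 0" and RN: "\<And>p q. p \<in> S \<Longrightarrow> q \<in> S \<Longrightarrow> d p q \<ge> R \<Longrightarrow>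
      finite {g \<in> carrier G. d p (\<phi> g p) \<le> \<epsilon> \<and> d q (\<phi> g q) \<le> \<epsilon>} \<and>
      card {g \<in> carrier G. d p (\<phi> g p) \<le> \<epsilon> \<and> d q (\<phi> g q) \<le> \<epsilon>} \<le> N"
    using acyl unfolding acylindrical_action_def by meson
  define \<rho> where "\<rho> = 1 / real N"
  have \<rho>: "\<rho> > 0" using N by (simp add: \<rho>_def)
  \<comment> \<open>Both the loss \<open>4 * \<delta>\<close> in \<open>disp_power_ge\<close> and
    its requirement \<open>k * \<rho> > 2 * \<delta>\<close> have to be covered.\<close>
  obtain k :: nat where k: "real k > (2 * \<delta> + 4 * \<delta> + \<bar>M\<bar>) / \<rho> + 1" using reals_Archimedean2
    by blast
  have kM: "(real k - 1) * \<rho> > 2 * \<delta> + 4 * \<delta> + \<bar>M\<bar>" using k \<rho> by (simp add: field_simps)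
  have "(2 * \<delta> + 4 * \<delta> + \<bar>M\<bar>) / \<rho> \<ge> 0" using \<delta> \<rho> by (intro divide_nonneg_pos) auto
  then have k1: "k > 1" using k by linarith
  have k\<rho>: "real k * \<rho> > 2 * \<delta>" using kM \<rho> \<delta> by (simp add: left_diff_distrib)
  have "d x (\<phi> (g [^]\<^bsub>G\<^esub> k) x) \<ge> d x (\<phi> g x) + M"
    if g: "g \<in> carrier G" and ne: "\<not> elliptic G S d \<phi> g" and x: "x \<in> S" for g x
  proof -
    interpret iterated_isometry S d "\<lambda>n. \<phi> (g [^]\<^bsub>G\<^esub> n)" \<delta> by (rule flow[OF g])
    have unbounded: "\<exists>n. disp n y > B" if y: "y \<in> S" for y B
    proof (rule ccontr)
      assume "\<nexists>n. disp n y > B"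
      then have B: "disp n y \<le> B" for n by (meson not_less)
      have "mbounded {\<phi> (g [^]\<^bsub>G\<^esub> n) y | n :: int. True}"
        unfolding mbounded_alt using T_closed[OF y]
          by (auto simp: dist_iterates[OF y] intro!: exI[of _ B] B)
      then show False using ne y by (auto simp: elliptic_def)
    qed
    \<comment> \<open>Otherwise the powers with exponents 0 to \<open>N\<close> all move
      \<open>y\<close> by at most \<open>\<epsilon>\<close>. Powers of \<open>g\<close> commute, so
      they move the far point \<open>q\<close> of the same orbit equally little, and they are
      \<open>N + 1\<close> elements, one too many.\<close>
    have moved: "\<exists>i\<in>{1..int N}. disp i y > 16 * \<delta> + 4" if y: "y \<in> S" for y
    proof (rule ccontr)
      assume "\<not> ?thesis"
      then have small: "disp i y \<le> \<epsilon>" if "i \<in> {0..int N}" for i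
        using that \<open>\<epsilon> > 0\<close> y by (cases "i = 0") (auto simp: \<epsilon>_def not_less)
      obtain m where m: "disp m y > R" using unbounded y by blast
      define q where "q = \<phi> (g [^]\<^bsub>G\<^esub> m) y"
      have q: "q \<in> S" "d y q \<ge> R" using T_closed y m by (auto simp: q_def disp_def)
      let ?A = "{h \<in> carrier G. d y (\<phi> h y) \<le> \<epsilon> \<and> d q (\<phi> h q) \<le> \<epsilon>}"
      have "disp i q = disp i y" for i unfolding q_def by (rule disp_iterate[OF y])
      then have "(\<lambda>i :: int. g [^]\<^bsub>G\<^esub> i) ` {0..int N} \<subseteq> ?A"
        using small g by (auto simp: disp_def)
      then have "card ((\<lambda>i :: int. g [^]\<^bsub>G\<^esub> i) ` {0..int N}) \<le> N"
        using RN[OF y q] card_mono by (meson le_trans)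
      moreover have "inj_on (\<lambda>i :: int. g [^]\<^bsub>G\<^esub> i) {0..int N}"
      proof (rule linorder_inj_onI)
        fix i j :: int assume "i < j"
        show "g [^]\<^bsub>G\<^esub> i \<noteq> g [^]\<^bsub>G\<^esub> j"
        proof
          assume "g [^]\<^bsub>G\<^esub> i = g [^]\<^bsub>G\<^esub> j"
          then have "g [^]\<^bsub>G\<^esub> (j - i) = \<one>\<^bsub>G\<^esub>" using g by (simp add: int_pow_diff)
          then have "\<phi> (g [^]\<^bsub>G\<^esub> (j - i)) y = y" using T_zero[OF y] by simp
          then obtain B where "disp n y \<le> B" for n
            using periodic_disp_bounded[OF y, of "j - i"] \<open>i < j\<close> by auto
          then show False using unbounded[OF y, of B] by (meson not_less)
        qed
      qed auto
      ultimately show False by (simp add: card_image)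
    qed
    have geo: "geodesic_space S d" using hyp by (simp add: hyperbolic_space_def)
    obtain y i where y: "y \<in> S" and i: "i \<in> {1..int N}" and "disp (2 * i) y \<ge> disp i y + 2 * \<delta> + 1"
      using exists_doubling[OF geo _ moved] x by blast
    then obtain C where "\<And>n :: nat. disp (int n) x \<ge> real n * (1 / of_int (int N)) - C"
      using growth_of_doubling[OF y i _ x] by blast
    then have "\<And>n :: nat. disp (int n) x \<ge> real n * \<rho> - C" by (simp add: \<rho>_def)
    from disp_power_ge[OF x this k\<rho> k1] \<rho> have "disp (int k) x \<ge>
      disp 1 x + (real k - 1) * \<rho> - 4 * \<delta>"
      by simp
    then have "disp (int k) x \<ge> disp 1 x + M" using kM \<delta> by linarith
    then show ?thesis using g by (simp add: disp_def int_pow_int)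
  qed
  then show ?thesis using k1 by (intro exI[of _ k]) auto
qed


section \<open>Tight spans of tree pseudometrics\<close>

text \<open>Distinct points may have distance 0, since all elements of a coset of
  \<open>H\<^sub>n\<close> represent the same vertex. The four-point inequality without error term
  expresses that the distances come from a tree, and it contains the triangle inequality.\<close>

locale tree_pseudometric =
  fixes V :: "'v set" and dst :: "'v \<Rightarrow> 'v \<Rightarrow> real"
  assumes V_nonempty: "V \<noteq> {}"
    and dst_self: "x \<in> V \<Longrightarrow> dst x x = 0"
    and dst_commute: "\<lbrakk>x \<in> V; y \<in> V\<rbrakk> \<Longrightarrow> dst x y = dst y x"
    and dst_four_point: "\<lbrakk>p \<in> V; q \<in> V; x \<in> V; y \<in> V\<rbrakk> \<Longrightarrow>
      dst p q + dst x y \<le> max (dst p x + dst q y) (dst p y + dst q x)"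
begin

lemma dst_triangle: "\<lbrakk>x \<in> V; y \<in> V; z \<in> V\<rbrakk> \<Longrightarrow> dst x z \<le> dst x y + dst y z"
  using dst_four_point[of x z y y] dst_self[of y] dst_commute[of y z] by simp

lemma dst_nonneg: "\<lbrakk>x \<in> V; y \<in> V\<rbrakk> \<Longrightarrow> 0 \<le> dst x y"
  using dst_four_point[of x x y y] dst_self[of y] dst_self[of x] by simp

text \<open>The last two conditions say that \<open>f x\<close> is the supremum of
  \<open>dst x y - f y\<close> over \<open>y\<close>, that is, \<open>f\<close> is an extremal
  function in the sense of Isbell and Dress. The value 0 outside \<open>V\<close> makes a function
  determined by its restriction to \<open>V\<close>.\<close>

definition tight_span :: "('v \<Rightarrow> real) set" where
  "tight_span = {f. (\<forall>x. x \<notin> V \<longrightarrow> f x = 0) \<and> (\<forall>x\<in>V. \<forall>y\<in>V. dst x y \<le> f x + f y) \<and>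
     (\<forall>x\<in>V. \<forall>e>0. \<exists>y\<in>V. f x + f y \<le> dst x y + e)}"

text \<open>The value \<open>0\<close> outside \<open>tight_span\<close> is needed because \<^const>\<open>Metric_space\<close> requires distances
  to be non-negative on the whole type.\<close>

definition sup_dist :: "('v \<Rightarrow> real) \<Rightarrow> ('v \<Rightarrow> real) \<Rightarrow> real" where
  "sup_dist f g = (if f \<in> tight_span \<and> g \<in> tight_span then SUP x\<in>V. \<bar>f x - g x\<bar> else 0)"

lemma tight_span_ge: "\<lbrakk>f \<in> tight_span; x \<in> V; y \<in> V\<rbrakk> \<Longrightarrow> dst x y \<le> f x + f y"
  by (simp add: tight_span_def)

lemma tight_span_approx:
  assumes "f \<in> tight_span" "x \<in> V" "0 < e"
  obtains y where "y \<in> V" "f x + f y \<le> dst x y + e"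
  using assms unfolding tight_span_def by blast

lemma tight_span_nonneg: "\<lbrakk>f \<in> tight_span; x \<in> V\<rbrakk> \<Longrightarrow> 0 \<le> f x"
  using tight_span_ge[of f x x] dst_self[of x] by simp

lemma tight_span_lipschitz:
  assumes f: "f \<in> tight_span" and x: "x \<in> V" and y: "y \<in> V"
  shows "f x \<le> f y + dst x y"
proof (rule field_le_epsilon)
  fix e :: real assume "0 < e"
  then obtain z where "z \<in> V" "f x + f z \<le> dst x z + e" using tight_span_approx f x by blast
  then show "f x \<le> f y + dst x y + e"
    using tight_span_ge[OF f y, of z] dst_triangle[OF x y, of z] by simp
qed

lemma sup_dist_bdd:
  assumes "f \<in> tight_span" "g \<in> tight_span"
  shows "bdd_above ((\<lambda>x. \<bar>f x - g x\<bar>) ` V)"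
proof -
  obtain v where v: "v \<in> V" using V_nonempty by blast
  have "\<bar>f x - g x\<bar> \<le> f v + g v" if "x \<in> V" for x
    using tight_span_lipschitz[OF assms(1) that v] tight_span_lipschitz[OF assms(2) that v]
      tight_span_ge[OF assms(1) that v] tight_span_ge[OF assms(2) that v] by linarith
  then show ?thesis by (rule bdd_aboveI2)
qed

lemma abs_diff_le_sup_dist:
  "\<lbrakk>f \<in> tight_span; g \<in> tight_span; x \<in> V\<rbrakk> \<Longrightarrow> \<bar>f x - g x\<bar> \<le> sup_dist f g"
  unfolding sup_dist_def by (simp add: cSUP_upper[OF _ sup_dist_bdd])

lemma sup_dist_le:
  "\<lbrakk>f \<in> tight_span; g \<in> tight_span; \<And>x. x \<in> V \<Longrightarrow> \<bar>f x - g x\<bar> \<le> c\<rbrakk> \<Longrightarrow> sup_dist f g \<le> c"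
  unfolding sup_dist_def by (simp add: cSUP_least[OF V_nonempty])

lemma sup_dist_nonneg: "0 \<le> sup_dist f g"
proof (cases "f \<in> tight_span \<and> g \<in> tight_span")
  case True
  obtain v where "v \<in> V" using V_nonempty by blast
  then show ?thesis using abs_diff_le_sup_dist[of f g v] True by linarith
qed (auto simp: sup_dist_def)

lemma sup_dist_commute: "sup_dist f g = sup_dist g f"
  by (simp add: sup_dist_def abs_minus_commute)

lemma sup_dist_ge:
  assumes "f \<in> tight_span" "g \<in> tight_span" "x \<in> V" "y \<in> V"
  shows "dst x y \<le> sup_dist f g + f x + g y"
  using abs_diff_le_sup_dist[OF assms(1-3)] tight_span_ge[OF assms(2-4)] by linarith

text \<open>Where the supremum of the differences is almost reached, an almost optimal partner for
  the larger of the two functions completes the pair. Together with \<open>sup_dist_ge\<close> this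
  makes \<open>sup_dist f g\<close> the supremum of \<open>dst x y - f x - g y\<close>, a form in
  which the four-point inequality passes from \<open>V\<close> to the span.\<close>

lemma sup_dist_approx:
  assumes f: "f \<in> tight_span" and g: "g \<in> tight_span" and e: "0 < e"
  obtains x y where "x \<in> V" "y \<in> V" "sup_dist f g + f x + g y \<le> dst x y + e"
proof -
  have "\<exists>x\<in>V. sup_dist f g - e / 2 < \<bar>f x - g x\<bar>"
    using less_cSUP_iff[OF V_nonempty sup_dist_bdd[OF f g], of "sup_dist f g - e / 2"] e
    by (simp add: sup_dist_def f g)
  then obtain x where x: "x \<in> V" "sup_dist f g - e / 2 < \<bar>f x - g x\<bar>" by blast
  obtain y where y: "y \<in> V" "f x + f y \<le> dst x y + e / 2"
    using tight_span_approx[OF f x(1)] e by (metis half_gt_zero)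
  obtain z where z: "z \<in> V" "g x + g z \<le> dst x z + e / 2"
    using tight_span_approx[OF g x(1)] e by (metis half_gt_zero)
  show thesis
  proof (cases "f x \<le> g x")
    case True
    then show thesis using that[of x z] x z by linarith
  next
    case False
    then show thesis using that[of y x] x y dst_commute[of x y] by linarith
  qed
qed

lemma sup_dist_four_point:
  assumes "f \<in> tight_span" "g \<in> tight_span" "h \<in> tight_span" "k \<in> tight_span"
  shows "sup_dist f g + sup_dist h k \<le>
    max (sup_dist f h + sup_dist g k) (sup_dist f k + sup_dist g h)"
proof (rule field_le_epsilon)
  fix e :: real assume "0 < e"
  then have e: "0 < e / 2" by simp
  obtain x y where xy: "x \<in> V" "y \<in> V" "sup_dist f g + f x + g y \<le> dst x y + e / 2"
    using sup_dist_approx[OF assms(1,2) e] .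
  obtain z w where zw: "z \<in> V" "w \<in> V" "sup_dist h k + h z + k w \<le> dst z w + e / 2"
    using sup_dist_approx[OF assms(3,4) e] .
  show "sup_dist f g + sup_dist h k \<le>
    max (sup_dist f h + sup_dist g k) (sup_dist f k + sup_dist g h) + e"
    using dst_four_point[OF xy(1,2) zw(1,2)] xy(3) zw(3)
      sup_dist_ge[OF assms(1,3) xy(1) zw(1)] sup_dist_ge[OF assms(2,4) xy(2) zw(2)]
      sup_dist_ge[OF assms(1,4) xy(1) zw(2)] sup_dist_ge[OF assms(2,3) xy(2) zw(1)]
    by linarith
qed

lemma Metric_space_tight_span: "Metric_space tight_span sup_dist"
proof
  show "0 \<le> sup_dist f g" for f g by (rule sup_dist_nonneg)
  show "sup_dist f g = sup_dist g f" for f g by (rule sup_dist_commute)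
  show "sup_dist f g = 0 \<longleftrightarrow> f = g" if fg: "f \<in> tight_span" "g \<in> tight_span" for f g
  proof
    assume 0: "sup_dist f g = 0"
    show "f = g"
    proof
      fix x
      show "f x = g x"
        using abs_diff_le_sup_dist[OF fg, of x] 0 fg by (cases "x \<in> V") (auto simp: tight_span_def)
    qed
  next
    assume "f = g"
    then show "sup_dist f g = 0" using sup_dist_le[OF fg, of 0] sup_dist_nonneg[of f g] by simp
  qed
  show "sup_dist f h \<le> sup_dist f g + sup_dist g h"
    if fgh: "f \<in> tight_span" "g \<in> tight_span" "h \<in> tight_span" for f g h
  proof (rule sup_dist_le[OF fgh(1,3)])
    show "\<bar>f x - h x\<bar> \<le> sup_dist f g + sup_dist g h" if "x \<in> V" for x
      using abs_diff_le_sup_dist[OF fgh(1,2) that] abs_diff_le_sup_dist[OF fgh(2,3) that]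
        by linarith
  qed
qed

section \<open>The embedding of the points and the geodesics of the tight span\<close>

definition embed :: "'v \<Rightarrow> 'v \<Rightarrow> real" where
  "embed x = (\<lambda>y. if y \<in> V then dst x y else 0)"

lemma embed_in_tight_span: "x \<in> V \<Longrightarrow> embed x \<in> tight_span"
proof -
  assume x: "x \<in> V"
  have "dst y z \<le> dst x y + dst x z" if "y \<in> V" "z \<in> V" for y z
    using dst_triangle[OF that(1) x that(2)] dst_commute[OF x that(1)] by simp
  moreover have "\<exists>z\<in>V. dst x y + dst x z \<le> dst y z + e" if "y \<in> V" "0 < e" for y e
    using dst_self[OF x] dst_commute[OF x that(1)] that(2) x by (intro bexI[of _ x]) auto
  ultimately show ?thesis by (simp add: tight_span_def embed_def)
qed

lemma sup_dist_embed:
  assumes f: "f \<in> tight_span" and x: "x \<in> V"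
  shows "sup_dist f (embed x) = f x"
proof (rule antisym)
  show "sup_dist f (embed x) \<le> f x"
  proof (rule sup_dist_le[OF f embed_in_tight_span[OF x]])
    fix y assume y: "y \<in> V"
    show "\<bar>f y - embed x y\<bar> \<le> f x"
      using tight_span_lipschitz[OF f y x] tight_span_ge[OF f x y] dst_commute[OF x y] y
      by (simp add: embed_def)
  qed
  show "f x \<le> sup_dist f (embed x)"
    using abs_diff_le_sup_dist[OF f embed_in_tight_span[OF x] x] x dst_self[OF x]
      by (simp add: embed_def)
qed

lemma sup_dist_embed_embed: "\<lbrakk>x \<in> V; y \<in> V\<rbrakk> \<Longrightarrow> sup_dist (embed x) (embed y) = dst x y"
  by (simp add: sup_dist_embed[OF embed_in_tight_span]) (simp add: embed_def)

text \<open>In a tree, the distance of a point \<open>x\<close> from the point at distance \<open>r\<close> from \<open>u\<close> on the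
  segment \<open>[u, v]\<close> is the maximum of \<open>dst x u - r\<close> and \<open>dst x v - (dst u v - r)\<close>.\<close>

definition geodesic_path :: "('v \<Rightarrow> real) \<Rightarrow> ('v \<Rightarrow> real) \<Rightarrow> real \<Rightarrow> 'v \<Rightarrow> real" where
  "geodesic_path f g r = (\<lambda>x. if x \<in> V then max (f x - r) (g x - (sup_dist f g - r)) else 0)"

text \<open>The lower bound is the four-point inequality for \<open>f\<close>, \<open>g\<close> and
  two embedded points. For extremality, an almost optimal partner of \<open>x\<close> for
  \<open>f\<close> serves where the first term of the maximum dominates, and one for
  \<open>g\<close> elsewhere.\<close>

lemma geodesic_path_in_tight_span:
  assumes f: "f \<in> tight_span" and g: "g \<in> tight_span" and r: "0 \<le> r" "r \<le> sup_dist f g"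
  shows "geodesic_path f g r \<in> tight_span"
proof -
  note fg = abs_diff_le_sup_dist[OF f g]
  have lower: "dst x y \<le> geodesic_path f g r x + geodesic_path f g r y" if xy: "x \<in> V" "y \<in> V"
    for x y
  proof -
    have "sup_dist f g + dst x y \<le> max (f x + g y) (f y + g x)"
      using sup_dist_four_point[OF f g embed_in_tight_span[OF xy(1)] embed_in_tight_span[OF xy(2)]]
        sup_dist_embed sup_dist_embed_embed f g xy by simp
    then show ?thesis unfolding geodesic_path_def using xy by simp
  qed
  have upper: "\<exists>y\<in>V. geodesic_path f g r x + geodesic_path f g r y \<le> dst x y + e"
    if x: "x \<in> V" and e: "e > 0" for x e
  proof -
    obtain y where y: "y \<in> V" "f x + f y \<le> dst x y + e" using tight_span_approx[OF f x e] .
    obtain z where z: "z \<in> V" "g x + g z \<le> dst x z + e" using tight_span_approx[OF g x e] .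
    show ?thesis
    proof (cases "g x - (sup_dist f g - r) \<le> f x - r")
      case True
      then show ?thesis using fg[OF y(1)] x y r
        by (intro bexI[of _ y]) (auto simp: geodesic_path_def max_def)
    next
      case False
      then show ?thesis using fg[OF z(1)] x z r
        by (intro bexI[of _ z]) (auto simp: geodesic_path_def max_def)
    qed
  qed
  show ?thesis
    unfolding tight_span_def using lower upper by (auto simp: geodesic_path_def)
qed

lemma geodesic_path_ends:
  assumes f: "f \<in> tight_span" and g: "g \<in> tight_span"
  shows "geodesic_path f g 0 = f" "geodesic_path f g (sup_dist f g) = g"
proof -
  note fg = abs_diff_le_sup_dist[OF f g]
  show "geodesic_path f g 0 = f"
  proof
    show "geodesic_path f g 0 x = f x" for x
      using fg[of x] f by (cases "x \<in> V") (auto simp: geodesic_path_def tight_span_def max_def)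
  qed
  show "geodesic_path f g (sup_dist f g) = g"
  proof
    show "geodesic_path f g (sup_dist f g) x = g x" for x
      using fg[of x] g by (cases "x \<in> V") (auto simp: geodesic_path_def tight_span_def max_def)
  qed
qed

lemma geodesic_space_tight_span: "geodesic_space tight_span sup_dist"
  unfolding geodesic_space_def
proof (intro conjI ballI)
  show "Metric_space tight_span sup_dist" by (rule Metric_space_tight_span)
  interpret Metric_space tight_span sup_dist by (rule Metric_space_tight_span)
  fix f g assume fg: "f \<in> tight_span" "g \<in> tight_span"
  let ?\<gamma> = "geodesic_path f g" and ?D = "sup_dist f g"
  have in_span: "?\<gamma> r \<in> tight_span" if "r \<in> {0..?D}" for r
    using geodesic_path_in_tight_span[OF fg] that by simp
  have le: "sup_dist (?\<gamma> s) (?\<gamma> t) \<le> \<bar>s - t\<bar>" if "s \<in> {0..?D}" "t \<in> {0..?D}" for s t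
    by (intro sup_dist_le in_span that) (auto simp: geodesic_path_def max_def)
  \<comment> \<open>The path is 1-Lipschitz and its ends are at distance \<open>?D\<close>, so no
    piece of it can be shorter than its parameter interval.\<close>
  have eq: "sup_dist (?\<gamma> s) (?\<gamma> t) = \<bar>s - t\<bar>" if "s \<le> t" "s \<in> {0..?D}" "t \<in> {0..?D}" for s t
  proof -
    have "?D \<le> sup_dist (?\<gamma> 0) (?\<gamma> s) + sup_dist (?\<gamma> s) (?\<gamma> t) + sup_dist (?\<gamma> t) (?\<gamma> ?D)"
      using triangle[of f "?\<gamma> s" g] triangle[of "?\<gamma> s" "?\<gamma> t" g] in_span that fg
      by (simp add: geodesic_path_ends[OF fg])
    then show ?thesis using le[of 0 s] le[of s t] le[of t ?D] that by simp
  qed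
  have "sup_dist (?\<gamma> s) (?\<gamma> t) = \<bar>s - t\<bar>" if "s \<in> {0..?D}" "t \<in> {0..?D}" for s t
    using eq[of s t] eq[of t s] sup_dist_commute[of "?\<gamma> s" "?\<gamma> t"] that by (cases "s \<le> t") auto
  then show "\<exists>\<gamma>. \<gamma> 0 = f \<and> \<gamma> ?D = g \<and> \<gamma> \<in> {0..?D} \<rightarrow> tight_span \<and>
      (\<forall>s\<in>{0..?D}. \<forall>t\<in>{0..?D}. sup_dist (\<gamma> s) (\<gamma> t) = \<bar>s - t\<bar>)"
    using geodesic_path_ends[OF fg] in_span by (intro exI[of _ ?\<gamma>]) auto
qed

lemma hyperbolic_space_tight_span: "hyperbolic_space tight_span sup_dist"
proof -
  interpret Metric_space tight_span sup_dist by (rule Metric_space_tight_span)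
  have "gromov_product sup_dist p x z \<ge>
    min (gromov_product sup_dist p x y) (gromov_product sup_dist p y z) - 0"
    if "p \<in> tight_span" "x \<in> tight_span" "y \<in> tight_span" "z \<in> tight_span" for p x y z
    using sup_dist_four_point[of p y x z] sup_dist_commute[of x y] that
    by (auto simp: gromov_product_def min_def max_def field_simps split: if_splits)
  then have "gromov_hyperbolic tight_span sup_dist"
    unfolding gromov_hyperbolic_def by (intro exI[of _ 0]) simp
  moreover have "tight_span \<noteq> {}" using V_nonempty embed_in_tight_span by blast
  ultimately show ?thesis using geodesic_space_tight_span by (simp add: hyperbolic_space_def)
qed

end


section \<open>Groups with a tree length function\<close>

text \<open>A Lyndon length function: \<open>len x\<close> is the distance of the base vertex from
  its translate by \<open>x\<close>. \<open>len_four_point\<close> is the four-point inequality for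
  the translates by \<open>\<one>\<close>, \<open>z\<close>, \<open>x\<close>, \<open>y\<close>. In
  \<open>edge_stabilizer\<close> the element \<open>g\<close> fixes two different translates, hence
  an edge. \<open>connected\<close> keeps every point of the tight span close to the orbit.\<close>

locale tree_length = group G for G :: "('a, 'm) monoid_scheme" (structure) +
  fixes len :: "'a \<Rightarrow> nat"
  assumes len_one: "len \<one> = 0"
    and len_inv: "x \<in> carrier G \<Longrightarrow> len (inv x) = len x"
    and len_four_point: "\<lbrakk>x \<in> carrier G; y \<in> carrier G; z \<in> carrier G\<rbrakk> \<Longrightarrow>
      len z + len (inv x \<otimes> y) \<le> max (len x + len (inv z \<otimes> y)) (len y + len (inv z \<otimes> x))"
    and edge_stabilizer: "\<lbrakk>k \<in> carrier G; g \<in> carrier G; len k > 0; len g = 0;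
      len (inv k \<otimes> g \<otimes> k) = 0\<rbrakk> \<Longrightarrow> g = \<one>"
    and connected: "g \<in> carrier G \<Longrightarrow>
      (\<one>, g) \<in> {(x, y). x \<in> carrier G \<and> y \<in> carrier G \<and> len (inv x \<otimes> y) \<le> 1}\<^sup>*"
begin

definition gdist :: "'a \<Rightarrow> 'a \<Rightarrow> real" where
  "gdist x y = real (len (inv x \<otimes> y))"

lemma inv_mult_cancel:
  "\<lbrakk>g \<in> carrier G; x \<in> carrier G; y \<in> carrier G\<rbrakk> \<Longrightarrow> inv (g \<otimes> x) \<otimes> (g \<otimes> y) = inv x \<otimes> y"
  by (simp add: inv_mult_group m_assoc flip: m_assoc[of "inv g" g y])

lemma mult_inv_cancel: "\<lbrakk>x \<in> carrier G; y \<in> carrier G\<rbrakk> \<Longrightarrow> x \<otimes> (inv x \<otimes> y) = y"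
  by (simp flip: m_assoc)

lemma gdist_left_mult:
  "\<lbrakk>g \<in> carrier G; x \<in> carrier G; y \<in> carrier G\<rbrakk> \<Longrightarrow> gdist (g \<otimes> x) (g \<otimes> y) = gdist x y"
  by (simp add: gdist_def inv_mult_cancel)

sublocale tree_pseudometric "carrier G" gdist
proof
  show "carrier G \<noteq> {}" by blast
  show "gdist x x = 0" if "x \<in> carrier G" for x using that by (simp add: gdist_def len_one)
  show "gdist x y = gdist y x" if "x \<in> carrier G" "y \<in> carrier G" for x y
    using that len_inv[of "inv x \<otimes> y"] by (simp add: gdist_def inv_mult_group)
  show "gdist p q + gdist x y \<le> max (gdist p x + gdist q y) (gdist p y + gdist q x)"
    if "p \<in> carrier G" "q \<in> carrier G" "x \<in> carrier G" "y \<in> carrier G" for p q x y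
    using len_four_point[of "inv p \<otimes> x" "inv p \<otimes> y" "inv p \<otimes> q"] that
    by (simp add: gdist_def inv_mult_cancel)
qed

text \<open>Conjugation by \<open>x\<close> transports the axiom from the pair
  \<open>\<one>\<close>, \<open>k\<close> to an arbitrary pair.\<close>

lemma dist_edge_stabilizer:
  assumes c: "x \<in> carrier G" "y \<in> carrier G" "g \<in> carrier G"
    and xy: "gdist x y > 0" and fixed: "gdist x (g \<otimes> x) = 0" "gdist y (g \<otimes> y) = 0"
  shows "g = \<one>"
proof -
  define k where "k = inv x \<otimes> y"
  define h where "h = inv x \<otimes> g \<otimes> x"
  have kh: "k \<in> carrier G" "h \<in> carrier G" using c by (auto simp: k_def h_def)
  have "inv k \<otimes> h \<otimes> k = inv y \<otimes> (g \<otimes> y)"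
    using c by (simp add: k_def h_def inv_mult_group m_assoc mult_inv_cancel)
  then have "h = \<one>"
    using edge_stabilizer[OF kh] xy fixed c by (simp add: gdist_def k_def h_def m_assoc)
  then have "x \<otimes> h \<otimes> inv x = \<one>" using c by simp
  moreover have "x \<otimes> h \<otimes> inv x = g"
    using c by (simp add: h_def m_assoc mult_inv_cancel)
  ultimately show ?thesis using c by simp
qed

lemma connected_pair:
  assumes "x \<in> carrier G" "y \<in> carrier G"
  shows "(x, y) \<in> {(x, y). x \<in> carrier G \<and> y \<in> carrier G \<and> gdist x y \<le> 1}\<^sup>*" (is "_ \<in> ?E\<^sup>*")
proof -
  have "(x \<otimes> a, x \<otimes> b) \<in> ?E\<^sup>*"
    if "(a, b) \<in> {(x, y). x \<in> carrier G \<and> y \<in> carrier G \<and> len (inv x \<otimes> y) \<le> 1}\<^sup>*" for a b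
    using that
  proof (induction rule: rtrancl_induct)
    case (step b c)
    then have "(x \<otimes> b, x \<otimes> c) \<in> ?E" using assms by (simp add: gdist_left_mult) (simp add: gdist_def)
    with step.IH show ?case by (rule rtrancl_into_rtrancl)
  qed simp
  from this[OF connected[of "inv x \<otimes> y"]] show ?thesis
    using assms by (simp flip: m_assoc)
qed

text \<open>Walk from \<open>p\<close> to \<open>q\<close> in steps of length at most \<open>1\<close>. When the projection to the segment
  passes \<open>r\<close>, one of the two ends of the step lies on the segment, since distances are
  integers.\<close>

lemma exists_between:
  assumes p: "p \<in> carrier G" and q: "q \<in> carrier G" and r: "0 \<le> r" "r < gdist p q"
  obtains z where "z \<in> carrier G" "gdist p z + gdist z q = gdist p q" "\<bar>gdist p z - r\<bar> \<le> 1"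
proof -
  let ?E = "{(x, y). x \<in> carrier G \<and> y \<in> carrier G \<and> gdist x y \<le> 1}"
  \<comment> \<open>\<open>gdist p v + gdist p q - gdist v q\<close> is twice the distance from
    \<open>p\<close> to the projection of \<open>v\<close> to the segment.\<close>
  have "v \<in> carrier G \<and> (gdist p v + gdist p q - gdist v q > 2 * r \<longrightarrow>
      (\<exists>z\<in>carrier G. gdist p z + gdist z q = gdist p q \<and> \<bar>gdist p z - r\<bar> \<le> 1))" if "(p, v) \<in> ?E\<^sup>*"
        for v
    using that
  proof (induction rule: rtrancl_induct)
    case base
    then show ?case using p r dst_self by simp
  next
    case (step v w)
    then have c: "v \<in> carrier G" "w \<in> carrier G" and vw: "gdist v w \<le> 1" by auto
    show ?case
    proof (intro conjI impI)
      assume w: "gdist p w + gdist p q - gdist w q > 2 * r"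
      show "\<exists>z\<in>carrier G. gdist p z + gdist z q = gdist p q \<and> \<bar>gdist p z - r\<bar> \<le> 1"
      proof (cases "gdist p v + gdist p q - gdist v q > 2 * r")
        case True
        then show ?thesis using step by blast
      next
        case False
        have "gdist p w + gdist q v \<le> max (gdist p q + gdist w v) (gdist p v + gdist q w)"
          using dst_four_point[OF p c(2) q c(1)] dst_commute[OF q c(1)] dst_commute[OF q c(2)]
            by simp
        \<comment> \<open>The second alternative of the maximum is excluded because the projection
          of \<open>w\<close> lies beyond \<open>r\<close> and that of \<open>v\<close> does
          not.\<close>
        then have up: "gdist p w + gdist v q \<le> gdist p q + 1"
          using w False vw dst_commute[OF q c(1)] dst_commute[OF q c(2)] dst_commute[OF c]
            by linarith
        have tri: "gdist p q \<le> gdist p v + gdist v q" "gdist p q \<le> gdist p w + gdist w q"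
          "gdist p w \<le> gdist p v + gdist v w" "gdist v q \<le> gdist v w + gdist w q"
          using dst_triangle p q c by auto
        have "gdist p v + gdist v q = gdist p q \<or> gdist p w + gdist w q = gdist p q"
        proof (rule ccontr)
          assume "\<not> ?thesis"
          then have "gdist p v + gdist v q > gdist p q" "gdist p w + gdist w q > gdist p q"
            using tri by auto
          then have "gdist p v + gdist v q \<ge> gdist p q + 1" "gdist p w + gdist w q \<ge> gdist p q + 1"
            unfolding gdist_def by (simp_all flip: of_nat_add)
          then show False using up w False by linarith
        qed
        then show ?thesis
        proof
          assume v: "gdist p v + gdist v q = gdist p q"
          then have "\<bar>gdist p v - r\<bar> \<le> 1" using w False tri(3,4) vw by linarith
          then show ?thesis using v c by blast
        next
          assume w': "gdist p w + gdist w q = gdist p q"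
          then have "\<bar>gdist p w - r\<bar> \<le> 1" using w False tri(3,4) vw by linarith
          then show ?thesis using w' c by blast
        qed
      qed
    qed (rule c)
  qed
  from this[OF connected_pair[OF p q]] show thesis
    using r dst_self[OF q] that by auto
qed

text \<open>Extremality at \<open>\<one>\<close> provides \<open>y\<close> such that
  \<open>f\<close> lies on the segment from \<open>\<one>\<close> to \<open>y\<close> up to an error
  of 1; the group element \<open>z\<close> on that segment at distance about \<open>f \<one>\<close>
  from \<open>\<one>\<close> is close to \<open>f\<close>. The bound 2 adds this error to the
  rounding error 1 of \<open>exists_between\<close>.\<close>

lemma tight_span_near_embed:
  assumes f: "f \<in> tight_span"
  obtains z where "z \<in> carrier G" "sup_dist f (embed z) \<le> 2"
proof -
  obtain y where y: "y \<in> carrier G" "f \<one> + f y \<le> gdist \<one> y + 1"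
    using tight_span_approx[OF f one_closed, of 1] by auto
  have fy: "f \<one> \<ge> 0" "f y \<ge> 0" using tight_span_nonneg f y by auto
  have "\<exists>z\<in>carrier G. gdist \<one> z + gdist z y = gdist \<one> y \<and> \<bar>gdist \<one> z - f \<one>\<bar> \<le> 1"
  proof (cases "f \<one> < gdist \<one> y")
    case True
    then show ?thesis using exists_between[OF one_closed y(1) fy(1)] by blast
  next
    case False
    then show ?thesis using y fy dst_self[OF y(1)] by (intro bexI[of _ y]) auto
  qed
  then obtain z where z: "z \<in> carrier G" "gdist \<one> z + gdist z y = gdist \<one> y" "\<bar>gdist \<one> z - f \<one>\<bar> \<le> 1"
    by blast
  have "f z + gdist \<one> y \<le> max (f \<one> + gdist z y) (f y + gdist z \<one>)"
    using sup_dist_four_point[OF f embed_in_tight_span embed_in_tight_span embed_in_tight_span, of z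
      \<one> y] f y(1) z(1)
    by (simp add: sup_dist_embed sup_dist_embed_embed)
  then have "f z \<le> 2" using z y fy dst_commute[OF z(1) one_closed] by linarith
  then show thesis using that[OF z(1)] f z by (simp add: sup_dist_embed)
qed

text \<open>Two points \<open>z\<close> and \<open>w\<close> in the interior of the segment from \<open>p\<close> to \<open>q\<close> are mapped to the
  same segment by every such \<open>g\<close>, so by the triviality of edge stabilisers their distances to
  \<open>p\<close> determine \<open>g\<close>.\<close>

lemma finite_card_near_pair:
  assumes p: "p \<in> carrier G" and q: "q \<in> carrier G" and K: "0 \<le> K" and pq: "gdist p q \<ge> 2 * K + 7"
  defines "A \<equiv> {g \<in> carrier G. gdist p (g \<otimes> p) \<le> K \<and> gdist q (g \<otimes> q) \<le> K}"
  shows "finite A" "card A \<le> (nat \<lfloor>2 * K + 6\<rfloor> + 1)\<^sup>2"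
proof -
  \<comment> \<open>The distances of \<open>z\<close> and \<open>w\<close> from \<open>p\<close> lie
    in \<open>[K + 1, K + 3]\<close> and \<open>[K + 4, K + 6]\<close>. So the two points are apart,
    and by \<open>gdist p q \<ge> 2 * K + 7\<close> both are further than \<open>K\<close> from
    either end.\<close>
  obtain z where z: "z \<in> carrier G" "gdist p z + gdist z q = gdist p q" "\<bar>gdist p z - (K + 2)\<bar> \<le> 1"
    using exists_between[OF p q, of "K + 2"] pq K by auto
  obtain w where w: "w \<in> carrier G" "gdist p w + gdist w q = gdist p q" "\<bar>gdist p w - (K + 5)\<bar> \<le> 1"
    using exists_between[OF p q, of "K + 5"] pq K by auto
  have zw: "gdist z w > 0" using dst_triangle[OF p z(1) w(1)] z(3) w(3) by linarith
  have between: "gdist p (g \<otimes> v) + gdist (g \<otimes> v) q = gdist p q"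
    if g: "g \<in> A" and v: "v \<in> carrier G" "gdist p v + gdist v q = gdist p q" "gdist p v > K"
      "gdist v q > K" for g v
  proof -
    have gc: "g \<in> carrier G" and gK: "gdist p (g \<otimes> p) \<le> K" "gdist q (g \<otimes> q) \<le> K"
      using g by (auto simp: A_def)
    define y where "y = g \<otimes> v"
    have y: "y \<in> carrier G" "g \<otimes> p \<in> carrier G" "g \<otimes> q \<in> carrier G" using gc v p q
      by (auto simp: y_def)
    have moved: "gdist (g \<otimes> p) y = gdist p v" "gdist y (g \<otimes> q) = gdist v q"
      "gdist (g \<otimes> p) (g \<otimes> q) = gdist p q"
      using gdist_left_mult gc v p q by (auto simp: y_def)
    have sym: "gdist (g \<otimes> p) p = gdist p (g \<otimes> p)" "gdist y (g \<otimes> p) = gdist (g \<otimes> p) y"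
      "gdist y p = gdist p y"
      using dst_commute y p by auto
    have "gdist (g \<otimes> p) (g \<otimes> q) + gdist p y \<le>
      max (gdist p (g \<otimes> p) + gdist y (g \<otimes> q)) (gdist p (g \<otimes> q) + gdist (g \<otimes> p) y)"
      using dst_four_point[OF y(2,3) p y(1)] dst_commute[OF y(3) p] dst_commute[OF y(3,1)]
      by (simp add: sym add.commute max.commute)
    then have 1: "gdist p (g \<otimes> q) \<ge> gdist p q + gdist p y - gdist p v"
      using moved gK v dst_nonneg[OF p y(1)] by linarith
    have "gdist p (g \<otimes> q) + gdist y q \<le>
      max (gdist p q + gdist y (g \<otimes> q)) (gdist q (g \<otimes> q) + gdist p y)"
      using dst_four_point[OF p y(3) q y(1)] dst_commute[OF y(3) q] dst_commute[OF y(3,1)]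
        dst_commute[OF q y(1)]
      by (simp add: add.commute max.commute)
    then have "gdist p y + gdist y q \<le> gdist p q"
      using 1 moved gK v dst_nonneg[OF y(1) q] by linarith
    then show ?thesis using dst_triangle[OF p y(1) q] by (simp add: y_def)
  qed
  have same: "gdist v (inv g \<otimes> h \<otimes> v) = 0"
    if gh: "g \<in> A" "h \<in> A"
      and v: "v \<in> carrier G" "gdist p v + gdist v q = gdist p q" "gdist p v > K" "gdist v q > K"
      and eq: "gdist p (g \<otimes> v) = gdist p (h \<otimes> v)" for g h v
  proof -
    have c: "g \<in> carrier G" "h \<in> carrier G" using gh by (auto simp: A_def)
    then have gv: "g \<otimes> v \<in> carrier G" "h \<otimes> v \<in> carrier G" using v by auto
    have "gdist (g \<otimes> v) (h \<otimes> v) \<le> 0"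
      using dst_four_point[OF p q gv] between[OF gh(1) v] between[OF gh(2) v] eq
        dst_commute[OF q gv(1)] dst_commute[OF q gv(2)] by simp
    then show ?thesis
      using gdist_left_mult[of "inv g" "g \<otimes> v" "h \<otimes> v"] c gv v dst_nonneg[OF gv]
      by (simp add: m_assoc flip: m_assoc[of "inv g" g v])
  qed
  define F where "F g = (len (inv p \<otimes> (g \<otimes> z)), len (inv p \<otimes> (g \<otimes> w)))" for g
  let ?M = "nat \<lfloor>2 * K + 6\<rfloor>"
  have bound: "len (inv p \<otimes> (g \<otimes> v)) \<le> ?M"
    if g: "g \<in> A" and v: "v \<in> carrier G" "gdist p v \<le> K + 6" for g v
  proof -
    have gc: "g \<in> carrier G" and gK: "gdist p (g \<otimes> p) \<le> K" using g by (auto simp: A_def)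
    have "gdist p (g \<otimes> v) \<le> gdist p (g \<otimes> p) + gdist (g \<otimes> p) (g \<otimes> v)"
      by (intro dst_triangle) (use gc p v in auto)
    then have "gdist p (g \<otimes> v) \<le> 2 * K + 6" using gdist_left_mult[OF gc p v(1)] gK v by linarith
    then show ?thesis unfolding gdist_def by (rule le_nat_floor)
  qed
  have "F ` A \<subseteq> {..?M} \<times> {..?M}"
    using bound z w unfolding F_def by fastforce
  moreover have "inj_on F A"
  proof (rule inj_onI)
    fix g h assume gh: "g \<in> A" "h \<in> A" "F g = F h"
    then have c: "g \<in> carrier G" "h \<in> carrier G" by (auto simp: A_def)
    have "gdist p (g \<otimes> z) = gdist p (h \<otimes> z)" "gdist p (g \<otimes> w) = gdist p (h \<otimes> w)"
      using gh(3) by (auto simp: F_def gdist_def)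
    then have "gdist z (inv g \<otimes> h \<otimes> z) = 0" "gdist w (inv g \<otimes> h \<otimes> w) = 0"
      using same[OF gh(1,2) z(1,2)] same[OF gh(1,2) w(1,2)] z w pq by auto
    then have "inv g \<otimes> h = \<one>" using dist_edge_stabilizer[OF z(1) w(1) _ zw] c by simp
    then show "g = h" using c by (metis inv_equality inv_inv inv_closed)
  qed
  ultimately show "finite A"
    by (meson finite_SigmaI finite_atMost finite_imageD finite_subset)
  have "card A = card (F ` A)" using \<open>inj_on F A\<close> by (simp add: card_image)
  also have "\<dots> \<le> card ({..?M} \<times> {..?M})"
    by (rule card_mono[OF _ \<open>F ` A \<subseteq> _\<close>]) simp
  also have "\<dots> = (?M + 1)\<^sup>2" by (simp add: card_cartesian_product power2_eq_square)
  finally show "card A \<le> (?M + 1)\<^sup>2" .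
qed

section \<open>The isometric action on the tight span\<close>

definition act :: "'a \<Rightarrow> ('a \<Rightarrow> real) \<Rightarrow> 'a \<Rightarrow> real" where
  "act g = (\<lambda>f\<in>tight_span. \<lambda>x. if x \<in> carrier G then f (inv g \<otimes> x) else 0)"

lemma act_in_tight_span:
  assumes g: "g \<in> carrier G" and f: "f \<in> tight_span"
  shows "act g f \<in> tight_span"
proof -
  have dist_inv: "gdist (inv g \<otimes> x) (inv g \<otimes> y) = gdist x y" if "x \<in> carrier G" "y \<in> carrier G"
    for x y
    using gdist_left_mult g that by simp
  have "\<exists>y\<in>carrier G. act g f x + act g f y \<le> gdist x y + e" if x: "x \<in> carrier G" and e: "0 < e"
    for x e
  proof -
    obtain y where y: "y \<in> carrier G" "f (inv g \<otimes> x) + f y \<le> gdist (inv g \<otimes> x) y + e"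
      using tight_span_approx[OF f _ e, of "inv g \<otimes> x"] g x by auto
    have "inv g \<otimes> (g \<otimes> y) = y" using y g by (simp flip: m_assoc)
    then show ?thesis
      using y g x f dist_inv[of x "g \<otimes> y"] by (intro bexI[of _ "g \<otimes> y"]) (auto simp: act_def)
  qed
  moreover have "gdist x y \<le> act g f x + act g f y" if "x \<in> carrier G" "y \<in> carrier G" for x y
    using tight_span_ge[OF f, of "inv g \<otimes> x" "inv g \<otimes> y"] dist_inv[OF that] g f that
      by (simp add: act_def)
  moreover have "act g f x = 0" if "x \<notin> carrier G" for x using that f by (simp add: act_def)
  ultimately show ?thesis unfolding tight_span_def by blast
qed

lemma act_one:
  assumes "f \<in> tight_span"
  shows "act \<one> f = f"
  using assms by (auto simp: act_def tight_span_def fun_eq_iff)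

lemma act_mult:
  assumes "g \<in> carrier G" "h \<in> carrier G" "f \<in> tight_span"
  shows "act (g \<otimes> h) f = act g (act h f)"
  using assms act_in_tight_span[of h f]
  by (auto simp: act_def fun_eq_iff inv_mult_group m_assoc)

lemma sup_dist_act:
  assumes g: "g \<in> carrier G" and f: "f \<in> tight_span" and h: "h \<in> tight_span"
  shows "sup_dist (act g f) (act g h) = sup_dist f h"
proof -
  have le: "sup_dist (act g f) (act g h) \<le> sup_dist f h"
    if "g \<in> carrier G" "f \<in> tight_span" "h \<in> tight_span" for g f h
    using that abs_diff_le_sup_dist[of f h "inv g \<otimes> _"]
    by (intro sup_dist_le act_in_tight_span) (auto simp: act_def)
  have "sup_dist f h = sup_dist (act (inv g) (act g f)) (act (inv g) (act g h))"
    using assms by (simp add: act_one flip: act_mult)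
  also have "\<dots> \<le> sup_dist (act g f) (act g h)"
    using assms by (intro le) (auto intro: act_in_tight_span)
  finally show ?thesis using le[OF assms] by linarith
qed

lemma act_embed:
  assumes "g \<in> carrier G" "x \<in> carrier G"
  shows "act g (embed x) = embed (g \<otimes> x)"
proof
  show "act g (embed x) y = embed (g \<otimes> x) y" for y
    using assms embed_in_tight_span[of x] gdist_left_mult[of "inv g" "g \<otimes> x" y]
    by (cases "y \<in> carrier G") (auto simp: act_def embed_def simp flip: m_assoc)
qed

lemma isometric_action_act: "isometric_action G tight_span sup_dist act"
proof -
  have bij: "act g \<in> Bij tight_span" if g: "g \<in> carrier G" for g
  proof -
    have "bij_betw (act g) tight_span tight_span"
      by (rule bij_betw_byWitness[of _ "act (inv g)"])
        (use g act_in_tight_span in \<open>auto simp: act_one simp flip: act_mult\<close>)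
    then show ?thesis by (simp add: Bij_def act_def)
  qed
  have "act \<in> hom G (BijGroup tight_span)"
  proof (rule homI)
    show "act g \<in> carrier (BijGroup tight_span)" if "g \<in> carrier G" for g
      using bij[OF that] by (simp add: BijGroup_def)
    show "act (g \<otimes> h) = act g \<otimes>\<^bsub>BijGroup tight_span\<^esub> act h" if gh: "g \<in> carrier G" "h \<in> carrier G"
      for g h
    proof -
      have "act (g \<otimes> h) f = compose tight_span (act g) (act h) f" for f
        using act_mult[OF gh, of f] by (cases "f \<in> tight_span") (auto simp: compose_def act_def)
      then show ?thesis using bij gh by (auto simp: BijGroup_def)
    qed
  qed
  then have "group_action G tight_span act"
    unfolding group_action_def group_hom_def group_hom_axioms_def
    using group_axioms group_BijGroup by blast
  then show ?thesis
    unfolding isometric_action_def using Metric_space_tight_span sup_dist_act by blast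
qed

theorem acylindrical_action_act: "acylindrical_action G tight_span sup_dist act"
  unfolding acylindrical_action_def
proof (intro conjI allI impI isometric_action_act)
  interpret Metric_space tight_span sup_dist by (rule Metric_space_tight_span)
  fix \<epsilon> :: real assume \<epsilon>: "0 < \<epsilon>"
  \<comment> \<open>Replacing \<open>p\<close> and \<open>q\<close> by orbit points within distance
    2 raises \<open>\<epsilon>\<close> to \<open>\<epsilon> + 4\<close> and costs 4 in their
    distance, whence \<open>2 * \<epsilon> + 19 = 2 * (\<epsilon> + 4) + 7 + 4\<close>.\<close>
  let ?N = "(nat \<lfloor>2 * (\<epsilon> + 4) + 6\<rfloor> + 1)\<^sup>2"
  have "finite {g \<in> carrier G. sup_dist p (act g p) \<le> \<epsilon> \<and> sup_dist q (act g q) \<le> \<epsilon>} \<and>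
      card {g \<in> carrier G. sup_dist p (act g p) \<le> \<epsilon> \<and> sup_dist q (act g q) \<le> \<epsilon>} \<le> ?N"
    if p: "p \<in> tight_span" and q: "q \<in> tight_span" and pq: "2 * \<epsilon> + 19 \<le> sup_dist p q" for p q
  proof -
    obtain x where x: "x \<in> carrier G" "sup_dist p (embed x) \<le> 2" using tight_span_near_embed[OF p] .
    obtain y where y: "y \<in> carrier G" "sup_dist q (embed y) \<le> 2" using tight_span_near_embed[OF q] .
    note ex = embed_in_tight_span[OF x(1)] and ey = embed_in_tight_span[OF y(1)]
    have near: "gdist v (g \<otimes> v) \<le> \<epsilon> + 4"
      if "g \<in> carrier G" "v \<in> carrier G" "f \<in> tight_span" "sup_dist f (embed v) \<le> 2"
        "sup_dist f (act g f) \<le> \<epsilon>" for g v f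
    proof -
      have "sup_dist (embed v) (act g (embed v)) \<le>
        sup_dist (embed v) f + sup_dist f (act g f) + sup_dist (act g f) (act g (embed v))"
        using triangle[of "embed v" f "act g (embed v)"] triangle[of f "act g f"
          "act g (embed v)"] that
          act_in_tight_span embed_in_tight_span by fastforce
      then show ?thesis
        using that sup_dist_act[OF that(1,3) embed_in_tight_span[OF that(2)]]
          commute[of f "embed v"]
        by (simp add: act_embed sup_dist_embed_embed)
    qed
    let ?A = "{g \<in> carrier G. gdist x (g \<otimes> x) \<le> \<epsilon> + 4 \<and> gdist y (g \<otimes> y) \<le> \<epsilon> + 4}"
    have sub: "{g \<in> carrier G. sup_dist p (act g p) \<le> \<epsilon> \<and> sup_dist q (act g q) \<le> \<epsilon>} \<subseteq> ?A"
      using near x y p q by blast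
    have "sup_dist p q \<le> sup_dist p (embed x) + sup_dist (embed x) (embed y) + sup_dist q (embed y)"
      using triangle[OF p ex q] triangle[OF ex ey q] commute[of q "embed y"] by linarith
    then have "gdist x y \<ge> 2 * (\<epsilon> + 4) + 7"
      using pq x y by (simp add: sup_dist_embed_embed)
    note A = finite_card_near_pair[OF x(1) y(1) _ this]
    show ?thesis using A \<epsilon> sub
      by (meson add_nonneg_nonneg card_mono finite_subset le_trans less_imp_le zero_le_numeral)
  qed
  then show "\<exists>R>0. \<exists>N::nat. N > 0 \<and> (\<forall>p\<in>tight_span. \<forall>q\<in>tight_span. R \<le> sup_dist p q \<longrightarrow>
      finite {g \<in> carrier G. sup_dist p (act g p) \<le> \<epsilon> \<and> sup_dist q (act g q) \<le> \<epsilon>} \<and>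
      card {g \<in> carrier G. sup_dist p (act g p) \<le> \<epsilon> \<and> sup_dist q (act g q) \<le> \<epsilon>} \<le> N)"
    using \<epsilon> by (intro exI[of _ "2 * \<epsilon> + 19"] exI[of _ ?N] conjI ballI impI) auto
qed

end

text \<open>Used in the contrapositive: unbounded lengths of powers exclude ellipticity. A bounded
  orbit of any \<open>f\<close> is compared with the orbit of the base point at the cost of
  \<open>2 * f \<one>\<close>.\<close>

lemma (in tree_length) elliptic_act_bounded:
  assumes g: "g \<in> carrier G" and ell: "elliptic G tight_span sup_dist act g"
  shows "\<exists>B. \<forall>k :: nat. real (len (g [^] k)) \<le> B"
proof -
  interpret Metric_space tight_span sup_dist by (rule Metric_space_tight_span)
  obtain f where f: "f \<in> tight_span" and "mbounded {act (g [^] n) f | n :: int. True}"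
    using ell by (auto simp: elliptic_def)
  then have "\<exists>B. \<forall>h\<in>{act (g [^] n) f | n :: int. True}. \<forall>k\<in>{act (g [^] n) f | n ::
    int. True}. sup_dist h k \<le> B"
    by (simp only: mbounded_alt)
  then obtain B where B: "sup_dist h k \<le> B"
    if "h \<in> {act (g [^] n) f | n :: int. True}" "k \<in> {act (g [^] n) f | n :: int. True}" for h k
    by meson
  note e1 = embed_in_tight_span[OF one_closed]
  have "real (len (g [^] k)) \<le> 2 * f \<one> + B" for k :: nat
  proof -
    define h where "h = g [^] k"
    have h: "h \<in> carrier G" using g by (simp add: h_def)
    have "sup_dist f (act h f) \<le> B"
    proof (rule B)
      show "f \<in> {act (g [^] n) f | n :: int. True}"
        using act_one[OF f] by (intro CollectI exI[of _ 0]) simp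
      show "act h f \<in> {act (g [^] n) f | n :: int. True}"
        unfolding h_def by (intro CollectI exI[of _ "int k"]) (simp add: int_pow_int)
    qed
    moreover have "sup_dist (embed \<one>) (embed h) \<le>
      sup_dist (embed \<one>) f + sup_dist f (act h f) + sup_dist (act h f) (embed h)"
      using triangle[OF e1 f embed_in_tight_span[OF h]] triangle[OF f act_in_tight_span[OF h f]
        embed_in_tight_span[OF h]]
      by linarith
    moreover have "sup_dist (act h f) (embed h) = f \<one>"
      using sup_dist_act[OF h f e1] h f by (simp add: act_embed sup_dist_embed)
    moreover have "sup_dist (embed \<one>) f = f \<one>" using f
      by (simp add: commute[of "embed \<one>"] sup_dist_embed)
    moreover have "sup_dist (embed \<one>) (embed h) = real (len h)"
      using h by (simp add: sup_dist_embed_embed gdist_def)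
    ultimately show ?thesis by (simp add: h_def)
  qed
  then show ?thesis by blast
qed


section \<open>Free reduction\<close>

lemma inv_letter_inv_letter [simp]: "inv_letter (inv_letter a) = a"
  by (simp add: inv_letter_def)

lemma inv_letter_neq [simp]: "inv_letter a \<noteq> a" "a \<noteq> inv_letter a"
  by (auto simp: inv_letter_def prod_eq_iff)

lemma inv_letter_eq_iff [simp]: "inv_letter a = inv_letter b \<longleftrightarrow> a = b"
  by (metis inv_letter_inv_letter)

lemma inv_letter_in_letters_upto [simp]: "inv_letter a \<in> letters_upto n \<longleftrightarrow> a \<in> letters_upto n"
  by (simp add: inv_letter_def letters_upto_def)

definition freely_reduced :: "letter list \<Rightarrow> bool" where
  "freely_reduced = successively (\<lambda>a b. b \<noteq> inv_letter a)"

definition push :: "letter \<Rightarrow> letter list \<Rightarrow> letter list" where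
  "push a xs = (case xs of [] \<Rightarrow> [a] | b # ys \<Rightarrow> if b = inv_letter a then ys else a # xs)"

definition red :: "letter list \<Rightarrow> letter list" where
  "red xs = foldr push xs []"

definition inv_list :: "letter list \<Rightarrow> letter list" where
  "inv_list xs = rev (map inv_letter xs)"

lemma red_simps [simp]: "red [] = []" "red (a # xs) = push a (red xs)"
  by (simp_all add: red_def)

lemma reduced_Nil [simp]: "freely_reduced []" and reduced_single [simp]: "freely_reduced [a]"
  by (simp_all add: freely_reduced_def)

lemma reduced_Cons_Cons [simp]: "freely_reduced (a # b # xs) \<longleftrightarrow> b \<noteq> inv_letter a \<and>
  freely_reduced (b # xs)"
  by (simp add: freely_reduced_def)

lemma reduced_ConsD: "freely_reduced (a # xs) \<Longrightarrow> freely_reduced xs"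
  by (cases xs) auto

lemma reduced_appendD: "freely_reduced (xs @ ys) \<Longrightarrow> freely_reduced xs"
  "freely_reduced (xs @ ys) \<Longrightarrow> freely_reduced ys"
  by (simp_all add: freely_reduced_def successively_append_iff)

lemma push_reduced: "freely_reduced (a # xs) \<Longrightarrow> push a xs = a # xs"
  by (cases xs) (auto simp: push_def)

lemma reduced_push: "freely_reduced xs \<Longrightarrow> freely_reduced (push a xs)"
  by (cases xs) (auto simp: push_def dest: reduced_ConsD)

lemma reduced_red [simp]: "freely_reduced (red xs)"
  by (induction xs) (auto intro: reduced_push)

lemma red_reduced: "freely_reduced xs \<Longrightarrow> red xs = xs"
proof (induction xs)
  case (Cons a xs)
  then show ?case using push_reduced[OF Cons.prems] reduced_ConsD[OF Cons.prems] by simp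
qed simp

lemma red_red [simp]: "red (red xs) = red xs"
  by (simp add: red_reduced)

text \<open>Van der Waerden's argument: on reduced lists, \<open>push a\<close> and
  \<open>push (inv_letter a)\<close> are inverse permutations. Hence \<open>foldr push\<close>
  respects cancellation, and \<open>red\<close> is a normal form.\<close>

lemma push_push_inv: "freely_reduced xs \<Longrightarrow> push a (push (inv_letter a) xs) = xs"
  by (cases xs) (auto simp: push_def split: list.splits)

lemma reduced_foldr_push: "freely_reduced ys \<Longrightarrow> freely_reduced (foldr push xs ys)"
  by (induction xs) (auto intro: reduced_push)

lemma red_append: "red (xs @ ys) = foldr push xs (red ys)"
  by (simp add: red_def)

lemma push_cases:
  obtains "push a xs = a # xs" | ys where "xs = inv_letter a # ys" "push a xs = ys"
proof (cases xs)
  case (Cons b ys)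
  then show thesis using that by (cases "b = inv_letter a") (simp_all add: push_def)
qed (use that(1) in \<open>simp add: push_def\<close>)

lemma foldr_push_push:
  assumes "freely_reduced zs"
  shows "foldr push (push a ys) zs = push a (foldr push ys zs)"
  by (cases a ys rule: push_cases) (simp_all add: push_push_inv[OF reduced_foldr_push[OF assms]])

lemma foldr_push_red: "freely_reduced zs \<Longrightarrow> foldr push (red xs) zs = foldr push xs zs"
  by (induction xs) (simp_all add: foldr_push_push)

lemma red_append_red [simp]: "red (red xs @ ys) = red (xs @ ys)" "red (xs @ red ys) = red (xs @ ys)"
  by (simp_all add: red_append foldr_push_red)

lemma red_cancel: "red (xs @ a # inv_letter a # ys) = red (xs @ ys)"
  by (simp add: red_append push_push_inv)

lemma inv_list_simps [simp]:
  "inv_list [] = []" "inv_list (a # xs) = inv_list xs @ [inv_letter a]"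
  "inv_list (xs @ ys) = inv_list ys @ inv_list xs" "inv_list (inv_list xs) = xs"
  by (simp_all add: inv_list_def rev_map comp_def)

lemma inv_list_eq_Nil_iff [simp]: "inv_list xs = [] \<longleftrightarrow> xs = []"
  by (simp add: inv_list_def)

lemma reduced_inv_list: "freely_reduced xs \<Longrightarrow> freely_reduced (inv_list xs)"
  unfolding freely_reduced_def inv_list_def successively_rev successively_map
  by (erule successively_mono) auto

lemma red_inv_list_append: "red (inv_list xs @ xs @ ys) = red ys"
proof (induction xs arbitrary: ys)
  case (Cons a xs)
  then show ?case using red_cancel[of "inv_list xs" "inv_letter a" "xs @ ys"] by simp
qed simp

lemma red_append_inv_list: "red (xs @ inv_list xs @ ys) = red ys"
  using red_inv_list_append[of "inv_list xs"] by simp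

lemma red_append_red_append: "red (xs @ red ys @ zs) = red (xs @ ys @ zs)"
  by (metis red_append_red)

lemma red_inv_list: "red (inv_list xs) = inv_list (red xs)"
proof -
  have "red (inv_list xs) = red (inv_list xs @ red xs @ inv_list (red xs))"
    using red_append_inv_list[of "red xs" "[]"] red_append_red(2)[of "inv_list xs"
      "red xs @ inv_list (red xs)"]
    by simp
  also have "\<dots> = red (inv_list (red xs))"
    by (simp only: red_append_red_append red_inv_list_append)
  finally show ?thesis by (simp add: red_reduced reduced_inv_list)
qed

lemma set_red: "set (red xs) \<subseteq> set xs"
proof (induction xs)
  case (Cons a xs)
  have "set (push a (red xs)) \<subseteq> insert a (set (red xs))"
    by (cases a "red xs" rule: push_cases) auto
  with Cons show ?case by auto
qed simp

text \<open>A cancelling pair is kept or deleted as a whole, since \<open>P\<close> does not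
  separate a letter from its inverse. This makes the projections between free groups compatible with
  \<open>red\<close>.\<close>

lemma red_filter:
  assumes P: "\<And>a. P (inv_letter a) = P a"
  shows "red (filter P (red xs)) = red (filter P xs)"
proof (induction xs)
  case (Cons a xs)
  have "red (filter P (push a ys)) = red (filter P (a # ys))" for ys
    by (cases a ys rule: push_cases) (simp_all add: P push_push_inv)
  then show ?case using Cons by simp
qed simp

lemma free_eq_imp_red_eq: "(xs, ys) \<in> free_eq n \<Longrightarrow> red xs = red ys"
  unfolding free_eq_def
proof (induction rule: rtrancl_induct)
  case (step y z)
  then show ?case by (auto simp: cancel_step_def red_cancel)
qed simp

lemma free_eq_Cons:
  assumes "(xs, ys) \<in> free_eq n" "a \<in> letters_upto n"
  shows "(a # xs, a # ys) \<in> free_eq n"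
  using assms(1) unfolding free_eq_def
proof (induction rule: rtrancl_induct)
  case (step y z)
  have Cons: "(a # us, a # vs) \<in> cancel_step n" if "(us, vs) \<in> cancel_step n" for us vs
    using that assms(2) unfolding cancel_step_def by simp (metis Cons_in_lists_iff append_Cons)
  have "(a # y, a # z) \<in> cancel_step n \<union> (cancel_step n)\<inverse>"
    using step(2) Cons by blast
  with step.IH show ?case by (rule rtrancl_into_rtrancl)
qed simp

lemma free_eq_red: "xs \<in> lists (letters_upto n) \<Longrightarrow> (xs, red xs) \<in> free_eq n"
proof (induction xs)
  case (Cons a xs)
  then have IH: "(a # xs, a # red xs) \<in> free_eq n" by (intro free_eq_Cons) auto
  have "red xs \<in> lists (letters_upto n)" using Cons.prems set_red[of xs] by auto
  then have "(a # red xs, push a (red xs)) \<in> free_eq n"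
  proof (cases a "red xs" rule: push_cases)
    case (2 ys)
    have "([] @ [a, inv_letter a] @ ys, [] @ ys) \<in> cancel_step n"
      unfolding cancel_step_def using \<open>red xs \<in> _\<close> 2(1) Cons.prems
      by (intro CollectI exI[of _ "[]"] exI[of _ a] exI[of _ ys]) simp
    then have "(a # red xs, push a (red xs)) \<in> cancel_step n" using 2 by simp
    then show ?thesis unfolding free_eq_def by (intro r_into_rtrancl) blast
  qed (simp add: free_eq_def)
  with IH show ?case unfolding free_eq_def red_simps by (rule rtrancl_trans)
qed (simp add: free_eq_def)

lemma free_eq_sym: "(xs, ys) \<in> free_eq n \<Longrightarrow> (ys, xs) \<in> free_eq n"
  unfolding free_eq_def by (metis converse_Un converse_converse rtrancl_converseI sup_commute)

text \<open>The right-hand side is independent of \<open>n\<close>, so all free groups are treated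
  through the single function \<open>red\<close>.\<close>

lemma free_eq_iff:
  assumes "xs \<in> lists (letters_upto n)" "ys \<in> lists (letters_upto n)"
  shows "(xs, ys) \<in> free_eq n \<longleftrightarrow> red xs = red ys"
proof
  assume "red xs = red ys"
  then show "(xs, ys) \<in> free_eq n"
    using free_eq_red[OF assms(1)] free_eq_sym[OF free_eq_red[OF assms(2)]]
    unfolding free_eq_def by (metis rtrancl_trans)
qed (rule free_eq_imp_red_eq)

section \<open>Counting letters in reduced words\<close>

definition num_upto :: "nat \<Rightarrow> letter list \<Rightarrow> nat" where
  "num_upto n xs = length (filter (\<lambda>a. a \<in> letters_upto n) xs)"

lemma num_upto_simps [simp]:
  "num_upto n [] = 0" "num_upto n (a # xs) = (if a \<in> letters_upto n then 1 else 0) + num_upto n xs"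
  "num_upto n (xs @ ys) = num_upto n xs + num_upto n ys"
  by (simp_all add: num_upto_def)

lemma num_upto_inv_list [simp]: "num_upto n (inv_list xs) = num_upto n xs"
  by (induction xs) auto

lemma num_upto_red_le: "num_upto n (red xs) \<le> num_upto n xs"
proof (induction xs)
  case (Cons a xs)
  have "num_upto n (push a (red xs)) \<le> num_upto n (a # red xs)"
    by (cases a "red xs" rule: push_cases) simp_all
  with Cons show ?case by simp
qed simp

lemma num_upto_eq_0_iff: "num_upto n xs = 0 \<longleftrightarrow> (\<forall>a\<in>set xs. a \<notin> letters_upto n)"
  by (simp add: num_upto_def filter_empty_conv)

abbreviation lcp :: "letter list \<Rightarrow> letter list \<Rightarrow> letter list" where
  "lcp \<equiv> longest_common_prefix"

lemma reduced_append_iff: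
  "freely_reduced (xs @ ys) \<longleftrightarrow> freely_reduced xs \<and> freely_reduced ys \<and> (xs \<noteq> [] \<longrightarrow> ys \<noteq> [] \<longrightarrow>
    hd ys \<noteq> inv_letter (last xs))"
  by (auto simp: freely_reduced_def successively_append_iff)

lemma lcp_decomp:
  "\<exists>us vs. xs = lcp xs ys @ us \<and> ys = lcp xs ys @ vs \<and> (us = [] \<or> vs = [] \<or> hd us \<noteq> hd vs)"
  by (induction xs ys rule: longest_common_prefix.induct) auto

lemma lcp_commute: "lcp xs ys = lcp ys xs"
  by (induction xs ys rule: longest_common_prefix.induct) auto

lemma red_inv_list_append_lcp:
  assumes "freely_reduced xs" "freely_reduced ys"
  obtains us vs where "xs = lcp xs ys @ us" "ys = lcp xs ys @ vs"
    "red (inv_list xs @ ys) = inv_list us @ vs"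
proof -
  define p where "p = lcp xs ys"
  obtain us vs where us: "xs = p @ us" and vs: "ys = p @ vs"
    and hd: "us = [] \<or> vs = [] \<or> hd us \<noteq> hd vs"
    unfolding p_def using lcp_decomp by blast
  have red_us: "freely_reduced us" and red_vs: "freely_reduced vs"
    using reduced_appendD(2) assms unfolding us vs by blast+
  have "last (inv_list us) = inv_letter (hd us)" if "us \<noteq> []"
    using that by (cases us) simp_all
  then have "freely_reduced (inv_list us @ vs)"
    using hd red_us red_vs by (auto simp: reduced_append_iff reduced_inv_list)
  moreover have "red (inv_list xs @ ys) = red (inv_list us @ vs)"
    using red_inv_list_append[of p vs] red_append_red(2)[of "inv_list us" "inv_list p @ p @ vs"]
    unfolding us vs by simp
  ultimately show thesis using us vs that unfolding p_def by (simp add: red_reduced)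
qed

text \<open>Exactly the common prefix cancels. Hence for the letter count as distance, the Gromov
  product of \<open>xs\<close> and \<open>ys\<close> is the count in their longest common
  prefix.\<close>

lemma num_upto_red_inv_list_append:
  assumes "freely_reduced xs" "freely_reduced ys"
  shows "num_upto n (red (inv_list xs @ ys)) + 2 * num_upto n (lcp xs ys) =
    num_upto n xs + num_upto n ys"
proof -
  obtain us vs where *: "xs = lcp xs ys @ us" "ys = lcp xs ys @ vs"
    "red (inv_list xs @ ys) = inv_list us @ vs"
    using red_inv_list_append_lcp[OF assms] .
  have "num_upto n xs = num_upto n (lcp xs ys) + num_upto n us"
    by (subst *(1)) (rule num_upto_simps)
  moreover have "num_upto n ys = num_upto n (lcp xs ys) + num_upto n vs"
    by (subst *(2)) (rule num_upto_simps)
  ultimately show ?thesis using *(3) by simp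
qed

lemma num_upto_prefix_mono: "prefix xs ys \<Longrightarrow> num_upto n xs \<le> num_upto n ys"
  by (auto simp: prefix_def)

text \<open>Two prefixes of \<open>ys\<close> are comparable, and the shorter one is a common prefix
  of \<open>xs\<close> and \<open>zs\<close>. In terms of Gromov products this is
  0-hyperbolicity.\<close>

lemma num_upto_lcp_ultrametric:
  "num_upto n (lcp xs zs) \<ge> min (num_upto n (lcp xs ys)) (num_upto n (lcp ys zs))"
proof -
  note p1 = longest_common_prefix_prefix1 and p2 = longest_common_prefix_prefix2
  have "prefix (lcp xs ys) (lcp ys zs) \<or> prefix (lcp ys zs) (lcp xs ys)"
    by (rule prefix_same_cases[OF p2[of xs ys] p1[of ys zs]])
  then have "prefix (lcp xs ys) (lcp xs zs) \<or> prefix (lcp ys zs) (lcp xs zs)"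
  proof
    assume "prefix (lcp xs ys) (lcp ys zs)"
    then show ?thesis
      using longest_common_prefix_max_prefix[OF p1 prefix_order.trans[OF _ p2]] by blast
  next
    assume "prefix (lcp ys zs) (lcp xs ys)"
    then show ?thesis
      using longest_common_prefix_max_prefix[OF prefix_order.trans[OF _ p1] p2] by blast
  qed
  then show ?thesis by (auto dest!: num_upto_prefix_mono[of _ _ n] simp: min_le_iff_disj)
qed

lemma num_upto_four_point:
  assumes "freely_reduced xs" "freely_reduced ys" "freely_reduced zs"
  shows "num_upto n zs + num_upto n (red (inv_list xs @ ys)) \<le>
    max (num_upto n xs + num_upto n (red (inv_list zs @ ys)))
      (num_upto n ys + num_upto n (red (inv_list zs @ xs)))"
proof -
  have "num_upto n (lcp xs zs) \<le> num_upto n (lcp xs ys) \<or> num_upto n (lcp zs ys) \<le>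
    num_upto n (lcp xs ys)"
    using num_upto_lcp_ultrametric[of n xs zs ys] by (simp only: min_le_iff_disj)
  then show ?thesis
    using num_upto_red_inv_list_append[OF assms(1,2), of n]
      num_upto_red_inv_list_append[OF assms(3,2), of n]
      num_upto_red_inv_list_append[OF assms(3,1), of n] lcp_commute[of xs zs]
    by (elim disjE) (simp_all only: le_max_iff_disj, linarith+)
qed

lemma num_upto_eq_length: "set xs \<subseteq> letters_upto n \<Longrightarrow> num_upto n xs = length xs"
  by (induction xs) auto

text \<open>What cancels between the two factors is the common prefix of \<open>xs\<close> and its
  inverse. If it reached the middle of \<open>xs\<close>, the middle letter would be its own inverse
  for odd length, and the two middle letters would cancel for even length.\<close>

lemma length_red_square:
  assumes red: "freely_reduced xs" and ne: "xs \<noteq> []"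
  shows "length (red (xs @ xs)) > length xs"
proof -
  define ys where "ys = lcp (inv_list xs) xs"
  \<comment> \<open>With all letters below \<open>n\<close>, \<open>num_upto n\<close> is the
    length, and the counting identity for common prefixes applies.\<close>
  obtain n where n: "fst a < n" if "a \<in> set xs" for a
    using finite_nat_set_iff_bounded[of "fst ` set xs"] by auto
  have upto: "set zs \<subseteq> letters_upto n" if "set zs \<subseteq> set xs" for zs
    using that n by (auto simp: letters_upto_def)
  have pre: "prefix ys (inv_list xs)" "prefix ys xs"
    unfolding ys_def by (rule longest_common_prefix_prefix1 longest_common_prefix_prefix2)+
  have "num_upto n (red (inv_list (inv_list xs) @ xs)) + 2 * num_upto n ys =
    num_upto n (inv_list xs) + num_upto n xs"
    unfolding ys_def by (intro num_upto_red_inv_list_append red reduced_inv_list)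
  then have "length (red (xs @ xs)) + 2 * length ys = 2 * length xs"
    using upto[of "red (xs @ xs)"] upto[of ys] upto[of xs] set_red[of "xs @ xs"]
      set_mono_prefix[OF pre(2)]
    by (simp add: num_upto_eq_length)
  moreover have "2 * length ys < length xs"
  proof (rule ccontr)
    assume long: "\<not> ?thesis"
    have sym: "inv_letter (xs ! (length xs - Suc i)) = xs ! i" if "i < length ys" for i
    proof -
      have "inv_list xs ! i = xs ! i"
        using pre that by (auto simp: prefix_def nth_append)
      moreover have "i < length xs" using that prefix_length_le[OF pre(2)] by simp
      ultimately show ?thesis by (simp add: inv_list_def rev_nth)
    qed
    define h where "h = length xs div 2"
    show False
    proof (cases "even (length xs)")
      case True
      then have "length xs = 2 * h" by (simp add: h_def)
      moreover have "length xs > 0" using ne by simp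
      ultimately have h: "length xs = 2 * h" "h > 0" by simp_all
      then have "inv_letter (xs ! h) = xs ! (h - 1)"
        using sym[of "h - 1"] long by (simp add: mult_2)
      moreover have "xs ! Suc (h - 1) \<noteq> inv_letter (xs ! (h - 1))"
        using successively_nth[OF red[unfolded freely_reduced_def], of "h - 1"] h by simp
      ultimately show False using h by (metis Suc_pred' inv_letter_inv_letter)
    next
      case False
      then have "length xs = 2 * h + 1" by (simp add: h_def)
      then have "inv_letter (xs ! h) = xs ! h" using sym[of h] long by (simp add: mult_2)
      then show False by simp
    qed
  qed
  ultimately show ?thesis by linarith
qed


section \<open>Words and their projections\<close>

lemma sorted_wrt_unique:
  assumes "sorted_wrt P xs" "sorted_wrt P ys" "distinct xs" "distinct ys" "set xs = set ys"
    and "\<And>x y. P x y \<Longrightarrow> P y x \<Longrightarrow> x = y"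
  shows "xs = ys"
  using assms(1-5)
proof (induction xs arbitrary: ys)
  case (Cons x xs)
  then obtain y ys' where ys: "ys = y # ys'" by (cases ys) auto
  have "x \<in> insert y (set ys')" "y \<in> insert x (set xs)" using Cons.prems(5) unfolding ys by auto
  then have "x = y" using Cons.prems assms(6)[of x y] unfolding ys by auto
  have "x \<notin> set xs" "x \<notin> set ys'" "insert x (set xs) = insert x (set ys')"
    using Cons.prems(3-5) unfolding ys \<open>x = y\<close> by auto
  then have "set xs = set ys'" using insert_ident[of x "set xs" "set ys'"] by blast
  moreover have "sorted_wrt P ys'" "distinct ys'" "sorted_wrt P xs" "distinct xs"
    using Cons.prems(1-4) unfolding ys by auto
  ultimately have "xs = ys'" by (intro Cons.IH)
  then show ?case using \<open>x = y\<close> ys by simp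
qed simp

definition upto_positions :: "nat \<Rightarrow> word \<Rightarrow> nat set" where
  "upto_positions n w = {i \<in> positions w. label w i \<in> letters_upto n}"

lemma finite_letters_upto: "finite (letters_upto n)"
proof -
  have "letters_upto n = {..<n} \<times> UNIV" by (auto simp: letters_upto_def)
  then show ?thesis by simp
qed

lemma finite_upto_positions:
  assumes "is_word w"
  shows "finite (upto_positions n w)"
proof -
  have "upto_positions n w = (\<Union>a\<in>letters_upto n. {i \<in> positions w. label w i = a})"
    by (auto simp: upto_positions_def)
  moreover have "finite {i \<in> positions w. label w i = a}" for a using assms unfolding is_word_def
    by blast
  ultimately show ?thesis using finite_letters_upto by simp
qed

lemma is_word_ordD:
  assumes "is_word w"
  shows "(i, j) \<in> ord w \<Longrightarrow> i \<in> positions w \<and> j \<in> positions w"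
    "i \<in> positions w \<Longrightarrow> (i, i) \<in> ord w"
    "\<lbrakk>(i, j) \<in> ord w; (j, i) \<in> ord w\<rbrakk> \<Longrightarrow> i = j"
    "\<lbrakk>(i, j) \<in> ord w; (j, k) \<in> ord w\<rbrakk> \<Longrightarrow> (i, k) \<in> ord w"
    "\<lbrakk>i \<in> positions w; j \<in> positions w\<rbrakk> \<Longrightarrow> (i, j) \<in> ord w \<or> (j, i) \<in> ord w"
proof -
  have sub: "ord w \<subseteq> positions w \<times> positions w" and refl: "refl_on (positions w) (ord w)"
    and trans: "trans (ord w)" and antisym: "antisym (ord w)"
      and total: "total_on (positions w) (ord w)"
    using assms unfolding is_word_def linear_order_on_def partial_order_on_def preorder_on_def
      by blast+
  show "(i, j) \<in> ord w \<Longrightarrow> i \<in> positions w \<and> j \<in> positions w" using sub by blast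
  show refl': "i \<in> positions w \<Longrightarrow> (i, i) \<in> ord w" for i using refl by (rule refl_onD)
  show "\<lbrakk>(i, j) \<in> ord w; (j, i) \<in> ord w\<rbrakk> \<Longrightarrow> i = j" using antisym by (rule antisymD)
  show "\<lbrakk>(i, j) \<in> ord w; (j, k) \<in> ord w\<rbrakk> \<Longrightarrow> (i, k) \<in> ord w" using trans by (rule transD)
  show "\<lbrakk>i \<in> positions w; j \<in> positions w\<rbrakk> \<Longrightarrow> (i, j) \<in> ord w \<or> (j, i) \<in> ord w"
    using total refl' unfolding total_on_def by metis
qed

lemma is_wordI:
  assumes "\<And>i j. (i, j) \<in> ord w \<Longrightarrow> i \<in> positions w \<and> j \<in> positions w"
    "\<And>i. i \<in> positions w \<Longrightarrow> (i, i) \<in> ord w"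
    "\<And>i j. \<lbrakk>(i, j) \<in> ord w; (j, i) \<in> ord w\<rbrakk> \<Longrightarrow> i = j"
    "\<And>i j k. \<lbrakk>(i, j) \<in> ord w; (j, k) \<in> ord w\<rbrakk> \<Longrightarrow> (i, k) \<in> ord w"
    "\<And>i j. \<lbrakk>i \<in> positions w; j \<in> positions w\<rbrakk> \<Longrightarrow> (i, j) \<in> ord w \<or> (j, i) \<in> ord w"
    "\<And>a. finite {i \<in> positions w. label w i = a}"
  shows "is_word w"
proof -
  have "ord w \<subseteq> positions w \<times> positions w" using assms(1) by auto
  moreover have "refl_on (positions w) (ord w)" using assms(2) by (rule refl_onI)
  moreover have "trans (ord w)" using assms(4) by (rule transI)
  moreover have "antisym (ord w)" using assms(3) by (rule antisymI)
  moreover have "total_on (positions w) (ord w)" using assms(5) by (simp add: total_on_def)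
  ultimately show ?thesis
    using assms(6) unfolding is_word_def linear_order_on_def partial_order_on_def preorder_on_def
      by blast
qed

lemma exists_sorted_list:
  assumes w: "is_word w" and "finite A" "A \<subseteq> positions w"
  shows "\<exists>is. distinct is \<and> set is = A \<and> sorted_wrt (\<lambda>i j. (i, j) \<in> ord w) is"
  using assms(2,3)
proof (induction "card A" arbitrary: A)
  case 0
  then show ?case by (intro exI[of _ "[]"]) simp
next
  case (Suc n)
  have "\<exists>m\<in>A. \<forall>i\<in>A. (m, i) \<in> ord w" if "finite A" "A \<noteq> {}" "A \<subseteq> positions w" for A
    using that
  proof (induction rule: finite_ne_induct)
    case (insert x F)
    then obtain m where m: "m \<in> F" "\<forall>i\<in>F. (m, i) \<in> ord w" by auto
    have "(m, x) \<in> ord w \<or> (x, m) \<in> ord w" using is_word_ordD(5)[OF w, of m x] m insert by auto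
    then show ?case
    proof
      assume "(m, x) \<in> ord w"
      then show ?thesis using m by (intro bexI[of _ m]) auto
    next
      assume "(x, m) \<in> ord w"
      then have "(x, i) \<in> ord w" if "i \<in> F" for i using is_word_ordD(4)[OF w] m that by blast
      then show ?thesis using is_word_ordD(2)[OF w, of x] insert by (intro bexI[of _ x]) auto
    qed
  qed (use is_word_ordD(2)[OF w] in auto)
  from this[of A] obtain m where m: "m \<in> A" "\<forall>i\<in>A. (m, i) \<in> ord w"
    using Suc by fastforce
  obtain is' where "distinct is'" "set is' = A - {m}" "sorted_wrt (\<lambda>i j. (i, j) \<in> ord w) is'"
    using Suc(1)[of "A - {m}"] Suc(2-) m card_Diff_singleton[of m A] by fastforce
  then show ?case using m by (intro exI[of _ "m # is'"]) auto
qed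

lemma word_projI:
  assumes w: "is_word w" and "distinct is" "set is = upto_positions n w"
    "sorted_wrt (\<lambda>i j. (i, j) \<in> ord w) is"
  shows "word_proj n w = map (label w) is"
proof -
  have "(THE is. distinct is \<and> set is = upto_positions n w \<and> sorted_wrt (\<lambda>i j. (i, j) \<in> ord w) is) =
    is"
    using assms by (intro the_equality) (auto intro: sorted_wrt_unique is_word_ordD(3)[OF w])
  then show ?thesis by (simp add: word_proj_def upto_positions_def)
qed

lemma word_projE:
  assumes "is_word w"
  obtains "is" where "distinct is" "set is = upto_positions n w"
    "sorted_wrt (\<lambda>i j. (i, j) \<in> ord w) is" "word_proj n w = map (label w) is"
  using exists_sorted_list[OF assms finite_upto_positions[OF assms], of n] word_projI[OF assms]
  by (force simp: upto_positions_def)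

lemma set_word_proj: "is_word w \<Longrightarrow> set (word_proj n w) \<subseteq> letters_upto n"
  by (rule word_projE[of w n]) (auto simp: upto_positions_def)

lemma word_proj_filter:
  assumes w: "is_word w" and "m \<le> n"
  shows "word_proj m w = filter (\<lambda>a. a \<in> letters_upto m) (word_proj n w)"
proof -
  obtain "is" where "is": "distinct is" "set is = upto_positions n w"
    "sorted_wrt (\<lambda>i j. (i, j) \<in> ord w) is" "word_proj n w = map (label w) is"
    using word_projE[OF w] .
  let ?js = "filter (\<lambda>i. label w i \<in> letters_upto m) is"
  have "letters_upto m \<subseteq> letters_upto n" using assms(2) by (auto simp: letters_upto_def)
  then have "set ?js = upto_positions m w" using "is"(2) by (auto simp: upto_positions_def)
  moreover have "distinct ?js" using "is"(1) by simp
  moreover have "sorted_wrt (\<lambda>i j. (i, j) \<in> ord w) ?js" using "is"(3) by (rule sorted_wrt_filter)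
  ultimately have "word_proj m w = map (label w) ?js" by (intro word_projI w)
  then show ?thesis using "is" by (simp add: filter_map comp_def)
qed

lemma sum_encode_eq_iff [simp]: "sum_encode x = sum_encode y \<longleftrightarrow> x = y"
  by (rule inj_eq[OF inj_sum_encode])

lemma word_append_simps:
  "sum_encode (Inl i) \<in> positions (word_append u v) \<longleftrightarrow> i \<in> positions u"
  "sum_encode (Inr i) \<in> positions (word_append u v) \<longleftrightarrow> i \<in> positions v"
  "(sum_encode (Inl i), sum_encode (Inl j)) \<in> ord (word_append u v) \<longleftrightarrow> (i, j) \<in> ord u"
  "(sum_encode (Inr i), sum_encode (Inr j)) \<in> ord (word_append u v) \<longleftrightarrow> (i, j) \<in> ord v"
  "(sum_encode (Inl i), sum_encode (Inr j)) \<in> ord (word_append u v) \<longleftrightarrow> i \<in> positions u \<and>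
    j \<in> positions v"
  "(sum_encode (Inr i), sum_encode (Inl j)) \<notin> ord (word_append u v)"
  "label (word_append u v) (sum_encode (Inl i)) = label u i"
  "label (word_append u v) (sum_encode (Inr i)) = label v i"
  by (auto simp: word_append_def)

lemma sum_encode_cases:
  obtains i where "k = sum_encode (Inl i)" | i where "k = sum_encode (Inr i)"
  by (metis sum_decode_inverse sumE)

lemma is_word_append:
  assumes u: "is_word u" and v: "is_word v"
  shows "is_word (word_append u v)"
proof (rule is_wordI)
  note [simp] = word_append_simps
  note uD = is_word_ordD[OF u] and vD = is_word_ordD[OF v]
  show "i \<in> positions (word_append u v) \<and> j \<in> positions (word_append u v)"
    if "(i, j) \<in> ord (word_append u v)" for i j
    using that uD(1) vD(1) by (cases i rule: sum_encode_cases; cases j rule: sum_encode_cases) auto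
  show "(i, i) \<in> ord (word_append u v)" if "i \<in> positions (word_append u v)" for i
    using that uD(2) vD(2) by (cases i rule: sum_encode_cases) auto
  show "i = j" if "(i, j) \<in> ord (word_append u v)" "(j, i) \<in> ord (word_append u v)" for i j
    using that uD(3) vD(3) by (cases i rule: sum_encode_cases; cases j rule: sum_encode_cases) auto
  show "(i, k) \<in> ord (word_append u v)"
    if "(i, j) \<in> ord (word_append u v)" "(j, k) \<in> ord (word_append u v)" for i j k
    using that
    by (cases i rule: sum_encode_cases; cases j rule: sum_encode_cases; cases k rule:
      sum_encode_cases)
      (simp_all, (metis uD(1,4) vD(1,4))+)
  show "(i, j) \<in> ord (word_append u v) \<or> (j, i) \<in> ord (word_append u v)"
    if "i \<in> positions (word_append u v)" "j \<in> positions (word_append u v)" for i j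
    using that uD(5) vD(5)
      by (cases i rule: sum_encode_cases; cases j rule: sum_encode_cases) simp_all
  fix a
  have "{i \<in> positions (word_append u v). label (word_append u v) i = a} \<subseteq>
      (\<lambda>i. sum_encode (Inl i)) ` {i \<in> positions u. label u i = a} \<union>
      (\<lambda>i. sum_encode (Inr i)) ` {i \<in> positions v. label v i = a}"
  proof
    fix k assume "k \<in> {i \<in> positions (word_append u v). label (word_append u v) i = a}"
    then show "k \<in> (\<lambda>i. sum_encode (Inl i)) ` {i \<in> positions u. label u i = a} \<union>
      (\<lambda>i. sum_encode (Inr i)) ` {i \<in> positions v. label v i = a}"
      by (cases k rule: sum_encode_cases) auto
  qed
  moreover have "finite {i \<in> positions u. label u i = a}" "finite {i \<in> positions v. label v i = a}"
    using u v unfolding is_word_def by blast+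
  ultimately show "finite {i \<in> positions (word_append u v). label (word_append u v) i = a}"
    using finite_subset by blast
qed

lemma word_proj_append:
  assumes u: "is_word u" and v: "is_word v"
  shows "word_proj n (word_append u v) = word_proj n u @ word_proj n v"
proof -
  obtain "is" where "is": "distinct is" "set is = upto_positions n u"
    "sorted_wrt (\<lambda>i j. (i, j) \<in> ord u) is" "word_proj n u = map (label u) is"
    using word_projE[OF u] .
  obtain js where js: "distinct js" "set js = upto_positions n v"
    "sorted_wrt (\<lambda>i j. (i, j) \<in> ord v) js" "word_proj n v = map (label v) js"
    using word_projE[OF v] .
  let ?ks = "map (\<lambda>i. sum_encode (Inl i)) is @ map (\<lambda>i. sum_encode (Inr i)) js"
  have "distinct ?ks" using "is" js by (auto simp: distinct_map inj_on_def)
  moreover have "set ?ks = upto_positions n (word_append u v)"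
  proof (rule Set.set_eqI)
    show "k \<in> set ?ks \<longleftrightarrow> k \<in> upto_positions n (word_append u v)" for k
      using "is"(2) js(2)
      by (cases k rule: sum_encode_cases) (auto simp: upto_positions_def word_append_simps)
  qed
  moreover have "sorted_wrt (\<lambda>i j. (i, j) \<in> ord (word_append u v)) ?ks"
    using "is"(2,3) js(2,3)
    by (auto simp: sorted_wrt_append sorted_wrt_map word_append_simps upto_positions_def)
  ultimately have "word_proj n (word_append u v) = map (label (word_append u v)) ?ks"
    by (intro word_projI is_word_append u v)
  then show ?thesis using "is"(4) js(4) by (simp add: word_append_simps comp_def)
qed

definition word_inv :: "word \<Rightarrow> word" where
  "word_inv w = Word (positions w) ((ord w)\<inverse>) (\<lambda>i. inv_letter (label w i))"

lemma is_word_inv: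
  assumes w: "is_word w"
  shows "is_word (word_inv w)"
proof -
  have "finite {i \<in> positions w. inv_letter (label w i) = a}" for a
  proof -
    have "{i \<in> positions w. inv_letter (label w i) = a} = {i \<in> positions w. label w i =
      inv_letter a}" by auto
    then show ?thesis using w unfolding is_word_def by metis
  qed
  moreover have "linear_order_on (positions w) ((ord w)\<inverse>)" using w unfolding is_word_def by simp
  ultimately show ?thesis by (simp add: is_word_def word_inv_def)
qed

lemma word_proj_inv:
  assumes w: "is_word w"
  shows "word_proj n (word_inv w) = inv_list (word_proj n w)"
proof -
  obtain "is" where "is": "distinct is" "set is = upto_positions n w"
    "sorted_wrt (\<lambda>i j. (i, j) \<in> ord w) is" "word_proj n w = map (label w) is"
    using word_projE[OF w] .
  have "word_proj n (word_inv w) = map (label (word_inv w)) (rev is)"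
    by (rule word_projI[OF is_word_inv[OF w]])
      (use "is" in \<open>simp_all add: word_inv_def upto_positions_def sorted_wrt_rev\<close>)
  then show ?thesis using "is"(4) by (simp add: word_inv_def inv_list_def rev_map)
qed

definition word_restrict :: "word \<Rightarrow> nat set \<Rightarrow> word" where
  "word_restrict w D = Word (positions w \<inter> D) (ord w \<inter> D \<times> D) (label w)"

lemma is_word_restrict:
  assumes w: "is_word w"
  shows "is_word (word_restrict w D)"
proof -
  note wD = is_word_ordD[OF w]
  have "finite {i \<in> positions w \<inter> D. label w i = a}" for a
  proof (rule finite_subset)
    show "finite {i \<in> positions w. label w i = a}" using w unfolding is_word_def by blast
  qed auto
  then show ?thesis
    unfolding word_restrict_def
    by (intro is_wordI; simp) (blast dest: wD(1) wD(3) intro: wD(2), blast intro: wD(2), blast dest: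
      wD(3),
      metis wD(4), blast dest: wD(5))
qed

text \<open>An infinite word is taken apart at a cut of its order; both parts may again be
  infinite.\<close>

lemma word_proj_split:
  assumes w: "is_word w" and D: "\<And>i j. \<lbrakk>i \<in> positions w \<inter> D; j \<in> positions w - D\<rbrakk> \<Longrightarrow> (i, j) \<in> ord w"
  shows "word_proj n w = word_proj n (word_restrict w D) @ word_proj n (word_restrict w (- D))"
proof -
  obtain "is" where "is": "distinct is" "set is = upto_positions n (word_restrict w D)"
    "sorted_wrt (\<lambda>i j. (i, j) \<in> ord (word_restrict w D)) is"
    "word_proj n (word_restrict w D) = map (label (word_restrict w D)) is"
    using word_projE[OF is_word_restrict[OF w]] .
  obtain js where js: "distinct js" "set js = upto_positions n (word_restrict w (- D))"
    "sorted_wrt (\<lambda>i j. (i, j) \<in> ord (word_restrict w (- D))) js"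
    "word_proj n (word_restrict w (- D)) = map (label (word_restrict w (- D))) js"
    using word_projE[OF is_word_restrict[OF w]] .
  have sub: "set is \<subseteq> positions w \<inter> D" "set js \<subseteq> positions w - D"
    using "is"(2) js(2) by (auto simp: upto_positions_def word_restrict_def)
  have "word_proj n w = map (label w) (is @ js)"
  proof (rule word_projI[OF w])
    show "distinct (is @ js)" using "is"(1) js(1) sub by auto
    show "set (is @ js) = upto_positions n w"
      using "is"(2) js(2) by (auto simp: upto_positions_def word_restrict_def)
    have "sorted_wrt (\<lambda>i j. (i, j) \<in> ord w) is" "sorted_wrt (\<lambda>i j. (i, j) \<in> ord w) js"
      using "is"(3) js(3) by (auto simp: word_restrict_def elim!: sorted_wrt_mono_rel[rotated])
    then show "sorted_wrt (\<lambda>i j. (i, j) \<in> ord w) (is @ js)"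
      using D sub by (simp add: sorted_wrt_append subset_iff)
  qed
  then show ?thesis using "is"(4) js(4) by (simp add: word_restrict_def)
qed

definition finite_word :: "letter list \<Rightarrow> word" where
  "finite_word xs = Word {..<length xs} {(i, j). i \<le> j \<and> j < length xs} (\<lambda>i. xs ! i)"

lemma is_word_finite_word: "is_word (finite_word xs)"
  by (rule is_wordI) (auto simp: finite_word_def)

lemma word_proj_finite_word:
  "word_proj n (finite_word xs) = filter (\<lambda>a. a \<in> letters_upto n) xs"
proof -
  let ?is = "filter (\<lambda>i. xs ! i \<in> letters_upto n) [0..<length xs]"
  have "word_proj n (finite_word xs) = map (label (finite_word xs)) ?is"
  proof (rule word_projI[OF is_word_finite_word])
    have "sorted_wrt (\<lambda>i j. i \<le> j \<and> j < length xs) [0..<length xs]"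
      by (auto simp: sorted_wrt_iff_nth_less)
    then show "sorted_wrt (\<lambda>i j. (i, j) \<in> ord (finite_word xs)) ?is"
      by (simp add: finite_word_def sorted_wrt_filter)
  qed (auto simp: finite_word_def upto_positions_def)
  also have "\<dots> = filter (\<lambda>a. a \<in> letters_upto n) (map ((!) xs) [0..<length xs])"
    by (simp add: finite_word_def filter_map comp_def)
  finally show ?thesis by (simp only: map_nth)
qed

lemma is_word_empty: "is_word empty_word"
  by (rule is_wordI) (auto simp: empty_word_def)

lemma word_proj_empty: "word_proj n empty_word = []"
  by (subst word_projI[OF is_word_empty, of "[]"]) (auto simp: upto_positions_def empty_word_def)


section \<open>The Hawaiian earring group as a group\<close>

lemma red_append_cong: "\<lbrakk>red xs = red us; red ys = red vs\<rbrakk> \<Longrightarrow> red (xs @ ys) = red (us @ vs)"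
  by (metis red_append_red)

lemma word_rel_iff:
  "(u, v) \<in> word_rel \<longleftrightarrow> is_word u \<and> is_word v \<and> (\<forall>n. red (word_proj n u) = red (word_proj n v))"
proof -
  have "(word_proj n u, word_proj n v) \<in> free_eq n \<longleftrightarrow> red (word_proj n u) = red (word_proj n v)"
    if "is_word u" "is_word v" for n
    using set_word_proj[OF that(1), of n] set_word_proj[OF that(2), of n]
      by (intro free_eq_iff) auto
  then show ?thesis by (auto simp: word_rel_def)
qed

lemma equiv_word_rel: "equiv {w. is_word w} word_rel"
proof (rule equivI)
  show "word_rel \<subseteq> {w. is_word w} \<times> {w. is_word w}" by (auto simp: word_rel_iff)
  show "refl_on {w. is_word w} word_rel" by (auto simp: refl_on_def word_rel_iff)
  show "sym word_rel" by (auto simp: sym_def word_rel_iff)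
  show "trans word_rel" by (auto simp: trans_def word_rel_iff)
qed

definition heg :: "word \<Rightarrow> word set" where
  "heg w = word_rel `` {w}"

lemma heg_eq_iff:
  "\<lbrakk>is_word u; is_word v\<rbrakk> \<Longrightarrow> heg u = heg v \<longleftrightarrow> (\<forall>n. red (word_proj n u) = red (word_proj n v))"
  unfolding heg_def using eq_equiv_class_iff[OF equiv_word_rel, of u v] by (simp add: word_rel_iff)

lemma heg_in_carrier [simp]: "is_word w \<Longrightarrow> heg w \<in> carrier HEG"
  by (simp add: HEG_def heg_def quotientI)

lemma carrier_HEG_cases:
  assumes "x \<in> carrier HEG"
  obtains w where "is_word w" "x = heg w"
  using assms by (auto simp: HEG_def heg_def elim!: quotientE)

lemma one_HEG: "\<one>\<^bsub>HEG\<^esub> = heg empty_word"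
  by (simp add: HEG_def heg_def)

lemma mult_heg:
  assumes u: "is_word u" and v: "is_word v"
  shows "heg u \<otimes>\<^bsub>HEG\<^esub> heg v = heg (word_append u v)"
proof -
  have "heg (word_append u' v') = heg (word_append u v)" if "u' \<in> heg u" "v' \<in> heg v" for u' v'
  proof -
    have u': "is_word u'" "\<And>n. red (word_proj n u) = red (word_proj n u')"
      and v': "is_word v'" "\<And>n. red (word_proj n v) = red (word_proj n v')"
      using that by (auto simp: heg_def word_rel_iff)
    have "red (word_proj n u' @ word_proj n v') = red (word_proj n u @ word_proj n v)" for n
      by (rule red_append_cong[OF u'(2)[symmetric] v'(2)[symmetric]])
    then show ?thesis
      using u v u' v' by (simp add: heg_eq_iff is_word_append word_proj_append)
  qed
  moreover have "u \<in> heg u" "v \<in> heg v" using u v by (simp_all add: heg_def word_rel_iff)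
  ultimately have "(\<Union>u'\<in>heg u. \<Union>v'\<in>heg v. heg (word_append u' v')) = heg (word_append u v)"
    by blast
  then show ?thesis by (simp add: HEG_def heg_def)
qed

text \<open>The reduced form of the image in \<open>F\<^sub>n\<close>; independence of the chosen
  representative is \<open>red_proj_heg\<close>.\<close>

definition red_proj :: "nat \<Rightarrow> word set \<Rightarrow> letter list" where
  "red_proj n x = red (word_proj n (SOME w. w \<in> x))"

lemma red_proj_heg:
  assumes w: "is_word w"
  shows "red_proj n (heg w) = red (word_proj n w)"
proof -
  have "w \<in> heg w" using w by (simp add: heg_def word_rel_iff)
  then have some: "(SOME u. u \<in> heg w) \<in> heg w" by (rule someI)
  have "red (word_proj n u) = red (word_proj n w)" if "u \<in> heg w" for u
    using that by (simp add: heg_def word_rel_iff)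
  from this[OF some] show ?thesis unfolding red_proj_def .
qed

lemma freely_reduced_red_proj [simp]: "freely_reduced (red_proj n x)"
  by (simp add: red_proj_def)

lemma red_proj_mult:
  assumes "x \<in> carrier HEG" "y \<in> carrier HEG"
  shows "red_proj n (x \<otimes>\<^bsub>HEG\<^esub> y) = red (red_proj n x @ red_proj n y)"
proof -
  obtain u where u: "is_word u" "x = heg u" by (rule carrier_HEG_cases[OF assms(1)])
  obtain v where v: "is_word v" "y = heg v" by (rule carrier_HEG_cases[OF assms(2)])
  show ?thesis
    using u v by (simp add: mult_heg red_proj_heg is_word_append word_proj_append)
qed

lemma red_proj_one [simp]: "red_proj n \<one>\<^bsub>HEG\<^esub> = []"
  by (simp add: one_HEG red_proj_heg is_word_empty word_proj_empty)

text \<open>The group embeds into the inverse limit of the groups \<open>F\<^sub>n\<close>, so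
  identities in it become computations with \<open>red\<close>.\<close>

lemma HEG_eqI:
  assumes "x \<in> carrier HEG" "y \<in> carrier HEG" "\<And>n. red_proj n x = red_proj n y"
  shows "x = y"
proof -
  obtain u where u: "is_word u" "x = heg u" by (rule carrier_HEG_cases[OF assms(1)])
  obtain v where v: "is_word v" "y = heg v" by (rule carrier_HEG_cases[OF assms(2)])
  show ?thesis using assms(3) u v by (simp add: heg_eq_iff red_proj_heg)
qed

lemma mult_HEG_closed: "\<lbrakk>x \<in> carrier HEG; y \<in> carrier HEG\<rbrakk> \<Longrightarrow> x \<otimes>\<^bsub>HEG\<^esub> y \<in> carrier HEG"
  by (metis carrier_HEG_cases heg_in_carrier is_word_append mult_heg)

lemma heg_word_inv:
  assumes "is_word w"
  shows "heg (word_inv w) \<otimes>\<^bsub>HEG\<^esub> heg w = \<one>\<^bsub>HEG\<^esub>"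
proof (rule HEG_eqI)
  show "red_proj n (heg (word_inv w) \<otimes>\<^bsub>HEG\<^esub> heg w) = red_proj n \<one>\<^bsub>HEG\<^esub>" for n
    using assms red_inv_list_append[of "word_proj n w" "[]"]
    by (simp add: red_proj_mult red_proj_heg is_word_inv word_proj_inv)
qed (use assms in \<open>simp_all add: mult_HEG_closed is_word_inv is_word_empty one_HEG\<close>)

lemma group_HEG: "group HEG"
proof (rule groupI)
  show one: "\<one>\<^bsub>HEG\<^esub> \<in> carrier HEG" by (simp add: one_HEG is_word_empty)
  show "x \<otimes>\<^bsub>HEG\<^esub> y \<in> carrier HEG" if "x \<in> carrier HEG" "y \<in> carrier HEG" for x y
    by (rule mult_HEG_closed[OF that])
  show "x \<otimes>\<^bsub>HEG\<^esub> y \<otimes>\<^bsub>HEG\<^esub> z = x \<otimes>\<^bsub>HEG\<^esub> (y \<otimes>\<^bsub>HEG\<^esub> z)"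
    if "x \<in> carrier HEG" "y \<in> carrier HEG" "z \<in> carrier HEG" for x y z
    using that by (intro HEG_eqI) (simp_all add: mult_HEG_closed red_proj_mult)
  show "\<one>\<^bsub>HEG\<^esub> \<otimes>\<^bsub>HEG\<^esub> x = x" if "x \<in> carrier HEG" for x
    using that one by (intro HEG_eqI) (simp_all add: mult_HEG_closed red_proj_mult red_reduced)
  show "\<exists>y\<in>carrier HEG. y \<otimes>\<^bsub>HEG\<^esub> x = \<one>\<^bsub>HEG\<^esub>" if "x \<in> carrier HEG" for x
    using that heg_word_inv is_word_inv by (metis carrier_HEG_cases heg_in_carrier)
qed

interpretation HEG: group HEG by (rule group_HEG)

lemma red_proj_inv:
  assumes "x \<in> carrier HEG"
  shows "red_proj n (inv\<^bsub>HEG\<^esub> x) = inv_list (red_proj n x)"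
proof -
  obtain w where w: "is_word w" "x = heg w" by (rule carrier_HEG_cases[OF assms])
  then have "inv\<^bsub>HEG\<^esub> x = heg (word_inv w)"
    using heg_word_inv by (intro HEG.inv_equality) (simp_all add: is_word_inv)
  then show ?thesis using w by (simp add: red_proj_heg is_word_inv word_proj_inv red_inv_list)
qed

lemma red_proj_filter:
  assumes "x \<in> carrier HEG" "m \<le> n"
  shows "red_proj m x = red (filter (\<lambda>a. a \<in> letters_upto m) (red_proj n x))"
proof -
  obtain w where w: "is_word w" "x = heg w" by (rule carrier_HEG_cases[OF assms(1)])
  then show ?thesis
    using word_proj_filter[OF w(1) assms(2)] by (simp add: red_proj_heg red_filter)
qed

lemma red_proj_eq_Nil_mono: "\<lbrakk>x \<in> carrier HEG; m \<le> n; red_proj n x = []\<rbrakk> \<Longrightarrow> red_proj m x = []"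
  using red_proj_filter[of x m n] by simp

lemma set_red_proj: "x \<in> carrier HEG \<Longrightarrow> set (red_proj n x) \<subseteq> letters_upto n"
  using red_proj_filter[of x n n] set_red[of "filter (\<lambda>a. a \<in> letters_upto n) (red_proj n x)"]
    by auto


section \<open>Trees of the Hawaiian earring group\<close>

text \<open>The number of edges between the base vertex and its translate by \<open>x\<close> in the tree on
  which \<open>H\<^sub>n\<close> fixes the base vertex and \<open>F\<^sub>n\<close> acts freely.\<close>

definition heg_length :: "nat \<Rightarrow> word set \<Rightarrow> nat" where
  "heg_length n x = (SUP m. num_upto n (red_proj m x))"

lemma num_upto_filter_le: "num_upto n (filter P xs) \<le> num_upto n xs"
  by (induction xs) auto

text \<open>Passing from \<open>m'\<close> down to \<open>m\<close> deletes letters and then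
  reduces, and neither operation adds a letter below \<open>n\<close>.\<close>

lemma num_upto_red_proj_mono:
  assumes "x \<in> carrier HEG" "m \<le> m'"
  shows "num_upto n (red_proj m x) \<le> num_upto n (red_proj m' x)"
  unfolding red_proj_filter[OF assms] by (rule le_trans[OF num_upto_red_le num_upto_filter_le])

lemma num_upto_red_proj_heg_le:
  assumes w: "is_word w"
  shows "num_upto n (red_proj m (heg w)) \<le> card (upto_positions n w)"
proof -
  obtain "is" where "is": "distinct is" "set is = upto_positions n w"
    "word_proj n w = map (label w) is"
    using word_projE[OF w] .
  have "num_upto n (red_proj m (heg w)) \<le> num_upto n (red_proj (max m n) (heg w))"
    using w by (intro num_upto_red_proj_mono) simp_all
  also have "\<dots> \<le> num_upto n (word_proj (max m n) w)"
    using w by (simp add: red_proj_heg num_upto_red_le)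
  also have "\<dots> = length (word_proj n w)"
    by (simp add: num_upto_def word_proj_filter[OF w, of n "max m n"])
  also have "\<dots> = card (upto_positions n w)" using "is" by (metis distinct_card length_map)
  finally show ?thesis .
qed

lemma bdd_above_num_upto_red_proj:
  assumes "x \<in> carrier HEG"
  shows "bdd_above (range (\<lambda>m. num_upto n (red_proj m x)))"
proof -
  obtain w where "is_word w" "x = heg w" by (rule carrier_HEG_cases[OF assms])
  then show ?thesis by (intro bdd_aboveI2[of _ _ "card (upto_positions n w)"])
    (simp add: num_upto_red_proj_heg_le)
qed

lemma num_upto_red_proj_le_heg_length: "x \<in> carrier HEG \<Longrightarrow> num_upto n (red_proj m x) \<le>
  heg_length n x"
  unfolding heg_length_def by (rule cSUP_upper[OF UNIV_I bdd_above_num_upto_red_proj])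

lemma heg_length_heg_le: "is_word w \<Longrightarrow> heg_length n (heg w) \<le> card (upto_positions n w)"
  unfolding heg_length_def by (intro cSUP_least num_upto_red_proj_heg_le) simp_all

text \<open>A bounded supremum of naturals is attained, and monotonicity keeps it from then on. Thus
  finitely many lengths can be computed at one common large \<open>m\<close>.\<close>

lemma eventually_heg_length:
  assumes x: "x \<in> carrier HEG"
  shows "\<forall>\<^sub>F m in sequentially. num_upto n (red_proj m x) = heg_length n x"
proof -
  have "finite (range (\<lambda>m. num_upto n (red_proj m x)))"
    using bdd_above_num_upto_red_proj[OF x] by (simp add: bdd_above_nat)
  then have "heg_length n x \<in> range (\<lambda>m. num_upto n (red_proj m x))"
    unfolding heg_length_def by (simp add: cSup_eq_Max Max_in)
  then obtain M where "heg_length n x = num_upto n (red_proj M x)" by blast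
  then have "num_upto n (red_proj m x) = heg_length n x" if "M \<le> m" for m
    using num_upto_red_proj_mono[OF x that, of n] num_upto_red_proj_le_heg_length[OF x, of n m]
      by simp
  then show ?thesis by (auto simp: eventually_sequentially)
qed

text \<open>Malnormality of \<open>H\<^sub>n\<close>. With \<open>k\<close> split at its first
  letter \<open>a\<close> below \<open>n\<close>, the part \<open>u\<close> before it conjugates
  \<open>g\<close> to some \<open>r\<close> without such letters. If \<open>r\<close> were
  non-empty, nothing would cancel between \<open>r\<close> and the neighbouring
  \<open>inv_letter a\<close> and \<open>a\<close>, so \<open>a\<close> would survive in the
  conjugate.\<close>

lemma conjugate_reduced:
  assumes g: "freely_reduced g" "num_upto n g = 0" and k: "freely_reduced k" "num_upto n k > 0"
    and conj: "num_upto n (red (inv_list k @ g @ k)) = 0"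
  shows "g = []"
proof -
  have "\<exists>a\<in>set k. a \<in> letters_upto n" using k(2) num_upto_eq_0_iff[of n k] by auto
  then obtain u a v where uav: "k = u @ a # v" and a: "a \<in> letters_upto n"
    and u: "\<forall>b\<in>set u. b \<notin> letters_upto n"
    using split_list_first_prop[of k "\<lambda>a. a \<in> letters_upto n"] by blast
  define r where "r = red (inv_list u @ g @ u)"
  have r: "b \<notin> letters_upto n" if "b \<in> set r" for b
  proof -
    have "num_upto n (inv_list u @ g @ u) = 0" using g(2) u num_upto_eq_0_iff[of n u] by simp
    then have "num_upto n r = 0" unfolding r_def using num_upto_red_le by (metis le_zero_eq)
    then show ?thesis using that by (simp add: num_upto_eq_0_iff)
  qed
  have "r = []"
  proof (rule ccontr)
    assume ne: "r \<noteq> []"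
    then have "hd r \<noteq> a" "last r \<noteq> inv_letter a" using r[of "hd r"] r[of "last r"] a by auto
    moreover have av: "freely_reduced (a # v)" using k(1) reduced_appendD(2) unfolding uav by blast
    moreover have "freely_reduced r" by (simp add: r_def)
    moreover have "freely_reduced (inv_list v @ [inv_letter a])" using reduced_inv_list[OF av]
      by simp
    ultimately have "freely_reduced ((inv_list v @ [inv_letter a]) @ r @ a # v)"
      unfolding reduced_append_iff[of "inv_list v @ [inv_letter a]"] reduced_append_iff[of r]
      using ne by (auto dest: sym)
    moreover have "red (inv_list k @ g @ k) = red ((inv_list v @ [inv_letter a]) @ r @ a # v)"
      unfolding r_def red_append_red_append uav by simp
    ultimately have "red (inv_list k @ g @ k) = (inv_list v @ [inv_letter a]) @ r @ a # v"
      by (simp only: red_reduced)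
    then show False using conj a by simp
  qed
  then have "red (u @ (inv_list u @ g @ u) @ inv_list u) = []"
    using red_append_red_append[of u "inv_list u @ g @ u"
      "inv_list u"] red_append_inv_list[of u "[]"] by (simp add: r_def)
  moreover have "red (u @ (inv_list u @ g @ u) @ inv_list u) = red g"
    using red_append_inv_list[of u "g @ u @ inv_list u"] red_append_inv_list[of u "[]"]
      red_append_red(2)[of g "u @ inv_list u"] by simp
  ultimately show ?thesis using g(1) by (simp add: red_reduced)
qed

text \<open>A representative has finitely many letters below \<open>n\<close>. Cutting it just
  behind the first of them gives a factor of length at most 1 and a rest with one such letter less,
  whose path is translated by that factor.\<close>

lemma HEG_connected:
  assumes "is_word w"
  shows "(\<one>\<^bsub>HEG\<^esub>, heg w) \<in> {(x, y). x \<in> carrier HEG \<and> y \<in> carrier HEG \<and>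
    heg_length n (inv\<^bsub>HEG\<^esub> x \<otimes>\<^bsub>HEG\<^esub> y) \<le> 1}\<^sup>*" (is "_ \<in> ?E\<^sup>*")
  using assms
proof (induction "card (upto_positions n w)" arbitrary: w)
  case 0
  then have "(\<one>\<^bsub>HEG\<^esub>, heg w) \<in> ?E" using heg_length_heg_le[of w n] by simp
  then show ?case by (rule r_into_rtrancl)
next
  case (Suc c)
  note w = \<open>is_word w\<close> and fin = finite_upto_positions[OF \<open>is_word w\<close>, of n]
  obtain "is" where "is": "distinct is" "set is = upto_positions n w"
    "sorted_wrt (\<lambda>i j. (i, j) \<in> ord w) is"
    using word_projE[OF w] .
  obtain i js where ijs: "is = i # js" using Suc(2) "is"(2) by (cases "is") auto
  have i: "i \<in> upto_positions n w" "i \<in> positions w" using "is"(2) ijs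
    by (auto simp: upto_positions_def)
  \<comment> \<open>The initial segment up to and including \<open>i\<close>: it may be infinite,
    but \<open>i\<close> is its only position with a letter below \<open>n\<close>.\<close>
  define D where "D = {j. (j, i) \<in> ord w}"
  define u where "u = word_restrict w D"
  define v where "v = word_restrict w (- D)"
  have uv: "is_word u" "is_word v" using is_word_restrict[OF w] by (simp_all add: u_def v_def)
  have split: "word_proj m w = word_proj m u @ word_proj m v" for m
    unfolding u_def v_def
  proof (rule word_proj_split[OF w])
    fix j k assume "j \<in> positions w \<inter> D" "k \<in> positions w - D"
    then have "(j, i) \<in> ord w" "(i, k) \<in> ord w" using is_word_ordD(5)[OF w i(2), of k]
      by (auto simp: D_def)
    then show "(j, k) \<in> ord w" using is_word_ordD(4)[OF w] by blast
  qed
  have eq: "heg w = heg u \<otimes>\<^bsub>HEG\<^esub> heg v"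
    using w uv by (simp add: mult_heg heg_eq_iff is_word_append word_proj_append split)
  have "j = i" if "j \<in> upto_positions n w" "(j, i) \<in> ord w" for j
    using that "is"(2,3) is_word_ordD(3)[OF w, of i j] by (auto simp: ijs)
  then have "upto_positions n u \<subseteq> {i}"
    by (auto simp: u_def word_restrict_def upto_positions_def D_def)
  then have "card (upto_positions n u) \<le> card {i}" by (intro card_mono) simp_all
  then have 1: "(\<one>\<^bsub>HEG\<^esub>, heg u) \<in> ?E" using heg_length_heg_le[OF uv(1), of n] uv(1) by simp
  have "upto_positions n v = upto_positions n w - {i}"
    using \<open>\<And>j. j \<in> upto_positions n w \<Longrightarrow> (j, i) \<in> ord w \<Longrightarrow> j = i\<close> is_word_ordD(2)[OF w i(2)]
    by (auto simp: v_def word_restrict_def upto_positions_def D_def)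
  then have "c = card (upto_positions n v)" using Suc(2) i fin by simp
  then have "(\<one>\<^bsub>HEG\<^esub>, heg v) \<in> ?E\<^sup>*" using Suc(1) uv by blast
  then have "(heg u \<otimes>\<^bsub>HEG\<^esub> \<one>\<^bsub>HEG\<^esub>, heg u \<otimes>\<^bsub>HEG\<^esub> heg v) \<in> ?E\<^sup>*"
  proof (induction rule: rtrancl_induct)
    case (step x y)
    have "inv\<^bsub>HEG\<^esub> (heg u \<otimes>\<^bsub>HEG\<^esub> x) \<otimes>\<^bsub>HEG\<^esub> (heg u \<otimes>\<^bsub>HEG\<^esub> y) = inv\<^bsub>HEG\<^esub> x \<otimes>\<^bsub>HEG\<^esub> y"
      using step(2) uv by (simp add: HEG.inv_mult_group HEG.m_assoc flip:
        HEG.m_assoc[of "inv\<^bsub>HEG\<^esub> heg u" "heg u" y])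
    then have "(heg u \<otimes>\<^bsub>HEG\<^esub> x, heg u \<otimes>\<^bsub>HEG\<^esub> y) \<in> ?E" using step(2) uv by simp
    with step.IH show ?case by (rule rtrancl_into_rtrancl)
  qed simp
  then have "(heg u, heg w) \<in> ?E\<^sup>*" unfolding eq using uv(1)
    by (simp only: HEG.r_one heg_in_carrier)
  with 1 show ?case by (rule converse_rtrancl_into_rtrancl)
qed

lemma tree_length_HEG: "tree_length HEG (heg_length n)"
proof -
  \<comment> \<open>The axioms do not mention \<open>m\<close>, so it is enough to verify them for
    all large \<open>m\<close>, where the lengths involved are counts in finite reduced
    words.\<close>
  have eventually_const: "P" if "\<forall>\<^sub>F m :: nat in sequentially. P" for P
    using that by (simp add: eventually_const)
  show ?thesis
  proof
    have "\<forall>\<^sub>F m in sequentially. heg_length n \<one>\<^bsub>HEG\<^esub> = 0"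
      using eventually_heg_length[OF HEG.one_closed, of n] by eventually_elim simp
    then show "heg_length n \<one>\<^bsub>HEG\<^esub> = 0" by (rule eventually_const)
    show "heg_length n (inv\<^bsub>HEG\<^esub> x) = heg_length n x" if x: "x \<in> carrier HEG" for x
    proof (rule eventually_const)
      show "\<forall>\<^sub>F m in sequentially. heg_length n (inv\<^bsub>HEG\<^esub> x) = heg_length n x"
        using eventually_heg_length[OF x, of n] eventually_heg_length[OF HEG.inv_closed[OF x], of n]
        by eventually_elim (simp add: red_proj_inv x)
    qed
    show "heg_length n z + heg_length n (inv\<^bsub>HEG\<^esub> x \<otimes>\<^bsub>HEG\<^esub> y) \<le>
        max (heg_length n x + heg_length n (inv\<^bsub>HEG\<^esub> z \<otimes>\<^bsub>HEG\<^esub> y))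
          (heg_length n y + heg_length n (inv\<^bsub>HEG\<^esub> z \<otimes>\<^bsub>HEG\<^esub> x))"
      if x: "x \<in> carrier HEG" and y: "y \<in> carrier HEG" and z: "z \<in> carrier HEG" for x y z
    proof (rule eventually_const)
      have c: "inv\<^bsub>HEG\<^esub> x \<otimes>\<^bsub>HEG\<^esub> y \<in> carrier HEG" "inv\<^bsub>HEG\<^esub> z \<otimes>\<^bsub>HEG\<^esub> y \<in> carrier HEG"
        "inv\<^bsub>HEG\<^esub> z \<otimes>\<^bsub>HEG\<^esub> x \<in> carrier HEG"
        using x y z by simp_all
      show "\<forall>\<^sub>F m in sequentially. heg_length n z + heg_length n (inv\<^bsub>HEG\<^esub> x \<otimes>\<^bsub>HEG\<^esub> y) \<le>
        max (heg_length n x + heg_length n (inv\<^bsub>HEG\<^esub> z \<otimes>\<^bsub>HEG\<^esub> y))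
          (heg_length n y + heg_length n (inv\<^bsub>HEG\<^esub> z \<otimes>\<^bsub>HEG\<^esub> x))"
        using eventually_heg_length[OF x, of n] eventually_heg_length[OF y, of n]
          eventually_heg_length[OF z, of n]
          eventually_heg_length[OF c(1), of n] eventually_heg_length[OF c(2), of n]
            eventually_heg_length[OF c(3), of n]
      proof eventually_elim
        case (elim m)
        then show ?case
          using num_upto_four_point[of "red_proj m x" "red_proj m y" "red_proj m z" n] x y z
          by (simp add: red_proj_mult red_proj_inv)
      qed
    qed
    show "g = \<one>\<^bsub>HEG\<^esub>" if k: "k \<in> carrier HEG" and g: "g \<in> carrier HEG"
      and len: "heg_length n k > 0" "heg_length n g = 0"
      "heg_length n (inv\<^bsub>HEG\<^esub> k \<otimes>\<^bsub>HEG\<^esub> g \<otimes>\<^bsub>HEG\<^esub> k) = 0" for k g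
    proof -
      have c: "inv\<^bsub>HEG\<^esub> k \<otimes>\<^bsub>HEG\<^esub> g \<otimes>\<^bsub>HEG\<^esub> k \<in> carrier HEG" using k g by simp
      have "\<forall>\<^sub>F m in sequentially. red_proj m g = []"
        using eventually_heg_length[OF k, of n] eventually_heg_length[OF g, of n]
          eventually_heg_length[OF c, of n]
      proof eventually_elim
        case (elim m)
        have "num_upto n (red (inv_list (red_proj m k) @ red_proj m g @ red_proj m k)) = 0"
          using elim(3) len(3) k g by (simp add: red_proj_mult red_proj_inv)
        then show ?case
          using elim len by (intro conjugate_reduced[of _ n "red_proj m k"]) simp_all
      qed
      then obtain M where M: "red_proj m g = []" if "m \<ge> M" for m
        by (auto simp: eventually_sequentially)
      have "red_proj m g = []" for m
        using red_proj_eq_Nil_mono[OF g, of m "max m M"] M[of "max m M"] by simp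
      then show ?thesis using g by (intro HEG_eqI) simp_all
    qed
    show "(\<one>\<^bsub>HEG\<^esub>, g) \<in> {(x, y). x \<in> carrier HEG \<and> y \<in> carrier HEG \<and>
        heg_length n (inv\<^bsub>HEG\<^esub> x \<otimes>\<^bsub>HEG\<^esub> y) \<le> 1}\<^sup>*" if "g \<in> carrier HEG" for g
      using that HEG_connected by (metis (no_types, lifting) carrier_HEG_cases)
  qed
qed

text \<open>Squaring strictly lengthens a non-empty reduced list, so repeated squaring already makes
  the lengths unbounded.\<close>

lemma red_proj_power_of_two:
  assumes g: "g \<in> carrier HEG" and ne: "red_proj n g \<noteq> []"
  shows "length (red_proj n (g [^]\<^bsub>HEG\<^esub> ((2 :: nat) ^ j))) > j"
proof (induction j)
  case 0
  then show ?case using assms by simp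
next
  case (Suc j)
  define h where "h = g [^]\<^bsub>HEG\<^esub> ((2 :: nat) ^ j)"
  have h: "h \<in> carrier HEG" using g by (simp add: h_def)
  have "g [^]\<^bsub>HEG\<^esub> ((2 :: nat) ^ Suc j) = h \<otimes>\<^bsub>HEG\<^esub> h"
    using g by (simp add: h_def HEG.nat_pow_mult mult_2)
  then have "red_proj n (g [^]\<^bsub>HEG\<^esub> ((2 :: nat) ^ Suc j)) = red (red_proj n h @ red_proj n h)"
    using h by (simp add: red_proj_mult)
  moreover have "length (red_proj n h) > j" using Suc by (simp add: h_def)
  moreover from this have "length (red (red_proj n h @ red_proj n h)) > length (red_proj n h)"
    by (intro length_red_square) auto
  ultimately show ?case by simp
qed

lemma elliptic_radical_HEG: "elliptic_radical HEG = {\<one>\<^bsub>HEG\<^esub>}"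
proof
  show "elliptic_radical HEG \<subseteq> {\<one>\<^bsub>HEG\<^esub>}"
  proof (rule subsetI, rule ccontr)
    fix g assume g: "g \<in> elliptic_radical HEG" and "g \<notin> {\<one>\<^bsub>HEG\<^esub>}"
    have gc: "g \<in> carrier HEG" using g by (simp add: elliptic_radical_def)
    obtain n where n: "red_proj n g \<noteq> []"
      using HEG_eqI[OF gc HEG.one_closed] \<open>g \<notin> _\<close> by auto
    interpret tree_length HEG "heg_length n" by (rule tree_length_HEG)
    \<comment> \<open>The tight span consists of functions and lies outside the type over which
      \<open>elliptic_radical\<close> quantifies; \<open>elliptic_radicalD\<close> bridges
      this.\<close>
    have "elliptic HEG tight_span sup_dist act g"
      using g hyperbolic_space_tight_span acylindrical_action_act by (rule elliptic_radicalD)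
    then obtain B where B: "real (heg_length n (g [^]\<^bsub>HEG\<^esub> k)) \<le> B" for k :: nat
      using elliptic_act_bounded[OF gc] by blast
    obtain j :: nat where j: "B < real j" using reals_Archimedean2 by blast
    have "j < length (red_proj n (g [^]\<^bsub>HEG\<^esub> ((2 :: nat) ^ j)))"
      by (rule red_proj_power_of_two[OF gc n])
    also have "\<dots> = num_upto n (red_proj n (g [^]\<^bsub>HEG\<^esub> ((2 :: nat) ^ j)))"
      using gc by (simp add: num_upto_eq_length set_red_proj)
    also have "\<dots> \<le> heg_length n (g [^]\<^bsub>HEG\<^esub> ((2 :: nat) ^ j))"
      using gc by (intro num_upto_red_proj_le_heg_length) simp
    finally show False using B[of "2 ^ j"] j by simp
  qed
  have "elliptic HEG S d \<phi> \<one>\<^bsub>HEG\<^esub>" if hyp: "hyperbolic_space S d"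
    and acyl: "acylindrical_action HEG S d \<phi>"
    for S :: "(word set \<times> real) set" and d \<phi>
  proof -
    interpret Metric_space S d using acyl
      by (simp add: acylindrical_action_def isometric_action_def)
    interpret group_action HEG S \<phi> using acyl
      by (simp add: acylindrical_action_def isometric_action_def)
    obtain x where x: "x \<in> S" using hyp unfolding hyperbolic_space_def by blast
    have "\<phi> \<one>\<^bsub>HEG\<^esub> x \<in> S" using x HEG.one_closed by (rule element_image[OF _ _ refl, rotated])
    then have "mbounded {\<phi> (\<one>\<^bsub>HEG\<^esub> [^]\<^bsub>HEG\<^esub> n) x | n :: int. True}"
      by (simp add: mbounded_insert)
    then show ?thesis using x by (auto simp: elliptic_def)
  qed
  then show "{\<one>\<^bsub>HEG\<^esub>} \<subseteq> elliptic_radical HEG" by (auto simp: elliptic_radical_def)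
qed

section \<open>Finite words and points of the limit set\<close>

lemma red_proj_finite_word:
  "freely_reduced xs \<Longrightarrow> set xs \<subseteq> letters_upto m \<Longrightarrow> red_proj m (heg (finite_word xs)) = xs"
  by (simp add: red_proj_heg is_word_finite_word word_proj_finite_word red_reduced
    filter_id_conv[THEN iffD2] subset_iff del: split_paired_All)

lemma heg_length_eqI:
  assumes x: "x \<in> carrier HEG" and c: "\<And>m. m \<ge> M \<Longrightarrow> num_upto n (red_proj m x) = c"
  shows "heg_length n x = c"
proof -
  have "\<forall>\<^sub>F m in sequentially. heg_length n x = c"
    using eventually_heg_length[OF x, of n] eventually_ge_at_top[of M]
      by eventually_elim (simp add: c)
  then show ?thesis by (simp add: eventually_const)
qed

lemma heg_length_finite_words:
  assumes "freely_reduced xs" "freely_reduced ys"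
  shows "heg_length n (inv\<^bsub>HEG\<^esub> (heg (finite_word xs)) \<otimes>\<^bsub>HEG\<^esub> heg (finite_word ys))
    + 2 * num_upto n (lcp xs ys) =
    num_upto n xs + num_upto n ys"
proof -
  obtain M where M: "fst a < M" if "a \<in> set xs \<union> set ys" for a
    using finite_nat_set_iff_bounded[of "fst ` (set xs \<union> set ys)"] by auto
  then have sub: "set xs \<subseteq> letters_upto m" "set ys \<subseteq> letters_upto m" if "m \<ge> M" for m
    using that by (fastforce simp: letters_upto_def)+
  have "heg_length n (inv\<^bsub>HEG\<^esub> (heg (finite_word xs)) \<otimes>\<^bsub>HEG\<^esub> heg (finite_word ys)) =
    num_upto n (red (inv_list xs @ ys))"
  proof (rule heg_length_eqI[where M = M])
    show "num_upto n (red_proj m (inv\<^bsub>HEG\<^esub> (heg (finite_word xs)) \<otimes>\<^bsub>HEG\<^esub> heg (finite_word ys))) =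
      num_upto n (red (inv_list xs @ ys))"
      if "m \<ge> M" for m
      using sub[OF that] assms
        by (simp add: red_proj_mult red_proj_inv is_word_finite_word red_proj_finite_word)
  qed (simp add: is_word_finite_word)
  then show ?thesis using num_upto_red_inv_list_append[OF assms] by simp
qed

lemma freely_reduced_replicate: "freely_reduced (replicate i a)"
proof (induction i)
  case (Suc i)
  then show ?case by (cases i) simp_all
qed simp

lemma lcp_replicate_same: "lcp (replicate i a) (replicate j a) = replicate (min i j) a"
proof (induction i arbitrary: j)
  case (Suc i)
  then show ?case by (cases j) simp_all
qed simp

lemma lcp_replicate_distinct: "a \<noteq> b \<Longrightarrow> lcp (replicate i a) (replicate j b) = []"
  by (cases i; cases j) simp_all

lemma num_upto_replicate: "a \<in> letters_upto n \<Longrightarrow> num_upto n (replicate i a) = i"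
  by (induction i) simp_all

text \<open>There are four letters in \<open>letters_upto 2\<close>. The powers of each of them run
  along a ray from the base point, and different rays have Gromov product 0 there, so the limit set
  has at least four points.\<close>

lemma acylindrically_hyperbolic_HEG: "acylindrically_hyperbolic HEG"
proof -
  interpret tree_length HEG "heg_length 2" by (rule tree_length_HEG)
  interpret MS: Metric_space tight_span sup_dist by (rule Metric_space_tight_span)
  define x where "x a i = heg (finite_word (replicate i a))" for a i
  define s where "s a i = embed (x a i)" for a :: letter and i :: nat
  define o' where "o' = embed \<one>\<^bsub>HEG\<^esub>"
  have xc: "x a i \<in> carrier HEG" for a i by (simp add: x_def is_word_finite_word)
  have s_in: "s a i \<in> tight_span" for a i by (simp add: s_def xc embed_in_tight_span)
  have o': "o' \<in> tight_span" by (simp add: o'_def embed_in_tight_span)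
  have one: "\<one>\<^bsub>HEG\<^esub> = heg (finite_word [])"
    by (simp add: one_HEG heg_eq_iff is_word_empty is_word_finite_word word_proj_empty
      word_proj_finite_word)
  have D: "sup_dist (s a i) (s b j) =
    real i + real j - 2 * real (num_upto 2 (lcp (replicate i a) (replicate j b)))"
    if "a \<in> letters_upto 2" "b \<in> letters_upto 2" for a b i j
    using heg_length_finite_words[of "replicate i a" "replicate j b" 2] that
    by (simp add: s_def sup_dist_embed_embed xc gdist_def)
      (simp add: x_def freely_reduced_replicate num_upto_replicate)
  have D0: "sup_dist o' (s a i) = real i" if "a \<in> letters_upto 2" for a i
  proof -
    have "heg_length 2 (x a i) = i"
      using heg_length_finite_words[of "[]" "replicate i a" 2] that xc[of a i]
      by (simp add: x_def freely_reduced_replicate num_upto_replicate flip: one)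
    then show ?thesis by (simp add: s_def o'_def sup_dist_embed_embed xc gdist_def)
  qed
  have same: "gromov_product sup_dist o' (s a i) (s a j) = real (min i j)" if "a \<in> letters_upto 2"
    for a i j
    using that by (simp add: gromov_product_def D D0 lcp_replicate_same num_upto_replicate)
  have different: "gromov_product sup_dist o' (s a i) (s b i) = 0"
    if "a \<in> letters_upto 2" "b \<in> letters_upto 2" "a \<noteq> b" for a b i
    using that by (simp add: gromov_product_def D D0 lcp_replicate_distinct)
  have conv: "converges_to_infinity tight_span sup_dist (s a)" if a: "a \<in> letters_upto 2" for a
    unfolding converges_to_infinity_def
  proof (intro conjI ballI)
    show "range (s a) \<subseteq> tight_span" using s_in by blast
    fix p assume p: "p \<in> tight_span"
    have "filterlim (\<lambda>ij. real (min (fst ij) (snd ij))) at_top (sequentially \<times>\<^sub>F sequentially)"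
      unfolding filterlim_at_top
    proof
      fix Z :: real
      obtain N :: nat where N: "Z \<le> real N" using real_arch_simple by blast
      have "\<forall>\<^sub>F ij in sequentially \<times>\<^sub>F sequentially. fst ij \<ge> N \<and> snd ij \<ge> N"
        by (intro eventually_prodI eventually_ge_at_top)
      then show "\<forall>\<^sub>F ij in sequentially \<times>\<^sub>F sequentially. Z \<le> real (min (fst ij) (snd ij))"
        by eventually_elim (use N in auto)
    qed
    then have "filterlim (\<lambda>ij. gromov_product sup_dist o' (s a (fst ij)) (s a (snd ij)))
      at_top (sequentially \<times>\<^sub>F sequentially)"
      by (simp add: same[OF a])
    then have "filterlim (\<lambda>ij. gromov_product sup_dist p (s a (fst ij)) (s a (snd ij)))
      at_top (sequentially \<times>\<^sub>F sequentially)"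
      using s_in by (intro filterlim_gromov_product_basepoint[OF MS.Metric_space_axioms p o']) auto
    then show "filterlim (\<lambda>(i, j). gromov_product sup_dist p (s a i) (s a j))
      at_top (sequentially \<times>\<^sub>F sequentially)"
      by (simp only: case_prod_unfold)
  qed
  note eq = equiv_boundary_rel[OF hyperbolic_space_tight_span]
  define \<xi> where "\<xi> a = boundary_rel tight_span sup_dist `` {s a}" for a
  have "inj_on \<xi> (letters_upto 2)"
  proof (rule inj_onI, rule ccontr)
    fix a b assume ab: "a \<in> letters_upto 2" "b \<in> letters_upto 2" "\<xi> a = \<xi> b" "a \<noteq> b"
    then have "(s a, s b) \<in> boundary_rel tight_span sup_dist"
      using eq_equiv_class[OF _ eq] conv by (simp add: \<xi>_def)
    then have "filterlim (\<lambda>n. gromov_product sup_dist o' (s a n) (s b n)) at_top sequentially"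
      using o' by (simp add: boundary_rel_def)
    then have "filterlim (\<lambda>n. 0 :: real) at_top sequentially" using ab by (simp add: different)
    then show False by (simp add: filterlim_at_top_dense) (metis less_irrefl)
  qed
  moreover have "\<xi> ` letters_upto 2 \<subseteq> limit_set HEG tight_span sup_dist act"
  proof
    fix \<zeta> assume "\<zeta> \<in> \<xi> ` letters_upto 2"
    then obtain a where a: "a \<in> letters_upto 2" "\<zeta> = \<xi> a" by blast
    have "s a \<in> \<zeta>" unfolding a \<xi>_def using equiv_class_self[OF eq] conv[OF a(1)] by blast
    moreover have "\<zeta> \<in> gromov_boundary tight_span sup_dist"
      unfolding a \<xi>_def gromov_boundary_def using conv[OF a(1)] by (intro quotientI) simp
    moreover have "s a i = act (x a i) o'" for i using act_embed[OF xc HEG.one_closed] xc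
      by (simp add: s_def o'_def)
    then have "range (s a) \<subseteq> Group_Action.orbit HEG act o'" using xc
      unfolding Group_Action.orbit_def by blast
    ultimately show "\<zeta> \<in> limit_set HEG tight_span sup_dist act"
      unfolding limit_set_def using o' by blast
  qed
  moreover have "card (letters_upto 2) = 4"
  proof -
    have "letters_upto 2 = {..<2} \<times> UNIV" by (auto simp: letters_upto_def)
    then show ?thesis by (simp add: card_cartesian_product)
  qed
  ultimately have "\<not> elementary_action HEG tight_span sup_dist act"
    unfolding elementary_action_def
    using card_mono[of "limit_set HEG tight_span sup_dist act" "\<xi> ` letters_upto 2"]
      by (auto simp: card_image)
  then show ?thesis
    using acylindrically_hyperbolicI[OF hyperbolic_space_tight_span acylindrical_action_act]
      by blast
qed


section \<open>Infinite words with iterated powers\<close>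

definition bounded_path :: "(nat \<Rightarrow> nat) \<Rightarrow> nat \<Rightarrow> nat list \<Rightarrow> bool" where
  "bounded_path k i p \<longleftrightarrow> (\<forall>t<length p. p ! t < k (i + t))"

text \<open>The nodes of depth below \<open>n\<close> in preorder, a node before its children. This
  is the lexicographic order, so the list gives the finite projections of \<open>power_word\<close>
  explicitly.\<close>

fun paths :: "(nat \<Rightarrow> nat) \<Rightarrow> nat \<Rightarrow> nat \<Rightarrow> nat list list" where
  "paths k i 0 = []"
| "paths k i (Suc n) = [] # concat (map (\<lambda>j. map (Cons j) (paths k (Suc i) n)) [0..<k i])"

lemma bounded_path_simps [simp]:
  "bounded_path k i []" "bounded_path k i (j # p) \<longleftrightarrow> j < k i \<and> bounded_path k (Suc i) p"
  by (auto simp: bounded_path_def less_Suc_eq_0_disj)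

lemma set_paths: "set (paths k i n) = {p. bounded_path k i p \<and> length p < n}"
proof (induction n arbitrary: i)
  case (Suc n)
  show ?case
  proof (rule Set.set_eqI)
    show "p \<in> set (paths k i (Suc n)) \<longleftrightarrow> p \<in> {p. bounded_path k i p \<and> length p < Suc n}" for p
      by (cases p) (auto simp: Suc)
  qed
qed simp

lemma sorted_paths: "sorted_wrt (\<lambda>p q. (p, q) \<in> lexord less_than) (paths k i n)"
proof (induction n arbitrary: i)
  case (Suc n)
  have "sorted_wrt (\<lambda>p q. (p, q) \<in> lexord less_than) (concat (map (\<lambda>j. map (Cons j) (paths k (Suc i)
    n)) js))"
    if "sorted_wrt (<) js" for js
    using that
  proof (induction js)
    case (Cons j js)
    then show ?case
      using \<open>sorted_wrt _ (paths k (Suc i) n)\<close>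
      by (auto simp: sorted_wrt_append sorted_wrt_map)
  qed simp
  then show ?case by (auto simp: sorted_wrt_upt)
qed simp

lemma lexord_less_than_trans: "(p, q) \<in> lexord less_than \<Longrightarrow> (q, r) \<in> lexord less_than \<Longrightarrow>
  (p, r) \<in> lexord less_than"
  by (rule lexord_trans[OF _ _ trans_less_than])

lemma lexord_less_than_irrefl: "(p, p) \<notin> lexord less_than"
  by (rule lexord_irreflexive) simp

text \<open>The infinite word with \<open>w\<^sub>i = a\<^sub>i (w\<^sub>i\<^sub>+\<^sub>1)\<^sup>k\<close> for \<open>k = k i\<close>: a position is the list of
  the indices of the nested factors that contain it. In the lexicographic order a list precedes
  its extensions, so that the letter \<open>a\<^sub>i\<close> comes first. In the indexing of letters by pairs,
  \<open>a\<^sub>i\<close> is \<open>(i, True)\<close>.\<close>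

definition power_word :: "(nat \<Rightarrow> nat) \<Rightarrow> nat \<Rightarrow> word" where
  "power_word k i = Word (list_encode ` {p. bounded_path k i p})
     {(list_encode p, list_encode q) | p q. bounded_path k i p \<and> bounded_path k i q \<and>
       (p = q \<or> (p, q) \<in> lexord less_than)}
     (\<lambda>c. (i + length (list_decode c), True))"

lemma power_word_simps:
  "list_encode p \<in> positions (power_word k i) \<longleftrightarrow> bounded_path k i p"
  "(list_encode p, list_encode q) \<in> ord (power_word k i) \<longleftrightarrow>
     bounded_path k i p \<and> bounded_path k i q \<and> (p = q \<or> (p, q) \<in> lexord less_than)"
  "label (power_word k i) (list_encode p) = (i + length p, True)"
  by (auto simp: power_word_def list_encode_eq)

lemma list_encode_cases: obtains p where "c = list_encode p"
  by (metis list_decode_inverse)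

lemma is_word_power_word: "is_word (power_word k i)"
proof (rule is_wordI)
  show "c \<in> positions (power_word k i) \<and> c' \<in> positions (power_word k i)"
    if "(c, c') \<in> ord (power_word k i)" for c c'
    using that by (cases c rule: list_encode_cases; cases c' rule: list_encode_cases)
      (simp add: power_word_simps)
  show "(c, c) \<in> ord (power_word k i)" if "c \<in> positions (power_word k i)" for c
    using that by (cases c rule: list_encode_cases) (simp add: power_word_simps)
  show "c = c'" if "(c, c') \<in> ord (power_word k i)" "(c', c) \<in> ord (power_word k i)" for c c'
    using that lexord_less_than_trans lexord_less_than_irrefl
    by (cases c rule: list_encode_cases; cases c' rule: list_encode_cases)
      (simp add: power_word_simps, blast)
  show "(c, c'') \<in> ord (power_word k i)"
    if "(c, c') \<in> ord (power_word k i)" "(c', c'') \<in> ord (power_word k i)" for c c' c''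
    using that lexord_less_than_trans
    by (cases c rule: list_encode_cases; cases c' rule: list_encode_cases; cases c'' rule:
      list_encode_cases)
      (simp add: power_word_simps, blast)
  show "(c, c') \<in> ord (power_word k i) \<or> (c', c) \<in> ord (power_word k i)"
    if "c \<in> positions (power_word k i)" "c' \<in> positions (power_word k i)" for c c'
  proof -
    obtain p q where pq: "c = list_encode p" "c' = list_encode q" by (metis list_decode_inverse)
    have "(p, q) \<in> lexord less_than \<or> p = q \<or> (q, p) \<in> lexord less_than"
      by (rule lexord_linear) auto
    then show ?thesis using that unfolding pq power_word_simps by blast
  qed
  fix a
  \<comment> \<open>A letter determines the length of the path, and the bounds on the entries leave
    finitely many paths of that length.\<close>
  have "{c \<in> positions (power_word k i). label (power_word k i) c =
    a} \<subseteq> list_encode ` set (paths k i (Suc (fst a)))"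
  proof
    fix c assume "c \<in> {c \<in> positions (power_word k i). label (power_word k i) c = a}"
    then show "c \<in> list_encode ` set (paths k i (Suc (fst a)))"
      by (cases c rule: list_encode_cases)
        (auto simp: power_word_simps set_paths simp del: paths.simps)
  qed
  then show "finite {c \<in> positions (power_word k i). label (power_word k i) c = a}"
    using finite_subset by blast
qed

lemma word_proj_power_word: "word_proj n (power_word k i) =
  map (\<lambda>p. (i + length p, True)) (paths k i (n - i))"
proof -
  let ?cs = "map list_encode (paths k i (n - i))"
  have "word_proj n (power_word k i) = map (label (power_word k i)) ?cs"
  proof (rule word_projI[OF is_word_power_word])
    have "distinct (paths k i (n - i))"
      using sorted_paths[of k i "n - i"] lexord_less_than_irrefl
        by (auto simp: sorted_wrt_iff_nth_less distinct_conv_nth) (metis linorder_neqE_nat)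
    then show "distinct ?cs" by (simp add: distinct_map inj_list_encode)
    show "set ?cs = upto_positions n (power_word k i)"
    proof (rule Set.set_eqI)
      show "c \<in> set ?cs \<longleftrightarrow> c \<in> upto_positions n (power_word k i)" for c
        by (cases c rule: list_encode_cases)
          (auto simp: upto_positions_def power_word_simps set_paths letters_upto_def list_encode_eq)
    qed
    show "sorted_wrt (\<lambda>c c'. (c, c') \<in> ord (power_word k i)) ?cs"
      unfolding sorted_wrt_map
      by (rule sorted_wrt_mono_rel[OF _ sorted_paths]) (simp add: power_word_simps set_paths)
  qed
  then show ?thesis by (simp add: power_word_simps comp_def)
qed

text \<open>The label depends only on the length of a path, so the subtrees below the
  \<open>k i\<close> children all project to the same list.\<close>

lemma word_proj_power_word_Suc:
  assumes "i < n"
  shows "word_proj n (power_word k i) =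
    (i, True) # concat (replicate (k i) (word_proj n (power_word k (Suc i))))"
proof -
  have "n - i = Suc (n - Suc i)" using assms by simp
  then show ?thesis by (simp add: word_proj_power_word map_concat comp_def map_replicate_const)
qed

lemma red_proj_heg_pow:
  assumes w: "is_word w"
  shows "red_proj n (heg w [^]\<^bsub>HEG\<^esub> (j :: nat)) = red (concat (replicate j (word_proj n w)))"
proof (induction j)
  case (Suc j)
  have "concat (replicate (Suc j) (word_proj n w)) =
    concat (replicate j (word_proj n w)) @ word_proj n w"
    by (simp flip: replicate_append_same)
  then show ?case using w Suc by (simp add: red_proj_mult red_proj_heg del: replicate_Suc)
qed simp

lemma heg_power_word:
  "heg (power_word k i) =
    heg (finite_word [(i, True)]) \<otimes>\<^bsub>HEG\<^esub> heg (power_word k (Suc i)) [^]\<^bsub>HEG\<^esub> k i"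
proof (rule HEG_eqI)
  fix n
  have word: "is_word (power_word k i)" "is_word (power_word k (Suc i))"
    "is_word (finite_word [(i, True)])"
    by (rule is_word_power_word is_word_finite_word)+
  have "red_proj n (heg (finite_word [(i, True)]) \<otimes>\<^bsub>HEG\<^esub> heg (power_word k (Suc i)) [^]\<^bsub>HEG\<^esub> k i) =
      red (word_proj n (finite_word [(i, True)]) @ concat (replicate (k i)
        (word_proj n (power_word k (Suc i)))))"
    using word by (simp add: red_proj_mult red_proj_heg red_proj_heg_pow)
  also have "\<dots> = red (word_proj n (power_word k i))"
  proof (cases "i < n")
    case True
    then show ?thesis by (simp add: word_proj_power_word_Suc word_proj_finite_word letters_upto_def)
  next
    case False
    \<comment> \<open>For \<open>n \<le> i\<close> the truncated difference \<open>n - i\<close> is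
      0, and both sides are empty.\<close>
    then show ?thesis by (simp add: word_proj_power_word word_proj_finite_word letters_upto_def)
  qed
  finally show "red_proj n (heg (power_word k i)) =
      red_proj n (heg (finite_word [(i, True)]) \<otimes>\<^bsub>HEG\<^esub> heg (power_word k (Suc i)) [^]\<^bsub>HEG\<^esub> k i)"
    using word by (simp add: red_proj_heg)
qed (simp_all add: is_word_power_word is_word_finite_word)

lemma heg_power_word_neq_one: "heg (power_word k i) \<noteq> \<one>\<^bsub>HEG\<^esub>"
proof
  assume "heg (power_word k i) = \<one>\<^bsub>HEG\<^esub>"
  then have "red_proj (Suc i) (heg (power_word k i)) = []" by simp
  moreover have "word_proj (Suc i) (power_word k i) = [(i, True)]"
    by (simp add: word_proj_power_word comp_def map_replicate_const concat_replicate_trivial)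
  ultimately show False by (simp add: red_proj_heg is_word_power_word push_def)
qed

lemma no_free_acylindrical_action_HEG:
  assumes hyp: "hyperbolic_space S d" and acyl: "acylindrical_action HEG S d \<phi>"
    and free: "\<And>g. \<lbrakk>g \<in> carrier HEG; elliptic HEG S d \<phi> g\<rbrakk> \<Longrightarrow> g = \<one>\<^bsub>HEG\<^esub>"
  shows False
proof -
  interpret Metric_space S d using acyl by (simp add: acylindrical_action_def isometric_action_def)
  interpret group_action HEG S \<phi> using acyl
    by (simp add: acylindrical_action_def isometric_action_def)
  obtain x where x: "x \<in> S" using hyp unfolding hyperbolic_space_def by blast
  define a where "a i = heg (finite_word [(i, True)])" for i
  have a: "a i \<in> carrier HEG" for i by (simp add: a_def is_word_finite_word)
  \<comment> \<open>The required gain depends on \<open>i\<close> only through \<open>a i\<close>,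
    and the exponent is uniform in \<open>g\<close>. So the whole sequence \<open>k\<close> is
    chosen before the words built from it.\<close>
  have "\<forall>i. \<exists>k>0. \<forall>g\<in>carrier HEG. \<not> elliptic HEG S d \<phi> g \<longrightarrow>
      (\<forall>y\<in>S. d y (\<phi> (g [^]\<^bsub>HEG\<^esub> (k :: nat)) y) \<ge> d y (\<phi> g y) + (d x (\<phi> (a i) x) + 1))"
    using acylindrical_powers_displace[OF hyp acyl] by blast
  then obtain k :: "nat \<Rightarrow> nat" where k: "\<And>i g. \<lbrakk>g \<in> carrier HEG; \<not> elliptic HEG S d \<phi> g\<rbrakk> \<Longrightarrow>
      d x (\<phi> (g [^]\<^bsub>HEG\<^esub> k i) x) \<ge> d x (\<phi> g x) + (d x (\<phi> (a i) x) + 1)"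
    using x by metis
  define w where "w i = heg (power_word k i)" for i
  have w: "w i \<in> carrier HEG" for i by (simp add: w_def is_word_power_word)
  have "\<not> elliptic HEG S d \<phi> (w i)" for i
    using free[OF w] heg_power_word_neq_one[of k i] by (auto simp: w_def)
  then have pow: "d x (\<phi> (w (Suc i) [^]\<^bsub>HEG\<^esub> k i) x) \<ge>
    d x (\<phi> (w (Suc i)) x) + (d x (\<phi> (a i) x) + 1)" for i
    using k w by blast
  \<comment> \<open>Multiplication by \<open>a i\<close> can undo at most
    \<open>d x (\<phi> (a i) x)\<close> of the displacement, which was included in the gain; the
    surplus 1 remains.\<close>
  have step: "d x (\<phi> (w i) x) \<ge> d x (\<phi> (w (Suc i)) x) + 1" for i
  proof -
    define y where "y = \<phi> (w (Suc i) [^]\<^bsub>HEG\<^esub> k i) x"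
    have pc: "w (Suc i) [^]\<^bsub>HEG\<^esub> k i \<in> carrier HEG" using w by simp
    have y: "y \<in> S" unfolding y_def using pc x by (intro element_image[OF _ _ refl])
    have ax: "\<phi> (a i) x \<in> S" "\<phi> (a i) y \<in> S" using a x y by (auto intro: element_image)
    have "w i = a i \<otimes>\<^bsub>HEG\<^esub> w (Suc i) [^]\<^bsub>HEG\<^esub> k i" unfolding w_def a_def by (rule heg_power_word)
    then have "\<phi> (w i) x = \<phi> (a i) y" using composition_rule[OF x a pc] by (simp add: y_def)
    moreover have "d (\<phi> (a i) x) (\<phi> (a i) y) = d x y"
      using acyl a x y by (simp add: acylindrical_action_def isometric_action_def)
    moreover have "d (\<phi> (a i) x) (\<phi> (a i) y) \<le> d x (\<phi> (a i) x) + d x (\<phi> (a i) y)"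
      using triangle[OF ax(1) x ax(2)] commute[of x "\<phi> (a i) x"] by simp
    ultimately show ?thesis using pow[of i] by (simp add: y_def)
  qed
  have growth: "d x (\<phi> (w 0) x) \<ge> d x (\<phi> (w n) x) + real n" for n
  proof (induction n)
    case (Suc n)
    then show ?case using step[of n] by simp
  qed simp
  obtain n :: nat where "d x (\<phi> (w 0) x) < real n" using reals_Archimedean2 by blast
  then show False using growth[of n] nonneg[of x "\<phi> (w n) x"] by linarith
qed

theorem proposition6p6:
  "acylindrically_hyperbolic HEG \<and>
   elliptic_radical HEG = {\<one>\<^bsub>HEG\<^esub>} \<and>
   \<not> (\<exists>(S :: 's set) d \<phi>. hyperbolic_space S d \<and> universal_acylindrical_action HEG S d \<phi>)"
proof (intro conjI acylindrically_hyperbolic_HEG elliptic_radical_HEG notI)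
  assume "\<exists>(S :: 's set) d \<phi>. hyperbolic_space S d \<and> universal_acylindrical_action HEG S d \<phi>"
  then obtain S :: "'s set" and d \<phi> where hyp: "hyperbolic_space S d"
    and acyl: "acylindrical_action HEG S d \<phi>"
    and "{g \<in> carrier HEG. elliptic HEG S d \<phi> g} = {\<one>\<^bsub>HEG\<^esub>}"
    by (auto simp: universal_acylindrical_action_def elliptic_radical_HEG)
  then show False using no_free_acylindrical_action_HEG[OF hyp acyl] by blast
qed

end
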